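(* Every Coxeter group (of finite rank) has a virtual strong Remak decomposition, and this decomposition is unique up to equivalence.
   Context: A Coxeter group is a group $W$ generated by a finite set $S$ with relations $s^2=1$ for $s\in S$ and $(st)^{m_{s\,t}}=1$ for $s\neq t$ with $m_{s\,t}<+\infty$, where $m_{s\,s}=1$ and $m_{s\,t}=m_{t\,s}\in\{2,3,\dots,+\infty\}$ for $s\ne t$. A group is indecomposable if it has no proper non-trivial direct factor; it is strongly indecomposable if it is infinite and all its finite index subgroups are indecomposable. A virtual strong Remak decomposition of a group $G$ is a finite index subgroup $H$ of $G$ together with a decomposition $H=H_1\times\cdots\times H_m$ as a direct product of finitely many strongly indecomposable subgroups (the empty product, $m=0$ and $H=\{1\}$, is allowed). Two groups $G_1,G_2$ are commensurable if some finite index subgroup of $G_1$ is isomorphic to some finite index subgroup of $G_2$. Two virtual strong Remak decompositions $H=H_1\times\cdots\times H_p$ and $H'=H_1'\times\cdots\times H_q'$ of $G$ are equivalent if $p=q$ and, up to a permutation of the $H_i$'s, $H_i$ and $H_i'$ are commensurable for all $1\le i\le p$. *)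

theory Defs
  imports "HOL-Algebra.Algebra" "HOL-Library.Extended_Nat"
begin

section \<open>Group presentations\<close>

text \<open>A letter \<open>(s, True)\<close> stands for the generator \<open>s\<close>, and \<open>(s, False)\<close> for its formal inverse.\<close>

type_synonym 's gword = "('s \<times> bool) list"

inductive pres_step :: "'s set \<Rightarrow> 's gword set \<Rightarrow> 's gword \<Rightarrow> 's gword \<Rightarrow> bool"
  for S :: "'s set" and R :: "'s gword set" where
  cancel: "s \<in> S \<Longrightarrow> pres_step S R (u @ [(s, b), (s, \<not> b)] @ v) (u @ v)"
| relator: "r \<in> R \<Longrightarrow> pres_step S R (u @ r @ v) (u @ v)"

text \<open>If all relators are words over \<open>S\<close>, the classes of \<open>pres_eq S R\<close> on words over \<open>S\<close> are the
  elements of the group defined by generators \<open>S\<close> and relators \<open>R\<close>.\<close>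

definition pres_eq :: "'s set \<Rightarrow> 's gword set \<Rightarrow> 's gword \<Rightarrow> 's gword \<Rightarrow> bool" where
  "pres_eq S R = equivclp (pres_step S R)"

definition word_val :: "('a, 'b) monoid_scheme \<Rightarrow> 'a gword \<Rightarrow> 'a" where
  "word_val G w = foldr (\<lambda>(s, b) x. (if b then s else inv\<^bsub>G\<^esub> s) \<otimes>\<^bsub>G\<^esub> x) w \<one>\<^bsub>G\<^esub>"

text \<open>\<open>G\<close> is generated by its subset \<open>S\<close>, with \<open>R\<close> as a set of defining relators: evaluation of words
  induces an isomorphism from the group presented by \<open>S\<close> and \<open>R\<close> onto \<open>G\<close>.\<close>

definition has_presentation :: "('a, 'b) monoid_scheme \<Rightarrow> 'a set \<Rightarrow> 'a gword set \<Rightarrow> bool" where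
  "has_presentation G S R \<longleftrightarrow>
     group G \<and> S \<subseteq> carrier G \<and> R \<subseteq> lists (S \<times> UNIV) \<and> generate G S = carrier G \<and>
     (\<forall>u \<in> lists (S \<times> UNIV). \<forall>v \<in> lists (S \<times> UNIV).
        word_val G u = word_val G v \<longleftrightarrow> pres_eq S R u v)"


section \<open>Coxeter groups\<close>

definition coxeter_matrix :: "'s set \<Rightarrow> ('s \<Rightarrow> 's \<Rightarrow> enat) \<Rightarrow> bool" where
  "coxeter_matrix S m \<longleftrightarrow>
     (\<forall>s\<in>S. m s s = 1) \<and> (\<forall>s\<in>S. \<forall>t\<in>S. s \<noteq> t \<longrightarrow> m s t = m t s \<and> 2 \<le> m s t)"

definition coxeter_relators :: "'s set \<Rightarrow> ('s \<Rightarrow> 's \<Rightarrow> enat) \<Rightarrow> 's gword set" where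
  "coxeter_relators S m =
     {[(s, True), (s, True)] | s. s \<in> S} \<union>
     {concat (replicate k [(s, True), (t, True)]) | s t k. s \<in> S \<and> t \<in> S \<and> s \<noteq> t \<and> m s t = enat k}"

text \<open>The generators are taken as elements of \<open>W\<close>. This loses no generality: distinct abstract
  Coxeter generators always represent distinct elements of the presented group.\<close>

definition coxeter_group :: "('a, 'b) monoid_scheme \<Rightarrow> bool" where
  "coxeter_group W \<longleftrightarrow>
     (\<exists>S m. finite S \<and> coxeter_matrix S m \<and> has_presentation W S (coxeter_relators S m))"


section \<open>Direct decompositions\<close>

definition finite_index_subgroup :: "'a set \<Rightarrow> ('a, 'b) monoid_scheme \<Rightarrow> bool" where
  "finite_index_subgroup H G \<longleftrightarrow> subgroup H G \<and> finite (rcosets\<^bsub>G\<^esub> H)"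

text \<open>Internal direct product of a finite list of subgroups of \<open>G\<close>: multiplication, in the order of
  the list, is an isomorphism from the external direct product onto \<open>H\<close>. For the empty list this
  says \<open>H = {\<one>}\<close>.\<close>

definition is_direct_product :: "('a, 'b) monoid_scheme \<Rightarrow> 'a set \<Rightarrow> 'a set list \<Rightarrow> bool" where
  "is_direct_product G H Hs \<longleftrightarrow>
     subgroup H G \<and> (\<forall>K \<in> set Hs. subgroup K G) \<and>
     (\<lambda>x. foldr (\<lambda>i y. x i \<otimes>\<^bsub>G\<^esub> y) [0..<length Hs] \<one>\<^bsub>G\<^esub>)
       \<in> iso (product_group {..<length Hs} (\<lambda>i. G\<lparr>carrier := Hs ! i\<rparr>)) (G\<lparr>carrier := H\<rparr>)"

definition direct_factor :: "'a set \<Rightarrow> ('a, 'b) monoid_scheme \<Rightarrow> bool" where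
  "direct_factor K G \<longleftrightarrow> (\<exists>L. is_direct_product G (carrier G) [K, L])"

definition indecomposable :: "('a, 'b) monoid_scheme \<Rightarrow> bool" where
  "indecomposable G \<longleftrightarrow> (\<forall>K. direct_factor K G \<longrightarrow> K = {\<one>\<^bsub>G\<^esub>} \<or> K = carrier G)"

definition strongly_indecomposable :: "('a, 'b) monoid_scheme \<Rightarrow> bool" where
  "strongly_indecomposable G \<longleftrightarrow>
     infinite (carrier G) \<and>
     (\<forall>H. finite_index_subgroup H G \<longrightarrow> indecomposable (G\<lparr>carrier := H\<rparr>))"

definition virtual_strong_Remak_decomposition ::
    "('a, 'b) monoid_scheme \<Rightarrow> 'a set \<Rightarrow> 'a set list \<Rightarrow> bool" where
  "virtual_strong_Remak_decomposition G H Hs \<longleftrightarrow>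
     finite_index_subgroup H G \<and> is_direct_product G H Hs \<and>
     (\<forall>K \<in> set Hs. strongly_indecomposable (G\<lparr>carrier := K\<rparr>))"

definition commensurable :: "('a, 'b) monoid_scheme \<Rightarrow> ('c, 'd) monoid_scheme \<Rightarrow> bool" where
  "commensurable G1 G2 \<longleftrightarrow>
     (\<exists>K1 K2. finite_index_subgroup K1 G1 \<and> finite_index_subgroup K2 G2 \<and>
        G1\<lparr>carrier := K1\<rparr> \<cong> G2\<lparr>carrier := K2\<rparr>)"

text \<open>Equivalence does not involve the products \<open>H\<close>, \<open>H'\<close> themselves, only the lists of factors.\<close>

definition equivalent_decompositions ::
    "('a, 'b) monoid_scheme \<Rightarrow> 'a set list \<Rightarrow> 'a set list \<Rightarrow> bool" where
  "equivalent_decompositions G Hs Hs' \<longleftrightarrow>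
     length Hs = length Hs' \<and>
     (\<exists>\<pi>. \<pi> permutes {..<length Hs} \<and>
        (\<forall>i<length Hs. commensurable (G\<lparr>carrier := Hs ! \<pi> i\<rparr>) (G\<lparr>carrier := Hs' ! i\<rparr>)))"

end

theory Submission
  imports Defs
begin

text \<open>
  Existence. A Coxeter group \<open>W\<close> has a torsion-free subgroup of finite index, and the rank of its free
  abelian subgroups is at most the number of generators. Among the direct decompositions of finite
  index subgroups of the torsion-free subgroup into nontrivial factors there is therefore one with the
  largest number of factors, and maximality makes its factors strongly indecomposable
  (\<open>virtual_strong_Remak_decomposition_exists\<close>).

  Uniqueness. The decisive property is that a central element \<open>a\<close> of infinite order in a subgroup \<open>B\<close> of
  \<open>W\<close> is mapped to a nonzero integer by some homomorphism \<open>B \<rightarrow> \<int>\<close>. Such an element virtually splits off.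
  Hence a torsion-free strongly indecomposable subgroup either is virtually \<open>\<int>\<close>, or none of its finite
  index subgroups has a centre. In the second case a variant of the Krull-Remak-Schmidt argument applies:
  when a direct product is projected onto a finite index subgroup of a factor without centre, all
  factors but one have trivial image (\<open>dominating_factor\<close>). Comparing two decompositions in both
  directions gives the bijection between the factors (\<open>compare_decompositions\<close>).

  Homomorphisms to \<open>\<int>\<close>. They come from the root system. If \<open>a\<close> has infinite order, some root is odd: its
  images under the powers of \<open>a\<close> are finally positive in one direction and finally negative in the other
  (\<open>odd_root_exists\<close>); otherwise the powers of \<open>a\<close> would have bounded length. For the orbit of such a root
  under \<open>B\<close>, the map sending \<open>w\<close> to the number of roots of the orbit that become positive minus the number
  of those that become negative is a homomorphism, and all crossings for a high power of \<open>a\<close> have the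
  same sign (\<open>net_crossing_mult\<close>, \<open>net_crossing_nonzero\<close>).

  Rank. In an abelian subgroup the kernel of this homomorphism virtually fixes the root, while \<open>a\<close> moves
  it along an infinite orbit. Choosing elements successively in the kernels of the homomorphisms found
  so far yields as many linearly independent roots as the rank (\<open>commuting_rank_bound\<close>).

  Coxeter groups. That roots have a sign, and that the geometric representation is faithful, is the
  theorem of Tits (\<open>ascent_nonneg\<close>). The representation preserves a lattice over the ring generated by the
  numbers \<open>2 cos (\<pi> / q)\<close>, which is finitely generated as an abelian group; the congruence subgroups for
  two different primes meet in a torsion-free subgroup of finite index (\<open>congruence_torsion_free\<close>).
\<close>

section \<open>Subgroups of finite index\<close>

definition fin_index :: "('a, 'b) monoid_scheme \<Rightarrow> 'a set \<Rightarrow> 'a set \<Rightarrow> bool" where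
  "fin_index G H K \<longleftrightarrow> subgroup H G \<and> subgroup K G \<and> H \<subseteq> K \<and> finite ((\<lambda>x. H #>\<^bsub>G\<^esub> x) ` K)"

context group
begin

lemma subgroup_in_subgroup_iff:
  assumes "subgroup K G"
  shows "subgroup H (G\<lparr>carrier := K\<rparr>) \<longleftrightarrow> subgroup H G \<and> H \<subseteq> K"
proof
  assume *: "subgroup H (G\<lparr>carrier := K\<rparr>)"
  show "subgroup H G \<and> H \<subseteq> K"
    using incl_subgroup[OF assms *] subgroup.subset[OF *] by simp
qed (use assms subgroup_incl in blast)

lemma finite_index_subgroup_iff:
  assumes "subgroup K G"
  shows "finite_index_subgroup H (G\<lparr>carrier := K\<rparr>) \<longleftrightarrow> fin_index G H K"
proof -
  have "(rcosets\<^bsub>G\<lparr>carrier := K\<rparr>\<^esub> H) = (\<lambda>x. H #> x) ` K"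
    by (auto simp: RCOSETS_def r_coset_def)
  then show ?thesis
    using assms by (auto simp: finite_index_subgroup_def fin_index_def subgroup_in_subgroup_iff)
qed

lemma finite_index_subgroup_carrier_iff:
  "finite_index_subgroup H G \<longleftrightarrow> fin_index G H (carrier G)"
  using finite_index_subgroup_iff[OF subgroup_self, of H] by simp

text \<open>Finiteness of the index is always established by exhibiting a map with finite image that
  separates the cosets; this avoids all manipulation of coset representatives.\<close>

lemma fin_indexI:
  assumes H: "subgroup H G" and K: "subgroup K G" "H \<subseteq> K" and fin: "finite (f ` K)"
    and f: "\<And>x y. x \<in> K \<Longrightarrow> y \<in> K \<Longrightarrow> f x = f y \<Longrightarrow> x \<otimes> inv y \<in> H"
  shows "fin_index G H K"
proof -
  have "(\<lambda>x. H #> x) ` K \<subseteq> (\<lambda>v. H #> (SOME x. x \<in> K \<and> f x = v)) ` (f ` K)"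
  proof
    fix C assume "C \<in> (\<lambda>x. H #> x) ` K"
    then obtain x where x: "x \<in> K" "C = H #> x" by blast
    define y where "y = (SOME y. y \<in> K \<and> f y = f x)"
    have y: "y \<in> K \<and> f y = f x"
      unfolding y_def by (rule someI[of _ x]) (use x in simp)
    have carr: "x \<in> carrier G" "y \<in> carrier G"
      using x y K subgroup.subset by blast+
    have "y \<otimes> inv x \<in> H" using f[of y x] x y by simp
    then have "y \<in> H #> x"
      using subgroup.rcos_module[OF H is_group carr] by simp
    then have "H #> x = H #> y" using repr_independence[OF _ carr(1) H] by simp
    then show "C \<in> (\<lambda>v. H #> (SOME x. x \<in> K \<and> f x = v)) ` (f ` K)"
      using x y y_def by blast
  qed
  then have "finite ((\<lambda>x. H #> x) ` K)" using fin finite_surj by blast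
  then show ?thesis using H K by (simp add: fin_index_def)
qed

lemma fin_index_cosetD:
  assumes "fin_index G H K" "x \<in> K" "y \<in> K" "H #> x = H #> y"
  shows "x \<otimes> inv y \<in> H"
proof -
  have H: "subgroup H G" and carr: "x \<in> carrier G" "y \<in> carrier G"
    using assms subgroup.subset unfolding fin_index_def by blast+
  have "x \<in> H #> y" using assms(4) rcos_self[OF carr(1) H] by simp
  then show ?thesis using subgroup.rcos_module[OF H is_group carr(2,1)] by simp
qed

lemma fin_index_refl: "subgroup K G \<Longrightarrow> fin_index G K K"
  by (rule fin_indexI[where f = "\<lambda>_. ()"]) (auto simp: subgroup.m_closed subgroup.m_inv_closed)

lemma fin_index_trans:
  assumes "fin_index G H K" "fin_index G K L"
  shows "fin_index G H L"
proof -
  have sub: "subgroup H G" "subgroup K G" "subgroup L G" "H \<subseteq> K" "K \<subseteq> L"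
    using assms unfolding fin_index_def by auto
  define r where "r x = (SOME y. y \<in> L \<and> K #> y = K #> x)" for x
  have r: "r x \<in> L \<and> K #> r x = K #> x" if "x \<in> L" for x
    unfolding r_def by (rule someI[of _ x]) (use that in simp)
  have rK: "x \<otimes> inv (r x) \<in> K" if "x \<in> L" for x
    using fin_index_cosetD[OF assms(2) that] r[OF that] by metis
  \<comment> \<open>the coset of \<open>x\<close> modulo \<open>H\<close> is recovered from the coset \<open>K x\<close>, with chosen representative
    \<open>r x\<close>, and from the coset modulo \<open>H\<close> of the element \<open>x (r x)^-1\<close> of \<open>K\<close>\<close>
  define f where "f x = (K #> x, H #> (x \<otimes> inv (r x)))" for x
  have "f ` L \<subseteq> ((\<lambda>x. K #> x) ` L) \<times> ((\<lambda>x. H #> x) ` K)"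
    using rK by (auto simp: f_def)
  then have fin: "finite (f ` L)"
    using assms unfolding fin_index_def by (meson finite_SigmaI finite_subset)
  show ?thesis
  proof (rule fin_indexI[OF sub(1) sub(3) _ fin])
    show "H \<subseteq> L" using sub by blast
    fix x y assume xy: "x \<in> L" "y \<in> L" "f x = f y"
    have carr: "x \<in> carrier G" "y \<in> carrier G" "r x \<in> carrier G"
      using xy r sub subgroup.subset by blast+
    have rr: "r x = r y" using xy by (simp add: f_def r_def)
    have "(x \<otimes> inv (r x)) \<otimes> inv (y \<otimes> inv (r x)) \<in> H"
      using fin_index_cosetD[OF assms(1) rK[OF xy(1)] rK[OF xy(2)]] xy rr by (simp add: f_def)
    moreover have "(x \<otimes> inv (r x)) \<otimes> inv (y \<otimes> inv (r x)) = x \<otimes> inv y"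
      using carr by (simp add: inv_mult_group m_assoc[symmetric])
         (simp add: m_assoc)
    ultimately show "x \<otimes> inv y \<in> H" by simp
  qed
qed

lemma fin_index_Int:
  assumes "fin_index G H K" "subgroup M G" "M \<subseteq> K"
  shows "fin_index G (H \<inter> M) M"
proof (rule fin_indexI[where f = "\<lambda>x. H #> x"])
  show "subgroup (H \<inter> M) G"
    using assms subgroups_Inter_pair unfolding fin_index_def by blast
  show "finite ((\<lambda>x. H #> x) ` M)"
    using assms unfolding fin_index_def by (meson finite_subset image_mono)
  show "x \<otimes> inv y \<in> H \<inter> M" if "x \<in> M" "y \<in> M" "H #> x = H #> y" for x y
    using fin_index_cosetD[OF assms(1), of x y] that assms
    by (auto simp: subgroup.m_closed subgroup.m_inv_closed)
qed (use assms in blast)+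

lemma fin_index_restrict:
  assumes "fin_index G H K" "subgroup M G" "H \<subseteq> M" "M \<subseteq> K"
  shows "fin_index G H M"
proof -
  have "H \<inter> M = H" using assms(3) by blast
  then show ?thesis using fin_index_Int[OF assms(1,2,4)] by metis
qed

lemma fin_index_infinite:
  assumes "fin_index G H K" "infinite K"
  shows "infinite H"
proof
  assume fin: "finite H"
  have "K \<subseteq> \<Union> ((\<lambda>x. H #> x) ` K)"
  proof
    fix x assume x: "x \<in> K"
    then have "x \<in> H #> x"
      using assms(1) rcos_self[of x H] subgroup.mem_carrier unfolding fin_index_def by metis
    then show "x \<in> \<Union> ((\<lambda>x. H #> x) ` K)" using x by blast
  qed
  moreover have "finite (\<Union> ((\<lambda>x. H #> x) ` K))"
  proof (rule finite_Union)
    show "finite ((\<lambda>x. H #> x) ` K)" using assms(1) unfolding fin_index_def by blast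
    show "finite M" if "M \<in> (\<lambda>x. H #> x) ` K" for M
      using that fin by (auto simp: r_coset_def)
  qed
  ultimately show False using assms(2) finite_subset by blast
qed

lemma subgroup_hom_image:
  assumes "subgroup K G" "\<And>x. x \<in> K \<Longrightarrow> p x \<in> carrier G"
    and "\<And>x y. x \<in> K \<Longrightarrow> y \<in> K \<Longrightarrow> p (x \<otimes> y) = p x \<otimes> p y"
  shows "subgroup (p ` K) G"
proof -
  have "group_hom (G\<lparr>carrier := K\<rparr>) G p"
    using assms by (auto simp: group_hom_def group_hom_axioms_def hom_def subgroup_imp_group)
  then have "subgroup (p ` carrier (G\<lparr>carrier := K\<rparr>)) G"
    using group_hom.img_is_subgroup by blast
  then show ?thesis by simp
qed

lemma hom_on_subgroup:
  assumes "subgroup K G" "\<And>x. x \<in> K \<Longrightarrow> p x \<in> carrier G"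
    and "\<And>x y. x \<in> K \<Longrightarrow> y \<in> K \<Longrightarrow> p (x \<otimes> y) = p x \<otimes> p y"
  shows hom_on_one: "p \<one> = \<one>" and hom_on_inv: "\<And>x. x \<in> K \<Longrightarrow> p (inv x) = inv (p x)"
proof -
  have h: "group_hom (G\<lparr>carrier := K\<rparr>) G p"
    using assms by (auto simp: group_hom_def group_hom_axioms_def hom_def subgroup_imp_group)
  show "p \<one> = \<one>" using group_hom.hom_one[OF h] by simp
  show "p (inv x) = inv (p x)" if "x \<in> K" for x
    using group_hom.hom_inv[OF h, of x] that m_inv_consistent[OF assms(1) that] by simp
qed

lemma fin_index_hom_image:
  assumes "fin_index G H K" and carr: "\<And>x. x \<in> K \<Longrightarrow> p x \<in> carrier G"
    and hom: "\<And>x y. x \<in> K \<Longrightarrow> y \<in> K \<Longrightarrow> p (x \<otimes> y) = p x \<otimes> p y"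
  shows "fin_index G (p ` H) (p ` K)"
proof -
  have sub: "subgroup H G" "subgroup K G" "H \<subseteq> K"
    using assms unfolding fin_index_def by auto
  define r where "r v = (SOME x. x \<in> K \<and> p x = v)" for v
  have r: "r v \<in> K \<and> p (r v) = v" if "v \<in> p ` K" for v
    unfolding r_def by (rule someI_ex) (use that in auto)
  show ?thesis
  proof (rule fin_indexI[where f = "\<lambda>v. H #> r v"])
    show "subgroup (p ` H) G" by (rule subgroup_hom_image) (use sub carr hom in blast)+
    show "subgroup (p ` K) G" by (rule subgroup_hom_image) (use sub carr hom in blast)+
    show "p ` H \<subseteq> p ` K" using sub by blast
    have "(\<lambda>v. H #> r v) ` (p ` K) \<subseteq> (\<lambda>x. H #> x) ` K" using r by blast
    then show "finite ((\<lambda>v. H #> r v) ` (p ` K))"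
      using assms(1) finite_subset unfolding fin_index_def by blast
    fix u v assume uv: "u \<in> p ` K" "v \<in> p ` K" "H #> r u = H #> r v"
    have "r u \<otimes> inv (r v) \<in> H" using fin_index_cosetD[OF assms(1)] r uv by blast
    moreover have "p (r u \<otimes> inv (r v)) = u \<otimes> inv v"
      using r uv hom hom_on_inv[OF sub(2) carr hom] subgroup.m_inv_closed[OF sub(2)] by simp
    ultimately show "u \<otimes> inv v \<in> p ` H" by force
  qed
qed

end

section \<open>Internal direct products\<close>

definition lprod :: "('a, 'b) monoid_scheme \<Rightarrow> 'a list \<Rightarrow> 'a" where
  "lprod G xs = foldr (\<lambda>x y. x \<otimes>\<^bsub>G\<^esub> y) xs \<one>\<^bsub>G\<^esub>"

definition direct_decomp :: "('a, 'b) monoid_scheme \<Rightarrow> 'a set \<Rightarrow> 'a set list \<Rightarrow> bool" where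
  "direct_decomp G H Hs \<longleftrightarrow>
     subgroup H G \<and> (\<forall>i<length Hs. subgroup (Hs ! i) G) \<and>
     (\<forall>i<length Hs. \<forall>j<length Hs. i \<noteq> j \<longrightarrow>
        (\<forall>x\<in>Hs ! i. \<forall>y\<in>Hs ! j. x \<otimes>\<^bsub>G\<^esub> y = y \<otimes>\<^bsub>G\<^esub> x)) \<and>
     (\<forall>x. (\<forall>i<length Hs. x i \<in> Hs ! i) \<longrightarrow> lprod G (map x [0..<length Hs]) = \<one>\<^bsub>G\<^esub> \<longrightarrow>
        (\<forall>i<length Hs. x i = \<one>\<^bsub>G\<^esub>)) \<and>
     H = {lprod G (map x [0..<length Hs]) | x. \<forall>i<length Hs. x i \<in> Hs ! i}"

text \<open>Coordinates with respect to a direct decomposition, recorded by all the identities that determine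
  them. They turn statements about lists of factors into statements about homomorphisms.\<close>

definition projections ::
    "('a, 'b) monoid_scheme \<Rightarrow> 'a set \<Rightarrow> 'a set list \<Rightarrow> (nat \<Rightarrow> 'a \<Rightarrow> 'a) \<Rightarrow> bool" where
  "projections G H Hs q \<longleftrightarrow>
     (\<forall>i<length Hs. \<forall>x\<in>H. q i x \<in> Hs ! i) \<and>
     (\<forall>i<length Hs. \<forall>x\<in>H. \<forall>y\<in>H. q i (x \<otimes>\<^bsub>G\<^esub> y) = q i x \<otimes>\<^bsub>G\<^esub> q i y) \<and>
     (\<forall>x\<in>H. lprod G (map (\<lambda>i. q i x) [0..<length Hs]) = x) \<and>
     (\<forall>x i. (\<forall>i<length Hs. x i \<in> Hs ! i) \<longrightarrow> i < length Hs \<longrightarrow>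
        q i (lprod G (map x [0..<length Hs])) = x i) \<and>
     (\<forall>i<length Hs. \<forall>x\<in>Hs ! i. x \<in> H \<and> q i x = x) \<and>
     (\<forall>i<length Hs. \<forall>j<length Hs. i \<noteq> j \<longrightarrow> (\<forall>x\<in>Hs ! j. q i x = \<one>\<^bsub>G\<^esub>))"

context group
begin

lemma lprod_Nil [simp]: "lprod G [] = \<one>"
  and lprod_Cons [simp]: "lprod G (x # xs) = x \<otimes> lprod G xs"
  by (auto simp: lprod_def)

lemma lprod_closed [simp, intro]: "set xs \<subseteq> carrier G \<Longrightarrow> lprod G xs \<in> carrier G"
  by (induction xs) auto

lemma lprod_append:
  "set xs \<subseteq> carrier G \<Longrightarrow> set ys \<subseteq> carrier G \<Longrightarrow> lprod G (xs @ ys) = lprod G xs \<otimes> lprod G ys"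
  by (induction xs) (auto simp: m_assoc)

lemma lprod_commute:
  assumes "set xs \<subseteq> carrier G" "y \<in> carrier G" "\<And>x. x \<in> set xs \<Longrightarrow> x \<otimes> y = y \<otimes> x"
  shows "lprod G xs \<otimes> y = y \<otimes> lprod G xs"
  using assms
proof (induction xs)
  case (Cons x xs)
  then have "lprod G (x # xs) \<otimes> y = x \<otimes> (y \<otimes> lprod G xs)" by (simp add: m_assoc)
  also have "\<dots> = y \<otimes> lprod G (x # xs)" using Cons by (simp add: m_assoc[symmetric])
  finally show ?case .
qed simp

text \<open>Only factors with different indices are required to commute; the two factors with the same index
  stand next to each other after the rearrangement, in the right order.\<close>

lemma lprod_mult:
  assumes "distinct is" "\<And>i. i \<in> set is \<Longrightarrow> x i \<in> carrier G" "\<And>i. i \<in> set is \<Longrightarrow> y i \<in> carrier G"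
    and "\<And>i j. i \<in> set is \<Longrightarrow> j \<in> set is \<Longrightarrow> i \<noteq> j \<Longrightarrow> x i \<otimes> y j = y j \<otimes> x i"
  shows "lprod G (map (\<lambda>i. x i \<otimes> y i) is) = lprod G (map x is) \<otimes> lprod G (map y is)"
  using assms
proof (induction "is")
  case (Cons a as)
  have X: "lprod G (map x as) \<in> carrier G" and Y: "lprod G (map y as) \<in> carrier G"
    using Cons.prems by (auto intro!: lprod_closed)
  have comm: "lprod G (map x as) \<otimes> y a = y a \<otimes> lprod G (map x as)"
    by (rule lprod_commute) (use Cons.prems in auto)
  have "lprod G (map (\<lambda>i. x i \<otimes> y i) (a # as)) = x a \<otimes> y a \<otimes> (lprod G (map x as) \<otimes> lprod G (map y as))"
    using Cons by simp
  also have "\<dots> = x a \<otimes> ((y a \<otimes> lprod G (map x as)) \<otimes> lprod G (map y as))"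
    using Cons.prems X Y by (simp add: m_assoc)
  also have "\<dots> = x a \<otimes> ((lprod G (map x as) \<otimes> y a) \<otimes> lprod G (map y as))" by (simp add: comm)
  also have "\<dots> = lprod G (map x (a # as)) \<otimes> lprod G (map y (a # as))"
    using Cons.prems X Y by (simp add: m_assoc)
  finally show ?case .
qed simp

lemma lprod_one: "(\<And>i. i \<in> set is \<Longrightarrow> x i = \<one>) \<Longrightarrow> lprod G (map x is) = \<one>"
  by (induction "is") auto

lemma lprod_single:
  assumes "distinct is" "i \<in> set is" "a \<in> carrier G"
  shows "lprod G (map (\<lambda>k. if k = i then a else \<one>) is) = a"
  using assms
proof (induction "is")
  case (Cons k ks)
  show ?case
  proof (cases "k = i")
    case True
    then have "lprod G (map (\<lambda>k. if k = i then a else \<one>) ks) = \<one>"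
      using Cons.prems by (intro lprod_one) auto
    then show ?thesis using True Cons.prems by simp
  qed (use Cons in auto)
qed simp

lemma direct_decompD:
  assumes "direct_decomp G H Hs"
  shows "subgroup H G" "\<And>i. i < length Hs \<Longrightarrow> subgroup (Hs ! i) G"
    and "\<And>i j x y. i < length Hs \<Longrightarrow> j < length Hs \<Longrightarrow> i \<noteq> j \<Longrightarrow> x \<in> Hs ! i \<Longrightarrow> y \<in> Hs ! j \<Longrightarrow>
           x \<otimes> y = y \<otimes> x"
    and "\<And>x i. (\<And>i. i < length Hs \<Longrightarrow> x i \<in> Hs ! i) \<Longrightarrow> lprod G (map x [0..<length Hs]) = \<one> \<Longrightarrow>
           i < length Hs \<Longrightarrow> x i = \<one>"
    and "\<And>x. (\<And>i. i < length Hs \<Longrightarrow> x i \<in> Hs ! i) \<Longrightarrow> lprod G (map x [0..<length Hs]) \<in> H"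
    and "\<And>h. h \<in> H \<Longrightarrow> \<exists>x. h = lprod G (map x [0..<length Hs]) \<and> (\<forall>i<length Hs. x i \<in> Hs ! i)"
  using assms unfolding direct_decomp_def by blast+

text \<open>As the factors commute elementwise, their product set is closed under multiplication and inverses,
  hence a subgroup.\<close>

lemma direct_decompI:
  assumes sub: "\<And>i. i < length Hs \<Longrightarrow> subgroup (Hs ! i) G"
    and comm: "\<And>i j x y. i < length Hs \<Longrightarrow> j < length Hs \<Longrightarrow> i \<noteq> j \<Longrightarrow> x \<in> Hs ! i \<Longrightarrow> y \<in> Hs ! j \<Longrightarrow>
           x \<otimes> y = y \<otimes> x"
    and one: "\<And>x i. (\<And>i. i < length Hs \<Longrightarrow> x i \<in> Hs ! i) \<Longrightarrow> lprod G (map x [0..<length Hs]) = \<one> \<Longrightarrow>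
           i < length Hs \<Longrightarrow> x i = \<one>"
    and H: "H = {lprod G (map x [0..<length Hs]) | x. \<forall>i<length Hs. x i \<in> Hs ! i}"
  shows "direct_decomp G H Hs"
proof -
  let ?n = "length Hs"
  have carr: "x i \<in> carrier G" if "\<forall>i<?n. x i \<in> Hs ! i" "i < ?n" for x i
    using that sub subgroup.subset by blast
  have mult: "lprod G (map (\<lambda>i. x i \<otimes> y i) [0..<?n]) = lprod G (map x [0..<?n]) \<otimes> lprod G (map y [0..<?n])"
    if "\<forall>i<?n. x i \<in> Hs ! i" "\<forall>i<?n. y i \<in> Hs ! i" for x y
    by (rule lprod_mult) (use that carr comm in auto)
  have "subgroup H G"
  proof (rule subgroupI)
    show "H \<subseteq> carrier G" using carr by (auto simp: H intro!: lprod_closed)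
    have "lprod G (map (\<lambda>_. \<one>) [0..<?n]) \<in> H"
      using sub by (auto simp: H subgroup.one_closed intro!: exI[of _ "\<lambda>_. \<one>"])
    then show "H \<noteq> {}" by blast
    fix a assume "a \<in> H"
    then obtain x where x: "a = lprod G (map x [0..<?n])" "\<forall>i<?n. x i \<in> Hs ! i" by (auto simp: H)
    have y: "\<forall>i<?n. inv (x i) \<in> Hs ! i" using x sub by (simp add: subgroup.m_inv_closed)
    have "lprod G (map (\<lambda>i. inv (x i)) [0..<?n]) \<otimes> a = \<one>"
      unfolding x mult[OF y x(2), symmetric]
      by (rule lprod_one) (use x carr in auto)
    then have "inv a = lprod G (map (\<lambda>i. inv (x i)) [0..<?n])"
      using x carr y by (intro inv_equality) (auto intro!: lprod_closed)
    then show "inv a \<in> H" using y by (auto simp: H)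
  next
    fix a b assume "a \<in> H" "b \<in> H"
    then obtain x y where x: "a = lprod G (map x [0..<?n])" "\<forall>i<?n. x i \<in> Hs ! i"
      and y: "b = lprod G (map y [0..<?n])" "\<forall>i<?n. y i \<in> Hs ! i" by (auto simp: H)
    have "a \<otimes> b = lprod G (map (\<lambda>i. x i \<otimes> y i) [0..<?n])" using mult x y by simp
    then show "a \<otimes> b \<in> H"
      using x y sub by (auto simp: H subgroup.m_closed intro!: exI[of _ "\<lambda>i. x i \<otimes> y i"])
  qed
  then show ?thesis unfolding direct_decomp_def using assms by blast
qed

lemma direct_decomp_projections:
  assumes dd: "direct_decomp G H Hs"
  obtains q where "projections G H Hs q"
proof -
  let ?n = "length Hs"
  note D = direct_decompD[OF dd]
  have carr: "x i \<in> carrier G" if "\<And>i. i < ?n \<Longrightarrow> x i \<in> Hs ! i" "i < ?n" for x i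
    using that D(2) subgroup.subset by blast
  have mult: "lprod G (map (\<lambda>i. x i \<otimes> y i) [0..<?n]) = lprod G (map x [0..<?n]) \<otimes> lprod G (map y [0..<?n])"
    if "\<And>i. i < ?n \<Longrightarrow> x i \<in> Hs ! i" "\<And>i. i < ?n \<Longrightarrow> y i \<in> Hs ! i" for x y
    by (rule lprod_mult) (use carr[of x] carr[of y] that D(3) in auto)
  have uniq: "x i = y i"
    if x: "\<And>i. i < ?n \<Longrightarrow> x i \<in> Hs ! i" and y: "\<And>i. i < ?n \<Longrightarrow> y i \<in> Hs ! i" and i: "i < ?n"
      and eq: "lprod G (map x [0..<?n]) = lprod G (map y [0..<?n])" for x y i
  proof -
    have z: "inv (y i) \<in> Hs ! i" if "i < ?n" for i
      using y that D(2) by (simp add: subgroup.m_inv_closed)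
    have xz: "x i \<otimes> inv (y i) \<in> Hs ! i" if "i < ?n" for i
      using z x that D(2) by (simp add: subgroup.m_closed)
    have "lprod G (map (\<lambda>i. x i \<otimes> inv (y i)) [0..<?n]) =
        lprod G (map y [0..<?n]) \<otimes> lprod G (map (\<lambda>i. inv (y i)) [0..<?n])"
      using mult[of x, OF x z] eq by simp
    also have "\<dots> = lprod G (map (\<lambda>i. y i \<otimes> inv (y i)) [0..<?n])"
      using mult[of y "\<lambda>i. inv (y i)"] y z by simp
    also have "\<dots> = \<one>"
      by (rule lprod_one) (use carr[of y, OF y] in auto)
    finally have "x i \<otimes> inv (y i) = \<one>"
      using D(4)[of "\<lambda>i. x i \<otimes> inv (y i)" i, OF xz _ i] by blast
    then show ?thesis using carr[of x, OF x i] carr[of y, OF y i]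
      by (metis inv_closed inv_equality inv_inv)
  qed
  define c where "c h = (SOME x. h = lprod G (map x [0..<?n]) \<and> (\<forall>i<?n. x i \<in> Hs ! i))" for h
  have c: "h = lprod G (map (c h) [0..<?n]) \<and> (\<forall>i<?n. c h i \<in> Hs ! i)" if "h \<in> H" for h
    unfolding c_def by (rule someI_ex[OF D(6)[OF that]])
  have cl: "c (lprod G (map x [0..<?n])) i = x i" if "\<And>i. i < ?n \<Longrightarrow> x i \<in> Hs ! i" "i < ?n" for x i
  proof (rule uniq[of _ x])
    let ?h = "lprod G (map x [0..<?n])"
    have "?h \<in> H" using D(5) that by blast
    from c[OF this] show "c ?h i \<in> Hs ! i" if "i < ?n" for i using that by blast
    from c[OF \<open>?h \<in> H\<close>] show "lprod G (map (c ?h) [0..<?n]) = ?h" by simp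
  qed (use that in auto)
  have single: "x = lprod G (map (\<lambda>k. if k = i then x else \<one>) [0..<?n])"
    "\<And>k. k < ?n \<Longrightarrow> (if k = i then x else \<one>) \<in> Hs ! k" if "i < ?n" "x \<in> Hs ! i" for i x
  proof -
    have "x \<in> carrier G" using that D(2) subgroup.subset by blast
    then show "x = lprod G (map (\<lambda>k. if k = i then x else \<one>) [0..<?n])"
      using lprod_single[of "[0..<?n]" i x] that(1) by simp
    show "(if k = i then x else \<one>) \<in> Hs ! k" if "k < ?n" for k
      using that \<open>x \<in> Hs ! i\<close> D(2)[OF that] subgroup.one_closed by auto
  qed
  have cs: "c x k = (if k = i then x else \<one>)" if "i < ?n" "x \<in> Hs ! i" "k < ?n" for i x k
    using cl[of "\<lambda>k. if k = i then x else \<one>" k] single[OF that(1,2)] that by metis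
  show thesis
  proof (rule that[of "\<lambda>i h. c h i"], unfold projections_def, intro conjI allI impI ballI)
    fix i x y assume i: "i < ?n" and xy: "x \<in> H" "y \<in> H"
    have cx: "\<And>i. i < ?n \<Longrightarrow> c x i \<in> Hs ! i" and cy: "\<And>i. i < ?n \<Longrightarrow> c y i \<in> Hs ! i"
      using c xy by blast+
    have "x \<otimes> y = lprod G (map (\<lambda>i. c x i \<otimes> c y i) [0..<?n])"
      using mult[of "c x" "c y", OF cx cy] c[OF xy(1)] c[OF xy(2)] by simp
    then show "c (x \<otimes> y) i = c x i \<otimes> c y i"
      using cl[of "\<lambda>i. c x i \<otimes> c y i" i] cx cy i D(2) by (simp add: subgroup.m_closed)
  next
    fix i x assume ix: "i < ?n" "x \<in> Hs ! i"
    show "c x i = x" using cs[OF ix ix(1)] by simp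
    have "lprod G (map (\<lambda>k. if k = i then x else \<one>) [0..<?n]) \<in> H"
      by (rule D(5)) (use single(2)[OF ix] in blast)
    then show "x \<in> H" using single(1)[OF ix] by simp
  next
    show "c h i \<in> Hs ! i" if "i < ?n" "h \<in> H" for i h using c that by blast
    show "lprod G (map (\<lambda>i. c h i) [0..<?n]) = h" if "h \<in> H" for h using c[OF that] by simp
    show "c (lprod G (map x [0..<?n])) i = x i" if "\<forall>i<?n. x i \<in> Hs ! i" "i < ?n" for x i
      using cl that by blast
    show "c x i = \<one>" if "i < ?n" "j < ?n" "i \<noteq> j" "x \<in> Hs ! j" for i j x
      using cs[OF that(2,4,1)] that(3) by simp
  qed
qed

lemma projectionsD:
  assumes "projections G H Hs q"
  shows "\<And>i x. i < length Hs \<Longrightarrow> x \<in> H \<Longrightarrow> q i x \<in> Hs ! i"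
    and "\<And>i x y. i < length Hs \<Longrightarrow> x \<in> H \<Longrightarrow> y \<in> H \<Longrightarrow> q i (x \<otimes> y) = q i x \<otimes> q i y"
    and "\<And>x. x \<in> H \<Longrightarrow> lprod G (map (\<lambda>i. q i x) [0..<length Hs]) = x"
    and "\<And>x i. (\<And>i. i < length Hs \<Longrightarrow> x i \<in> Hs ! i) \<Longrightarrow> i < length Hs \<Longrightarrow>
        q i (lprod G (map x [0..<length Hs])) = x i"
    and "\<And>i x. i < length Hs \<Longrightarrow> x \<in> Hs ! i \<Longrightarrow> x \<in> H"
    and "\<And>i x. i < length Hs \<Longrightarrow> x \<in> Hs ! i \<Longrightarrow> q i x = x"
    and "\<And>i j x. i < length Hs \<Longrightarrow> j < length Hs \<Longrightarrow> i \<noteq> j \<Longrightarrow> x \<in> Hs ! j \<Longrightarrow> q i x = \<one>"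
  using assms unfolding projections_def by blast+

text \<open>The isomorphism condition on the external product says three things: being a homomorphism
  amounts to elementwise commutation of different factors (test it on tuples with one nontrivial
  entry), injectivity to the uniqueness of the expression of \<open>\<one>\<close>, surjectivity to \<open>H\<close> being the product
  set.\<close>

lemma is_direct_product_iff:
  assumes subK: "subgroup K G" and HK: "H \<subseteq> K" and KsK: "\<And>i. i < length Hs \<Longrightarrow> Hs ! i \<subseteq> K"
  shows "is_direct_product (G\<lparr>carrier := K\<rparr>) H Hs \<longleftrightarrow> direct_decomp G H Hs"
proof -
  let ?n = "length Hs"
  let ?f = "\<lambda>x. foldr (\<lambda>i y. x i \<otimes> y) [0..<?n] \<one>"
  let ?P = "product_group {..<?n} (\<lambda>i. G\<lparr>carrier := Hs ! i\<rparr>)"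
  have f: "foldr (\<lambda>i y. x i \<otimes> y) [0..<?n] \<one> = lprod G (map x [0..<?n])" for x
    by (auto simp: lprod_def foldr_map o_def)
  have carrP: "carrier ?P = (\<Pi>\<^sub>E i\<in>{..<?n}. Hs ! i)" by (simp add: product_group_def)
  have multP: "x \<otimes>\<^bsub>?P\<^esub> y = (\<lambda>i\<in>{..<?n}. x i \<otimes> y i)" for x y by (simp add: product_group_def)
  have res: "lprod G (map (restrict x {..<?n}) [0..<?n]) = lprod G (map x [0..<?n])" for x
    by (intro arg_cong[of _ _ "lprod G"]) auto
  have subs: "subgroup H (G\<lparr>carrier := K\<rparr>) \<and> (\<forall>L \<in> set Hs. subgroup L (G\<lparr>carrier := K\<rparr>)) \<longleftrightarrow>
     subgroup H G \<and> (\<forall>i<?n. subgroup (Hs ! i) G)"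
    using HK KsK by (auto simp: subgroup_in_subgroup_iff[OF subK] all_set_conv_all_nth)
  have "?f \<in> iso ?P (G\<lparr>carrier := H\<rparr>) \<longleftrightarrow> direct_decomp G H Hs"
    if sH: "subgroup H G" and sHs: "\<And>i. i < ?n \<Longrightarrow> subgroup (Hs ! i) G"
  proof
    assume iso: "?f \<in> iso ?P (G\<lparr>carrier := H\<rparr>)"
    then have hom: "\<And>x y. x \<in> carrier ?P \<Longrightarrow> y \<in> carrier ?P \<Longrightarrow> ?f (x \<otimes>\<^bsub>?P\<^esub> y) = ?f x \<otimes> ?f y"
      and bij: "bij_betw ?f (carrier ?P) H"
      by (auto simp: iso_def hom_def)
    have carr: "x \<in> carrier G" if "i < ?n" "x \<in> Hs ! i" for x i
      using that sHs subgroup.subset by blast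
    show "direct_decomp G H Hs"
    proof (rule direct_decompI)
      fix i j x y assume ij: "i < ?n" "j < ?n" "i \<noteq> j" and x: "x \<in> Hs ! i" and y: "y \<in> Hs ! j"
      define u where "u = (\<lambda>k\<in>{..<?n}. if k = i then x else \<one>)"
      define v where "v = (\<lambda>k\<in>{..<?n}. if k = j then y else \<one>)"
      have uv: "u \<in> carrier ?P" "v \<in> carrier ?P"
        using x y sHs by (auto simp: u_def v_def carrP subgroup.one_closed)
      have "?f u = x" "?f v = y"
        unfolding f u_def v_def res
        using lprod_single[of "[0..<?n]" i x] lprod_single[of "[0..<?n]" j y] ij carr[OF ij(1) x] carr[OF ij(2) y]
        by auto
      moreover have "u \<otimes>\<^bsub>?P\<^esub> v = v \<otimes>\<^bsub>?P\<^esub> u"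
        unfolding multP u_def v_def using ij carr x y by (intro ext) auto
      ultimately show "x \<otimes> y = y \<otimes> x" using hom uv by metis
    next
      fix x i assume x: "\<And>i. i < ?n \<Longrightarrow> x i \<in> Hs ! i" and one: "lprod G (map x [0..<?n]) = \<one>" and i: "i < ?n"
      let ?x = "restrict x {..<?n}" and ?e = "\<lambda>i\<in>{..<?n}. \<one>"
      have "?x \<in> carrier ?P" "?e \<in> carrier ?P"
        using x sHs by (auto simp: carrP subgroup.one_closed)
      moreover have "?f ?x = \<one>" unfolding f res by (rule one)
      moreover have "?f ?e = \<one>" unfolding f res by (rule lprod_one) simp
      ultimately have "?x = ?e" using bij by (metis bij_betw_imp_inj_on inj_onD)
      then show "x i = \<one>" using i by (metis lessThan_iff restrict_apply')
    next
      have "H = ?f ` carrier ?P" using bij by (simp add: bij_betw_def)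
      also have "\<dots> = {lprod G (map x [0..<?n]) | x. \<forall>i<?n. x i \<in> Hs ! i}"
      proof (intro equalityI subsetI)
        fix h assume "h \<in> {lprod G (map x [0..<?n]) | x. \<forall>i<?n. x i \<in> Hs ! i}"
        then obtain x where "h = lprod G (map x [0..<?n])" "\<forall>i<?n. x i \<in> Hs ! i" by blast
        then show "h \<in> ?f ` carrier ?P"
          unfolding f using res[of x]
          by (intro image_eqI[of _ _ "restrict x {..<?n}"]) (auto simp: carrP simp del: restrict_apply)
      qed (auto simp: f carrP)
      finally show "H = {lprod G (map x [0..<?n]) | x. \<forall>i<?n. x i \<in> Hs ! i}" .
    qed (use sHs in auto)
  next
    assume dd: "direct_decomp G H Hs"
    note D = direct_decompD[OF dd]
    obtain q where "projections G H Hs q" using direct_decomp_projections[OF dd] by blast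
    note q = projectionsD[OF this]
    have "?f \<in> hom ?P (G\<lparr>carrier := H\<rparr>)"
    proof (rule homI)
      fix x assume "x \<in> carrier ?P"
      then show "?f x \<in> carrier (G\<lparr>carrier := H\<rparr>)" unfolding f using D(5) by (auto simp: carrP)
    next
      fix x y assume xy: "x \<in> carrier ?P" "y \<in> carrier ?P"
      have "lprod G (map (\<lambda>i. x i \<otimes> y i) [0..<?n]) = lprod G (map x [0..<?n]) \<otimes> lprod G (map y [0..<?n])"
        by (rule lprod_mult) (use xy D(2,3) subgroup.subset in \<open>fastforce simp: carrP PiE_iff\<close>)+
      then show "?f (x \<otimes>\<^bsub>?P\<^esub> y) = ?f x \<otimes>\<^bsub>G\<lparr>carrier := H\<rparr>\<^esub> ?f y" unfolding f multP res by simp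
    qed
    moreover have "bij_betw ?f (carrier ?P) H"
    proof (rule bij_betwI[where g = "\<lambda>h. \<lambda>i\<in>{..<?n}. q i h"])
      show "?f \<in> carrier ?P \<rightarrow> H" unfolding f using D(5) by (auto simp: carrP)
      show "(\<lambda>h. \<lambda>i\<in>{..<?n}. q i h) \<in> H \<rightarrow> carrier ?P" using q(1) by (auto simp: carrP)
      show "(\<lambda>i\<in>{..<?n}. q i (?f x)) = x" if "x \<in> carrier ?P" for x
        unfolding f using q(4)[of x] that by (intro ext) (auto simp: carrP PiE_iff extensional_def)
      show "?f (\<lambda>i\<in>{..<?n}. q i h) = h" if "h \<in> H" for h unfolding f res by (rule q(3)[OF that])
    qed
    ultimately show "?f \<in> iso ?P (G\<lparr>carrier := H\<rparr>)" by (simp add: iso_def)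
  qed
  moreover have "is_direct_product (G\<lparr>carrier := K\<rparr>) H Hs \<longleftrightarrow>
      (subgroup H G \<and> (\<forall>i<?n. subgroup (Hs ! i) G)) \<and> ?f \<in> iso ?P (G\<lparr>carrier := H\<rparr>)"
    unfolding is_direct_product_def using subs by auto
  ultimately show ?thesis unfolding direct_decomp_def by auto
qed

end

section \<open>Linear relations among many vectors\<close>

text \<open>Gaussian elimination over an integral domain: a vector with a nonzero \<open>k\<close>-th coordinate is used to
  clear this coordinate in the others, at the price of multiplying them by the pivot. Over \<open>\<int>\<close> it
  produces common kernel elements of homomorphisms from \<open>\<int>\<^sup>m\<close>, over \<open>\<real>\<close> it bounds independent families of
  roots.\<close>

lemma dependent_family:
  fixes v :: "'i \<Rightarrow> 'k \<Rightarrow> 'f::idom"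
  assumes "finite K" "finite I" "card K < card I"
  shows "\<exists>n. (\<exists>i\<in>I. n i \<noteq> 0) \<and> (\<forall>k\<in>K. (\<Sum>i\<in>I. n i * v i k) = 0)"
  using assms
proof (induction K arbitrary: I v rule: finite_induct)
  case empty
  then obtain i where "i \<in> I" by fastforce
  then show ?case by (intro exI[of _ "\<lambda>_. 1"]) auto
next
  case (insert k K)
  show ?case
  proof (cases "\<forall>i\<in>I. v i k = 0")
    case True
    obtain n where "\<exists>i\<in>I. n i \<noteq> 0" "\<forall>k\<in>K. (\<Sum>i\<in>I. n i * v i k) = 0"
      using insert.IH[of I v] insert.prems insert.hyps by auto
    then show ?thesis using True by (intro exI[of _ n]) auto
  next
    case False
    then obtain i0 where i0: "i0 \<in> I" "v i0 k \<noteq> 0" by blast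
    define J where "J = I - {i0}"
    define c where "c = v i0 k"
    have J: "finite J" "card K < card J"
      using insert.prems insert.hyps i0 by (auto simp: J_def)
    obtain n where n: "\<exists>i\<in>J. n i \<noteq> 0"
      "\<forall>j\<in>K. (\<Sum>i\<in>J. n i * (c * v i j - v i k * v i0 j)) = 0"
      using insert.IH[of J "\<lambda>i j. c * v i j - v i k * v i0 j"] J by blast
    define m where "m i = (if i = i0 then - (\<Sum>i\<in>J. n i * v i k) else n i * c)" for i
    have split: "(\<Sum>i\<in>I. m i * v i j) = (\<Sum>i\<in>J. n i * c * v i j) - (\<Sum>i\<in>J. n i * v i k) * v i0 j" for j
    proof -
      have "(\<Sum>i\<in>I. m i * v i j) = m i0 * v i0 j + (\<Sum>i\<in>J. m i * v i j)"
        unfolding J_def using i0 insert.prems by (simp add: sum.remove)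
      also have "(\<Sum>i\<in>J. m i * v i j) = (\<Sum>i\<in>J. n i * c * v i j)"
        by (rule sum.cong) (auto simp: m_def J_def)
      finally show ?thesis by (simp add: m_def algebra_simps)
    qed
    have "(\<Sum>i\<in>I. m i * v i j) = 0" if "j \<in> insert k K" for j
    proof (cases "j = k")
      case True
      then show ?thesis unfolding split by (simp add: c_def sum_distrib_right sum_distrib_left mult_ac)
    next
      case False
      then have "(\<Sum>i\<in>J. n i * (c * v i j - v i k * v i0 j)) = 0" using n that by blast
      then show ?thesis
        unfolding split by (simp add: sum_distrib_right sum_distrib_left sum_subtractf right_diff_distrib mult_ac)
    qed
    moreover have "\<exists>i\<in>I. m i \<noteq> 0"
      using n(1) i0 by (auto simp: m_def J_def c_def)
    ultimately show ?thesis by blast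
  qed
qed

section \<open>Strongly indecomposable subgroups\<close>

definition str_indec :: "('a, 'b) monoid_scheme \<Rightarrow> 'a set \<Rightarrow> bool" where
  "str_indec G K \<longleftrightarrow> subgroup K G \<and> infinite K \<and>
     (\<forall>M A B. fin_index G M K \<longrightarrow> direct_decomp G M [A, B] \<longrightarrow> A = {\<one>\<^bsub>G\<^esub>} \<or> B = {\<one>\<^bsub>G\<^esub>})"

context group
begin

lemma lprod_pair: "x 0 \<in> carrier G \<Longrightarrow> x 1 \<in> carrier G \<Longrightarrow>
    lprod G (map x [0..<length [A, B]]) = x 0 \<otimes> x (Suc 0)"
  by (simp add: upt_rec)

lemma direct_decomp_pairI:
  assumes sub: "subgroup A G" "subgroup B G"
    and comm: "\<And>a b. a \<in> A \<Longrightarrow> b \<in> B \<Longrightarrow> a \<otimes> b = b \<otimes> a"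
    and triv: "A \<inter> B \<subseteq> {\<one>}" and M: "M = {a \<otimes> b | a b. a \<in> A \<and> b \<in> B}"
  shows "direct_decomp G M [A, B]"
proof (rule direct_decompI)
  have carr: "a \<in> carrier G" if "a \<in> A \<or> a \<in> B" for a
    using that subgroup.mem_carrier[OF sub(1)] subgroup.mem_carrier[OF sub(2)] by blast
  have i2: "i = 0 \<or> i = 1" if "i < length [A, B]" for i using that by auto
  show "subgroup ([A, B] ! i) G" if "i < length [A, B]" for i
    using i2[OF that] sub by auto
  show "x \<otimes> y = y \<otimes> x"
    if "i < length [A, B]" "j < length [A, B]" "i \<noteq> j" "x \<in> [A, B] ! i" "y \<in> [A, B] ! j" for i j x y
    using i2[OF that(1)] i2[OF that(2)] that(3-5) comm by auto
  show "x i = \<one>" if x: "\<And>i. i < length [A, B] \<Longrightarrow> x i \<in> [A, B] ! i"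
    and one: "lprod G (map x [0..<length [A, B]]) = \<one>" and i: "i < length [A, B]" for x i
  proof -
    have x0: "x 0 \<in> A" and x1: "x 1 \<in> B" using x[of 0] x[of 1] by auto
    then have c: "x 0 \<in> carrier G" "x 1 \<in> carrier G" using carr by auto
    have "x 0 \<otimes> x 1 = \<one>" using one lprod_pair[OF c] by simp
    then have eq: "inv (x 1) = x 0" using inv_equality c by blast
    then have "x 0 \<in> B" using subgroup.m_inv_closed[OF sub(2) x1] by simp
    then have "x 0 = \<one>" using triv x0 by blast
    moreover from this have "x 1 = \<one>" using eq c(2) by (metis inv_inv inv_one)
    ultimately show ?thesis using i2[OF i] by auto
  qed
  show "M = {lprod G (map x [0..<length [A, B]]) | x. \<forall>i<length [A, B]. x i \<in> [A, B] ! i}"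
  proof (intro equalityI subsetI)
    fix m assume "m \<in> M"
    then obtain a b where ab: "m = a \<otimes> b" "a \<in> A" "b \<in> B" using M by blast
    let ?x = "\<lambda>i. if i = 0 then a else b"
    have "m = lprod G (map ?x [0..<length [A, B]])"
      using lprod_pair[of ?x A B] ab carr by simp
    moreover have "\<forall>i<length [A, B]. ?x i \<in> [A, B] ! i"
      using i2 ab by fastforce
    ultimately show "m \<in> {lprod G (map x [0..<length [A, B]]) | x. \<forall>i<length [A, B]. x i \<in> [A, B] ! i}"
      by blast
  next
    fix m assume "m \<in> {lprod G (map x [0..<length [A, B]]) | x. \<forall>i<length [A, B]. x i \<in> [A, B] ! i}"
    then obtain x where m: "m = lprod G (map x [0..<length [A, B]])" and x: "\<forall>i<length [A, B]. x i \<in> [A, B] ! i"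
      by blast
    have x0: "x 0 \<in> A" and x1: "x 1 \<in> B" using spec[OF x, of 0] spec[OF x, of 1] by auto
    then have "m = x 0 \<otimes> x 1" unfolding m using lprod_pair[of x A B] carr by simp
    then show "m \<in> M" using M x0 x1 by blast
  qed
qed

lemma direct_decomp_pairD:
  assumes "direct_decomp G M [A, B]"
  shows "subgroup M G" "subgroup A G" "subgroup B G" "A \<subseteq> M" "B \<subseteq> M" "A \<inter> B \<subseteq> {\<one>}"
    and "\<And>a b. a \<in> A \<Longrightarrow> b \<in> B \<Longrightarrow> a \<otimes> b = b \<otimes> a"
    and "\<And>m. m \<in> M \<Longrightarrow> \<exists>a\<in>A. \<exists>b\<in>B. m = a \<otimes> b"
proof -
  note D = direct_decompD[OF assms]
  obtain q where "projections G M [A, B] q" using direct_decomp_projections[OF assms] by blast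
  note q = projectionsD[OF this]
  show "subgroup M G" by (rule D(1))
  show sub: "subgroup A G" "subgroup B G" using D(2)[of 0] D(2)[of 1] by auto
  show "A \<subseteq> M" "B \<subseteq> M" using q(5)[of 0] q(5)[of 1] by auto
  show "A \<inter> B \<subseteq> {\<one>}"
  proof
    fix x assume "x \<in> A \<inter> B"
    then have "q 0 x = x" "q 0 x = \<one>" using q(6)[of 0 x] q(7)[of 0 1 x] by auto
    then show "x \<in> {\<one>}" by simp
  qed
  show "a \<otimes> b = b \<otimes> a" if "a \<in> A" "b \<in> B" for a b using D(3)[of 0 1 a b] that by auto
  show "\<exists>a\<in>A. \<exists>b\<in>B. m = a \<otimes> b" if "m \<in> M" for m
  proof -
    have q01: "q 0 m \<in> A" "q 1 m \<in> B" using q(1)[of 0 m] q(1)[of 1 m] that by auto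
    then have "q 0 m \<in> carrier G" "q 1 m \<in> carrier G"
      using subgroup.mem_carrier[OF sub(1)] subgroup.mem_carrier[OF sub(2)] by auto
    then have "m = q 0 m \<otimes> q 1 m"
      using q(3)[OF that] lprod_pair[of "\<lambda>i. q i m" A B] by simp
    then show ?thesis using q01 by blast
  qed
qed

lemma str_indec_iff:
  assumes K: "subgroup K G"
  shows "strongly_indecomposable (G\<lparr>carrier := K\<rparr>) \<longleftrightarrow> str_indec G K"
proof -
  have "indecomposable (G\<lparr>carrier := M\<rparr>) \<longleftrightarrow>
      (\<forall>A B. direct_decomp G M [A, B] \<longrightarrow> A = {\<one>} \<or> B = {\<one>})" if M: "subgroup M G" for M
  proof -
    have dp: "is_direct_product (G\<lparr>carrier := M\<rparr>) M [A, B] \<longleftrightarrow> direct_decomp G M [A, B]" for A B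
    proof
      assume ip: "is_direct_product (G\<lparr>carrier := M\<rparr>) M [A, B]"
      then have "subgroup A (G\<lparr>carrier := M\<rparr>)" "subgroup B (G\<lparr>carrier := M\<rparr>)"
        unfolding is_direct_product_def by auto
      then have "A \<subseteq> M" "B \<subseteq> M" using subgroup.subset by fastforce+
      then have "\<And>i. i < length [A, B] \<Longrightarrow> [A, B] ! i \<subseteq> M" by (auto simp: less_Suc_eq)
      then show "direct_decomp G M [A, B]" using ip is_direct_product_iff[OF M order_refl] by blast
    next
      assume dd: "direct_decomp G M [A, B]"
      then have "\<And>i. i < length [A, B] \<Longrightarrow> [A, B] ! i \<subseteq> M"
        using direct_decomp_pairD(4,5)[OF dd] by (auto simp: less_Suc_eq)
      then show "is_direct_product (G\<lparr>carrier := M\<rparr>) M [A, B]"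
        using dd is_direct_product_iff[OF M order_refl] by blast
    qed
    have "B = {\<one>} \<longleftrightarrow> A = M" if dd: "direct_decomp G M [A, B]" for A B
    proof -
      note P = direct_decomp_pairD[OF dd]
      have "\<one> \<in> B" using P(3) subgroup.one_closed by blast
      moreover have "m \<in> A" if "B = {\<one>}" "m \<in> M" for m
        using P(8)[OF that(2)] that(1) subgroup.mem_carrier[OF P(2)] by auto
      ultimately show ?thesis using P(4-6) by blast
    qed
    then show ?thesis
      unfolding indecomposable_def direct_factor_def by (auto simp: dp)
  qed
  moreover have "subgroup M G" if "fin_index G M K" for M using that unfolding fin_index_def by blast
  ultimately show ?thesis
    unfolding strongly_indecomposable_def str_indec_def finite_index_subgroup_iff[OF K]
    using K by auto
qed

lemma virtual_strong_Remak_decomposition_iff: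
  "virtual_strong_Remak_decomposition G H Hs \<longleftrightarrow>
     fin_index G H (carrier G) \<and> direct_decomp G H Hs \<and> (\<forall>i<length Hs. str_indec G (Hs ! i))"
proof -
  have dp: "is_direct_product G H Hs \<longleftrightarrow> direct_decomp G H Hs"
    if "H \<subseteq> carrier G" "\<And>i. i < length Hs \<Longrightarrow> Hs ! i \<subseteq> carrier G"
    using is_direct_product_iff[OF subgroup_self that] by simp
  show ?thesis
  proof
    assume v: "virtual_strong_Remak_decomposition G H Hs"
    then have ip: "is_direct_product G H Hs" and fi: "fin_index G H (carrier G)"
      unfolding virtual_strong_Remak_decomposition_def finite_index_subgroup_carrier_iff by auto
    then have sub: "subgroup H G" "\<And>i. i < length Hs \<Longrightarrow> subgroup (Hs ! i) G"
      unfolding is_direct_product_def by auto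
    have "direct_decomp G H Hs" using dp ip sub subgroup.subset by blast
    moreover have "str_indec G (Hs ! i)" if "i < length Hs" for i
      using v nth_mem[OF that] str_indec_iff[OF sub(2)[OF that]]
      unfolding virtual_strong_Remak_decomposition_def by blast
    ultimately show "fin_index G H (carrier G) \<and> direct_decomp G H Hs \<and> (\<forall>i<length Hs. str_indec G (Hs ! i))"
      using fi by blast
  next
    assume a: "fin_index G H (carrier G) \<and> direct_decomp G H Hs \<and> (\<forall>i<length Hs. str_indec G (Hs ! i))"
    then have sub: "subgroup H G" "\<And>i. i < length Hs \<Longrightarrow> subgroup (Hs ! i) G"
      using direct_decompD(1,2) by blast+
    then have "is_direct_product G H Hs" using dp a subgroup.subset by blast
    moreover have "strongly_indecomposable (G\<lparr>carrier := K\<rparr>)" if KS: "K \<in> set Hs" for K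
    proof -
      obtain i where "i < length Hs" "K = Hs ! i" using KS by (auto simp: in_set_conv_nth)
      then show ?thesis using a str_indec_iff[OF sub(2)] by blast
    qed
    ultimately show "virtual_strong_Remak_decomposition G H Hs"
      using a unfolding virtual_strong_Remak_decomposition_def finite_index_subgroup_carrier_iff by blast
  qed
qed

lemma str_indec_fin_index:
  "str_indec G K \<Longrightarrow> fin_index G M K \<Longrightarrow> str_indec G M"
  unfolding str_indec_def using fin_index_trans[of _ M K] fin_index_infinite[of M K]
  by (simp add: fin_index_def[of G M K]) blast

text \<open>Coordinatewise, a coset modulo the smaller product is a tuple of cosets modulo the smaller
  factors, and there are finitely many such tuples.\<close>

lemma direct_decomp_fin_index:
  assumes dd: "direct_decomp G H Hs" and len: "length Ls = length Hs"
    and fi: "\<And>i. i < length Hs \<Longrightarrow> fin_index G (Ls ! i) (Hs ! i)"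
  obtains L where "direct_decomp G L Ls" "fin_index G L H"
proof -
  let ?n = "length Hs"
  note D = direct_decompD[OF dd]
  obtain q where "projections G H Hs q" using direct_decomp_projections[OF dd] by blast
  note q = projectionsD[OF this]
  have sub: "subgroup (Ls ! i) G" "Ls ! i \<subseteq> Hs ! i" if "i < ?n" for i
    using fi[OF that] unfolding fin_index_def by auto
  define L where "L = {lprod G (map x [0..<length Ls]) | x. \<forall>i<length Ls. x i \<in> Ls ! i}"
  have ddL: "direct_decomp G L Ls"
  proof (rule direct_decompI)
    fix i j x y assume "i < length Ls" "j < length Ls" "i \<noteq> j" "x \<in> Ls ! i" "y \<in> Ls ! j"
    then show "x \<otimes> y = y \<otimes> x" using D(3)[of i j x y] sub(2) len by (metis subsetD)
  next
    fix x i assume x: "\<And>i. i < length Ls \<Longrightarrow> x i \<in> Ls ! i" and one: "lprod G (map x [0..<length Ls]) = \<one>"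
      and i: "i < length Ls"
    show "x i = \<one>"
    proof (rule D(4)[of x])
      show "x i \<in> Hs ! i" if "i < ?n" for i using x[of i] sub(2)[of i] that len by auto
    qed (use one i len in auto)
  qed (use sub len L_def in auto)
  have LH: "L \<subseteq> H"
  proof
    fix l assume "l \<in> L"
    then obtain x where x: "l = lprod G (map x [0..<?n])" "\<forall>i<?n. x i \<in> Ls ! i"
      using len by (auto simp: L_def)
    then show "l \<in> H" using D(5)[of x] sub(2) by (auto simp: subset_iff)
  qed
  have "fin_index G L H"
  proof (rule fin_indexI[where f = "\<lambda>x. map (\<lambda>i. (Ls ! i) #> q i x) [0..<?n]"])
    show "subgroup L G" "subgroup H G" "L \<subseteq> H" using direct_decompD(1)[OF ddL] D(1) LH by auto
    let ?C = "\<Union>i<?n. (\<lambda>x. (Ls ! i) #> x) ` (Hs ! i)"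
    have fin: "finite ?C" using fi unfolding fin_index_def by auto
    have "(\<lambda>x. map (\<lambda>i. (Ls ! i) #> q i x) [0..<?n]) ` H \<subseteq> {xs. set xs \<subseteq> ?C \<and> length xs = ?n}"
      using q(1) by (fastforce intro!: imageI)
    then show "finite ((\<lambda>x. map (\<lambda>i. (Ls ! i) #> q i x) [0..<?n]) ` H)"
      using finite_lists_length_eq[OF fin] finite_subset by blast
    fix x y assume xy: "x \<in> H" "y \<in> H"
      and eq: "map (\<lambda>i. (Ls ! i) #> q i x) [0..<?n] = map (\<lambda>i. (Ls ! i) #> q i y) [0..<?n]"
    let ?z = "x \<otimes> inv y"
    have z: "?z \<in> H" using xy D(1) by (simp add: subgroup.m_closed subgroup.m_inv_closed)
    have "q i ?z \<in> Ls ! i" if i: "i < ?n" for i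
    proof -
      have "(Ls ! i) #> q i x = (Ls ! i) #> q i y" using eq i by simp
      then have "q i x \<otimes> inv (q i y) \<in> Ls ! i"
        using fin_index_cosetD[OF fi[OF i]] q(1) i xy by blast
      moreover have "q i (inv y) = inv (q i y)"
      proof (rule hom_on_inv[OF D(1)])
        show "q i x \<in> carrier G" if "x \<in> H" for x
          using subgroup.mem_carrier[OF D(2)[OF i] q(1)[OF i that]] .
      qed (use q(2) i xy in auto)
      ultimately show ?thesis
        using q(2)[OF i xy(1), of "inv y"] xy D(1) by (simp add: subgroup.m_inv_closed)
    qed
    then have "lprod G (map (\<lambda>i. q i ?z) [0..<length Ls]) \<in> L"
      unfolding L_def using len by auto
    then show "?z \<in> L" using q(3)[OF z] len by simp
  qed
  then show thesis using that ddL by blast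
qed

text \<open>The new factor \<open>B\<close> goes to the end of the list. It commutes with all factors other than \<open>A\<close>, and
  also with \<open>A\<close>, so that it can be moved back next to \<open>A\<close> when products are computed.\<close>

lemma direct_decomp_split:
  assumes dd: "direct_decomp G H Hs" and i: "i < length Hs" and AB: "direct_decomp G (Hs ! i) [A, B]"
  shows "direct_decomp G H (Hs[i := A] @ [B])"
proof -
  let ?n = "length Hs" and ?Ks = "Hs[i := A] @ [B]"
  note D = direct_decompD[OF dd] and P = direct_decomp_pairD[OF AB]
  have len: "length ?Ks = Suc ?n" by simp
  have nthK: "?Ks ! k = (if k = ?n then B else if k = i then A else Hs ! k)" if "k < Suc ?n" for k
    using that i by (auto simp: nth_append)
  have carr: "x \<in> carrier G" if "k < ?n" "x \<in> Hs ! k" for x k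
    using subgroup.mem_carrier[OF D(2)[OF that(1)] that(2)] .
  have KH: "?Ks ! k \<subseteq> Hs ! (if k = ?n then i else k)" if "k < Suc ?n" for k
    using that P(4,5) by (auto simp: nthK)
  \<comment> \<open>moving the new last factor back into position \<open>i\<close>\<close>
  have fold: "lprod G (map x [0..<Suc ?n]) = lprod G (map (\<lambda>k. x k \<otimes> (if k = i then x ?n else \<one>)) [0..<?n])"
    if x: "\<And>k. k < Suc ?n \<Longrightarrow> x k \<in> ?Ks ! k" for x
  proof -
    have xH: "x k \<in> Hs ! k" if "k < ?n" for k using x[of k] KH[of k] that by auto
    have xn: "x ?n \<in> Hs ! i" "x ?n \<in> B" using x[of ?n] P(5) by (auto simp: nthK)
    have c: "x k \<in> carrier G" if "k < Suc ?n" for k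
      using that xH xn carr i by (metis less_Suc_eq)
    have "set (map x [0..<?n]) \<subseteq> carrier G" "set [x ?n] \<subseteq> carrier G" using c by auto
    from lprod_append[OF this] have "lprod G (map x [0..<Suc ?n]) = lprod G (map x [0..<?n]) \<otimes> x ?n"
      using c by simp
    also have "x ?n = lprod G (map (\<lambda>k. if k = i then x ?n else \<one>) [0..<?n])"
      using lprod_single[of "[0..<?n]" i "x ?n"] i c by simp
    also have "lprod G (map x [0..<?n]) \<otimes> \<dots> = lprod G (map (\<lambda>k. x k \<otimes> (if k = i then x ?n else \<one>)) [0..<?n])"
    proof (rule lprod_mult[symmetric])
      fix k j assume "k \<in> set [0..<?n]" "j \<in> set [0..<?n]" "k \<noteq> j"
      then show "x k \<otimes> (if j = i then x ?n else \<one>) = (if j = i then x ?n else \<one>) \<otimes> x k"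
        using D(3)[of k i "x k" "x ?n"] xH xn(1) c i by auto
    qed (use c in auto)
    finally show ?thesis .
  qed
  have fac: "x k \<otimes> (if k = i then x ?n else \<one>) \<in> Hs ! k"
    if "\<And>k. k < Suc ?n \<Longrightarrow> x k \<in> ?Ks ! k" "k < ?n" for x k
  proof (cases "k = i")
    case True
    then have "x k \<in> Hs ! k" "x ?n \<in> Hs ! k" using that(1)[of k] that(1)[of ?n] KH[of k] KH[of ?n] that(2) by (auto split: if_splits)
    then show ?thesis using True D(2)[OF that(2)] by (simp add: subgroup.m_closed)
  next
    case False
    then have "x k \<in> Hs ! k" using that(1)[of k] KH[of k] that(2) by auto
    then show ?thesis using False carr that(2) by auto
  qed
  show ?thesis
  proof (rule direct_decompI)
    show "subgroup (?Ks ! k) G" if "k < length ?Ks" for k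
      using that D(2) P(2,3) by (auto simp: nthK less_Suc_eq)
    show "x \<otimes> y = y \<otimes> x"
      if "k < length ?Ks" "j < length ?Ks" "k \<noteq> j" "x \<in> ?Ks ! k" "y \<in> ?Ks ! j" for k j x y
    proof -
      have ne: "k \<noteq> j" by (rule that(3))
      let ?k = "if k = ?n then i else k" and ?j = "if j = ?n then i else j"
      have kj: "k < Suc ?n" "j < Suc ?n" using that by auto
      have xy: "x \<in> Hs ! ?k" "y \<in> Hs ! ?j" using that KH kj by blast+
      show ?thesis
      proof (cases "?k = ?j")
        case False
        then show ?thesis using D(3)[of ?k ?j x y] xy kj i by (auto simp: less_Suc_eq)
      next
        case True
        then consider "k = ?n" "j = i" | "k = i" "j = ?n" using ne by (auto split: if_splits)
        then show ?thesis
        proof cases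
          case 1
          then show ?thesis using P(7)[of y x] that i by (auto simp: nthK)
        next
          case 2
          then show ?thesis using P(7)[of x y] that i by (auto simp: nthK)
        qed
      qed
    qed
    show "x k = \<one>" if x: "\<And>k. k < length ?Ks \<Longrightarrow> x k \<in> ?Ks ! k"
      and one: "lprod G (map x [0..<length ?Ks]) = \<one>" and k: "k < length ?Ks" for x k
    proof -
      have x': "\<And>k. k < Suc ?n \<Longrightarrow> x k \<in> ?Ks ! k" using x by simp
      have z: "x k \<otimes> (if k = i then x ?n else \<one>) = \<one>" if "k < ?n" for k
        by (rule D(4)[of "\<lambda>k. x k \<otimes> (if k = i then x ?n else \<one>)"])
           (use fac[OF x'] fold[OF x'] one that in auto)
      have xi: "x i \<in> A" "x ?n \<in> B" using x'[of i] x'[of ?n] i by (auto simp: nthK)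
      then have c: "x i \<in> carrier G" "x ?n \<in> carrier G"
        using subgroup.mem_carrier[OF P(2)] subgroup.mem_carrier[OF P(3)] by auto
      have "x i \<otimes> x ?n = \<one>" using z[OF i] by simp
      then have inv: "inv (x ?n) = x i" using c by (simp add: inv_equality)
      then have "x i \<in> B" using subgroup.m_inv_closed[OF P(3) xi(2)] by simp
      then have xi1: "x i = \<one>" using P(6) xi(1) by blast
      then have xn1: "x ?n = \<one>" using inv c by (metis inv_inv inv_one)
      consider "k = ?n" | "k = i" | "k < ?n" "k \<noteq> i" using k by force
      then show ?thesis
      proof cases
        case 3
        then have "x k \<in> carrier G" using x'[of k] KH[of k] carr by auto
        then show ?thesis using z[of k] 3 by simp
      qed (use xi1 xn1 in auto)
    qed
    show "H = {lprod G (map x [0..<length ?Ks]) | x. \<forall>k<length ?Ks. x k \<in> ?Ks ! k}"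
    proof (intro equalityI subsetI)
      fix h assume "h \<in> H"
      then obtain y where y: "h = lprod G (map y [0..<?n])" "\<forall>i<?n. y i \<in> Hs ! i" using D(6) by blast
      obtain a b where ab: "a \<in> A" "b \<in> B" "y i = a \<otimes> b" using P(8) y(2) i by blast
      define x where "x k = (if k = ?n then b else if k = i then a else y k)" for k
      have x: "x k \<in> ?Ks ! k" if "k < Suc ?n" for k using that ab y i by (auto simp: x_def nthK)
      have "map (\<lambda>k. x k \<otimes> (if k = i then x ?n else \<one>)) [0..<?n] = map y [0..<?n]"
        using i ab y(2) carr by (intro map_cong) (auto simp: x_def)
      then have "h = lprod G (map x [0..<length ?Ks])"
        using fold[of x, OF x] y(1) len by metis
      then show "h \<in> {lprod G (map x [0..<length ?Ks]) | x. \<forall>k<length ?Ks. x k \<in> ?Ks ! k}"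
        using x len by auto
    next
      fix h assume "h \<in> {lprod G (map x [0..<length ?Ks]) | x. \<forall>k<length ?Ks. x k \<in> ?Ks ! k}"
      then obtain x where h: "h = lprod G (map x [0..<Suc ?n])" and x: "\<And>k. k < Suc ?n \<Longrightarrow> x k \<in> ?Ks ! k"
        by auto
      have f: "h = lprod G (map (\<lambda>k. x k \<otimes> (if k = i then x ?n else \<one>)) [0..<?n])"
        unfolding h by (rule fold) (rule x)
      show "h \<in> H" unfolding f by (rule D(5)) (rule fac[OF x])
    qed
  qed
qed

end

section \<open>Factors that are infinite cyclic or virtually centreless\<close>

text \<open>Unlike a description by a generator, an embedding into \<open>\<int>\<close> restricts to subgroups without any
  argument.\<close>

definition int_like :: "('a, 'b) monoid_scheme \<Rightarrow> 'a set \<Rightarrow> bool" where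
  "int_like G K \<longleftrightarrow> subgroup K G \<and> K \<noteq> {\<one>\<^bsub>G\<^esub>} \<and>
     (\<exists>\<tau> :: 'a \<Rightarrow> int. (\<forall>x\<in>K. \<forall>y\<in>K. \<tau> (x \<otimes>\<^bsub>G\<^esub> y) = \<tau> x + \<tau> y) \<and>
        (\<forall>x\<in>K. \<tau> x = 0 \<longrightarrow> x = \<one>\<^bsub>G\<^esub>))"

text \<open>The centre is required to vanish for every subgroup of finite index; this is the stability under
  commensurability that makes the comparison of decompositions work.\<close>

definition centreless :: "('a, 'b) monoid_scheme \<Rightarrow> 'a set \<Rightarrow> bool" where
  "centreless G K \<longleftrightarrow> subgroup K G \<and> infinite K \<and>
     (\<forall>M. fin_index G M K \<longrightarrow>
        (\<forall>a\<in>M. (\<forall>x\<in>M. a \<otimes>\<^bsub>G\<^esub> x = x \<otimes>\<^bsub>G\<^esub> a) \<longrightarrow> a = \<one>\<^bsub>G\<^esub>))"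

definition tame :: "('a, 'b) monoid_scheme \<Rightarrow> 'a set \<Rightarrow> bool" where
  "tame G K \<longleftrightarrow> str_indec G K \<and> (int_like G K \<or> centreless G K)"

text \<open>Commensurability of two subgroups of the same ambient group, without relativising their
  finite index subgroups.\<close>

definition virt_iso :: "('a, 'b) monoid_scheme \<Rightarrow> 'a set \<Rightarrow> 'a set \<Rightarrow> bool" where
  "virt_iso G A B \<longleftrightarrow> (\<exists>K1 K2. fin_index G K1 A \<and> fin_index G K2 B \<and>
     G\<lparr>carrier := K1\<rparr> \<cong> G\<lparr>carrier := K2\<rparr>)"

context group
begin

lemma commensurable_iff_virt_iso:
  assumes "subgroup A G" "subgroup B G"
  shows "commensurable (G\<lparr>carrier := A\<rparr>) (G\<lparr>carrier := B\<rparr>) \<longleftrightarrow> virt_iso G A B"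
  unfolding commensurable_def virt_iso_def finite_index_subgroup_iff[OF assms(1)]
    finite_index_subgroup_iff[OF assms(2)] by simp

lemma virt_iso_mono:
  "virt_iso G A B \<Longrightarrow> fin_index G A A' \<Longrightarrow> fin_index G B B' \<Longrightarrow> virt_iso G A' B'"
  unfolding virt_iso_def using fin_index_trans by blast

lemma hom_int_facts:
  fixes \<tau> :: "'a \<Rightarrow> int"
  assumes K: "subgroup K G" and hom: "\<And>x y. x \<in> K \<Longrightarrow> y \<in> K \<Longrightarrow> \<tau> (x \<otimes> y) = \<tau> x + \<tau> y"
  shows hom_int_one: "\<tau> \<one> = 0"
    and hom_int_inv: "\<And>x. x \<in> K \<Longrightarrow> \<tau> (inv x) = - \<tau> x"
    and hom_int_nat_pow: "\<And>x n. x \<in> K \<Longrightarrow> \<tau> (x [^] (n::nat)) = int n * \<tau> x"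
    and hom_int_int_pow: "\<And>x k. x \<in> K \<Longrightarrow> \<tau> (x [^] (k::int)) = k * \<tau> x"
proof -
  have oneK: "\<one> \<in> K" using K subgroup.one_closed by blast
  have c: "x \<in> carrier G" if "x \<in> K" for x using subgroup.mem_carrier[OF K that] .
  show one: "\<tau> \<one> = 0" using hom[OF oneK oneK] by simp
  show inv: "\<tau> (inv x) = - \<tau> x" if "x \<in> K" for x
    using hom[OF that subgroup.m_inv_closed[OF K that]] one c[OF that] by simp
  have powK: "x [^] (n::nat) \<in> K" if "x \<in> K" for x n
    using that K by (induction n) (auto simp: subgroup.one_closed subgroup.m_closed)
  show nat: "\<tau> (x [^] (n::nat)) = int n * \<tau> x" if "x \<in> K" for x n
    using that by (induction n) (auto simp: one hom powK algebra_simps)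
  show "\<tau> (x [^] (k::int)) = k * \<tau> x" if "x \<in> K" for x k
  proof (cases k rule: int_cases2)
    case (nonneg n)
    then show ?thesis using nat[OF that, of n] by (simp add: int_pow_int)
  next
    case (nonpos n)
    then show ?thesis
      using nat[OF that, of n] inv[OF powK[OF that, of n]] int_pow_neg_int[OF c[OF that], of n] by simp
  qed
qed

lemma inv_commute:
  assumes "x \<in> carrier G" "y \<in> carrier G" "x \<otimes> y = y \<otimes> x"
  shows "inv x \<otimes> y = y \<otimes> inv x"
proof -
  have "inv x \<otimes> y = inv x \<otimes> (y \<otimes> x) \<otimes> inv x" using assms(1,2) by (simp add: m_assoc)
  also have "\<dots> = inv x \<otimes> (x \<otimes> y) \<otimes> inv x" by (simp add: assms(3))
  also have "\<dots> = y \<otimes> inv x" using assms(1,2) by (simp add: m_assoc[symmetric])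
  finally show ?thesis .
qed

lemma int_pow_commute:
  assumes "x \<in> carrier G" "y \<in> carrier G" "x \<otimes> y = y \<otimes> x"
  shows "x [^] (k::int) \<otimes> y = y \<otimes> x [^] k"
proof -
  have n: "x [^] (n::nat) \<otimes> y = y \<otimes> x [^] n" for n using group_commutes_pow[OF assms(3,1,2)] .
  show ?thesis
  proof (cases k rule: int_cases2)
    case (nonneg m)
    then show ?thesis using n[of m] by (simp add: int_pow_int)
  next
    case (nonpos m)
    then show ?thesis using inv_commute[OF _ assms(2) n[of m]] assms(1) by (simp add: int_pow_neg_int)
  qed
qed

lemma subgroup_range_int_pow:
  assumes a: "a \<in> carrier G" shows "subgroup (range (\<lambda>k::int. a [^] k)) G"
proof (rule subgroupI)
  show "range (\<lambda>k::int. a [^] k) \<subseteq> carrier G" using a by auto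
  show "range (\<lambda>k::int. a [^] k) \<noteq> {}" by simp
  show "inv x \<in> range (\<lambda>k::int. a [^] k)" if x: "x \<in> range (\<lambda>k::int. a [^] k)" for x
  proof -
    obtain k :: int where k: "x = a [^] k" using x by blast
    have "inv x = a [^] (- k)" using a by (simp add: k int_pow_neg)
    then show ?thesis by blast
  qed
  show "x \<otimes> y \<in> range (\<lambda>k::int. a [^] k)"
    if xy: "x \<in> range (\<lambda>k::int. a [^] k)" "y \<in> range (\<lambda>k::int. a [^] k)" for x y
  proof -
    obtain k l :: int where "x = a [^] k" "y = a [^] l" using xy by blast
    then have "x \<otimes> y = a [^] (k + l)" using a by (simp add: int_pow_mult)
    then show ?thesis by blast
  qed
qed

lemma subgroup_kernel_mod:
  fixes \<tau> :: "'a \<Rightarrow> int"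
  assumes K: "subgroup K G" and hom: "\<And>x y. x \<in> K \<Longrightarrow> y \<in> K \<Longrightarrow> \<tau> (x \<otimes> y) = \<tau> x + \<tau> y"
  shows "subgroup {x \<in> K. d dvd \<tau> x} G"
proof (rule subgroupI)
  have "\<one> \<in> {x \<in> K. d dvd \<tau> x}" using hom_int_one[OF K hom] subgroup.one_closed[OF K] by simp
  then show "{x \<in> K. d dvd \<tau> x} \<noteq> {}" by blast
qed (use K hom hom_int_inv[OF K hom] subgroup.mem_carrier[OF K] in
      \<open>auto simp: subgroup.m_closed subgroup.m_inv_closed\<close>)

lemma fin_index_kernel_mod:
  fixes \<tau> :: "'a \<Rightarrow> int"
  assumes K: "subgroup K G" and hom: "\<And>x y. x \<in> K \<Longrightarrow> y \<in> K \<Longrightarrow> \<tau> (x \<otimes> y) = \<tau> x + \<tau> y" and d: "d \<noteq> 0"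
  shows "fin_index G {x \<in> K. d dvd \<tau> x} K"
proof (rule fin_indexI[where f = "\<lambda>x. \<tau> x mod \<bar>d\<bar>"])
  show "subgroup {x \<in> K. d dvd \<tau> x} G" by (rule subgroup_kernel_mod[OF K hom])
  have "(\<lambda>x. \<tau> x mod \<bar>d\<bar>) ` K \<subseteq> {0..<\<bar>d\<bar>}" using d by auto
  then show "finite ((\<lambda>x. \<tau> x mod \<bar>d\<bar>) ` K)" using finite_subset by blast
  fix x y assume xy: "x \<in> K" "y \<in> K" and "\<tau> x mod \<bar>d\<bar> = \<tau> y mod \<bar>d\<bar>"
  then have "d dvd \<tau> x - \<tau> y" by (simp add: mod_eq_dvd_iff)
  moreover have "\<tau> (x \<otimes> inv y) = \<tau> x - \<tau> y"
    using hom[OF xy(1) subgroup.m_inv_closed[OF K xy(2)]] hom_int_inv[OF K hom xy(2)] by simp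
  ultimately show "x \<otimes> inv y \<in> {x \<in> K. d dvd \<tau> x}"
    using xy K by (simp add: subgroup.m_closed subgroup.m_inv_closed)
qed (use K in auto)

text \<open>If \<open>a\<close> is central and \<open>\<tau> a\<close> is not \<open>0\<close>, then multiplying \<open>x\<close> by a power of \<open>a\<close> changes \<open>\<tau> x\<close> by an
  arbitrary multiple of \<open>\<tau> a\<close>. Hence the cyclic group of \<open>a\<close> is a complement to the kernel of \<open>\<tau>\<close> in the
  finite index subgroup of all \<open>x\<close> with \<open>\<tau> x\<close> divisible by \<open>\<tau> a\<close>.\<close>

lemma central_splits:
  fixes \<tau> :: "'a \<Rightarrow> int"
  assumes K: "subgroup K G" and hom: "\<And>x y. x \<in> K \<Longrightarrow> y \<in> K \<Longrightarrow> \<tau> (x \<otimes> y) = \<tau> x + \<tau> y"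
    and a: "a \<in> K" "\<tau> a \<noteq> 0" and central: "\<And>x. x \<in> K \<Longrightarrow> a \<otimes> x = x \<otimes> a"
  shows "direct_decomp G {x \<in> K. \<tau> a dvd \<tau> x} [range (\<lambda>k::int. a [^] k), {x \<in> K. \<tau> x = 0}]"
proof (rule direct_decomp_pairI)
  have ac: "a \<in> carrier G" using subgroup.mem_carrier[OF K a(1)] .
  note t = hom_int_int_pow[OF K hom a(1)]
  note pK = subgroup_int_pow_closed[OF K a(1)]
  have kc: "x \<in> carrier G" if "x \<in> K" for x using subgroup.mem_carrier[OF K that] .
  show "subgroup (range (\<lambda>k::int. a [^] k)) G" by (rule subgroup_range_int_pow[OF ac])
  show "subgroup {x \<in> K. \<tau> x = 0} G" using subgroup_kernel_mod[OF K hom, of 0] by simp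
  have comm: "a [^] (k::int) \<otimes> x = x \<otimes> a [^] k" if x: "x \<in> K" for x k
    by (rule int_pow_commute[OF ac kc[OF x] central[OF x]])
  then show "b \<otimes> x = x \<otimes> b" if "b \<in> range (\<lambda>k::int. a [^] k)" "x \<in> {x \<in> K. \<tau> x = 0}" for b x
    using that by auto
  show "range (\<lambda>k::int. a [^] k) \<inter> {x \<in> K. \<tau> x = 0} \<subseteq> {\<one>}"
    using t a(2) by auto
  show "{x \<in> K. \<tau> a dvd \<tau> x} = {b \<otimes> x | b x. b \<in> range (\<lambda>k::int. a [^] k) \<and> x \<in> {x \<in> K. \<tau> x = 0}}"
  proof (intro equalityI subsetI)
    fix x assume "x \<in> {x \<in> K. \<tau> a dvd \<tau> x}"
    then obtain k where x: "x \<in> K" and k: "\<tau> x = \<tau> a * k" by (auto simp: dvd_def)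
    let ?y = "a [^] (- k) \<otimes> x"
    have "\<tau> ?y = 0" using hom[OF pK x] t k by simp
    moreover have "?y \<in> K" using pK x K by (simp add: subgroup.m_closed)
    moreover have "x = a [^] k \<otimes> ?y"
      using ac kc[OF x] by (simp add: m_assoc[symmetric] int_pow_mult[symmetric])
    ultimately show "x \<in> {b \<otimes> x | b x. b \<in> range (\<lambda>k::int. a [^] k) \<and> x \<in> {x \<in> K. \<tau> x = 0}}" by blast
  next
    fix z assume "z \<in> {b \<otimes> x | b x. b \<in> range (\<lambda>k::int. a [^] k) \<and> x \<in> {x \<in> K. \<tau> x = 0}}"
    then obtain k :: int and x where "z = a [^] k \<otimes> x" "x \<in> K" "\<tau> x = 0" by blast
    then show "z \<in> {x \<in> K. \<tau> a dvd \<tau> x}" using hom[OF pK] t pK K by (simp add: subgroup.m_closed)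
  qed
qed

lemma int_like_commute:
  assumes "int_like G K" "x \<in> K" "y \<in> K"
  shows "x \<otimes> y = y \<otimes> x"
proof -
  obtain \<tau> :: "'a \<Rightarrow> int" where K: "subgroup K G"
    and hom: "\<And>x y. x \<in> K \<Longrightarrow> y \<in> K \<Longrightarrow> \<tau> (x \<otimes> y) = \<tau> x + \<tau> y"
    and inj: "\<And>x. x \<in> K \<Longrightarrow> \<tau> x = 0 \<Longrightarrow> x = \<one>"
    using assms(1) unfolding int_like_def by blast
  have xy: "x \<otimes> y \<in> K" "y \<otimes> x \<in> K" using assms K by (auto simp: subgroup.m_closed)
  then have z: "(x \<otimes> y) \<otimes> inv (y \<otimes> x) \<in> K" using K by (simp add: subgroup.m_closed subgroup.m_inv_closed)
  have "\<tau> ((x \<otimes> y) \<otimes> inv (y \<otimes> x)) = 0"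
    using hom[OF xy(1) subgroup.m_inv_closed[OF K xy(2)]] hom_int_inv[OF K hom xy(2)]
      hom[OF assms(2,3)] hom[OF assms(3,2)] by simp
  then have "(x \<otimes> y) \<otimes> inv (y \<otimes> x) = \<one>" using inj[OF z] by simp
  then show ?thesis using subgroup.mem_carrier[OF K xy(1)] subgroup.mem_carrier[OF K xy(2)]
    by (metis inv_closed inv_equality inv_inv)
qed

lemma int_like_not_centreless: "int_like G K \<Longrightarrow> \<not> centreless G K"
proof
  assume il: "int_like G K" and "centreless G K"
  then have K: "subgroup K G" "infinite K"
    and c: "\<And>a. a \<in> K \<Longrightarrow> (\<forall>x\<in>K. a \<otimes> x = x \<otimes> a) \<Longrightarrow> a = \<one>"
    using fin_index_refl unfolding centreless_def by blast+
  have "K \<subseteq> {\<one>}" using c int_like_commute[OF il] by blast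
  then show False using K(2) finite_subset by blast
qed

lemma int_like_obtain:
  assumes "int_like G K"
  obtains a where "a \<in> K" "\<And>k::int. a [^] k = \<one> \<Longrightarrow> k = 0" "fin_index G (range (\<lambda>k::int. a [^] k)) K"
proof -
  obtain \<tau> :: "'a \<Rightarrow> int" where K: "subgroup K G" "K \<noteq> {\<one>}"
    and hom: "\<And>x y. x \<in> K \<Longrightarrow> y \<in> K \<Longrightarrow> \<tau> (x \<otimes> y) = \<tau> x + \<tau> y"
    and inj: "\<And>x. x \<in> K \<Longrightarrow> \<tau> x = 0 \<Longrightarrow> x = \<one>"
    using assms unfolding int_like_def by blast
  obtain a where a: "a \<in> K" "a \<noteq> \<one>" using K subgroup.one_closed by blast
  then have ta: "\<tau> a \<noteq> 0" using inj by blast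
  have kz: "k = 0" if "a [^] k = \<one>" for k :: int
    using hom_int_int_pow[OF K(1) hom a(1), of k] hom_int_one[OF K(1) hom] that ta by auto
  have dd: "direct_decomp G {x \<in> K. \<tau> a dvd \<tau> x} [range (\<lambda>k::int. a [^] k), {x \<in> K. \<tau> x = 0}]"
    by (rule central_splits[OF K(1) hom a(1) ta int_like_commute[OF assms a(1)]])
  note P = direct_decomp_pairD[OF dd]
  have "{x \<in> K. \<tau> a dvd \<tau> x} = range (\<lambda>k::int. a [^] k)"
  proof
    show "{x \<in> K. \<tau> a dvd \<tau> x} \<subseteq> range (\<lambda>k::int. a [^] k)"
    proof
      fix x assume "x \<in> {x \<in> K. \<tau> a dvd \<tau> x}"
      then obtain b y where "b \<in> range (\<lambda>k::int. a [^] k)" "y \<in> {x \<in> K. \<tau> x = 0}" "x = b \<otimes> y" using P(8) by blast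
      moreover from this have "y = \<one>" "b \<in> carrier G" using inj subgroup.mem_carrier[OF P(2)] by auto
      ultimately show "x \<in> range (\<lambda>k::int. a [^] k)" by simp
    qed
  qed (rule P(4))
  then have "fin_index G (range (\<lambda>k::int. a [^] k)) K"
    using fin_index_kernel_mod[OF K(1) hom ta] by simp
  then show thesis using that[OF a(1)] kz by blast
qed

lemma infinite_cyclic_iso_integer_group:
  assumes a: "a \<in> carrier G" and inf: "\<And>k::int. a [^] k = \<one> \<Longrightarrow> k = 0"
  shows "integer_group \<cong> G\<lparr>carrier := range (\<lambda>k::int. a [^] k)\<rparr>"
proof -
  have "inj (\<lambda>k::int. a [^] k)"
  proof (rule injI)
    fix k l :: int assume "a [^] k = a [^] l"
    then have "a [^] (k - l) = \<one>" using a by (simp add: int_pow_diff)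
    then show "k = l" using inf by force
  qed
  then have "(\<lambda>k::int. a [^] k) \<in> iso integer_group (G\<lparr>carrier := range (\<lambda>k::int. a [^] k)\<rparr>)"
    using a by (auto simp: iso_def hom_def bij_betw_def int_pow_mult)
  then show ?thesis unfolding is_iso_def by blast
qed

lemma int_like_virt_iso:
  assumes "int_like G A" "int_like G B"
  shows "virt_iso G A B"
proof -
  obtain a where a: "a \<in> A" "\<And>k::int. a [^] k = \<one> \<Longrightarrow> k = 0" "fin_index G (range (\<lambda>k::int. a [^] k)) A"
    using int_like_obtain[OF assms(1)] by blast
  obtain b where b: "b \<in> B" "\<And>k::int. b [^] k = \<one> \<Longrightarrow> k = 0" "fin_index G (range (\<lambda>k::int. b [^] k)) B"
    using int_like_obtain[OF assms(2)] by blast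
  have carr: "a \<in> carrier G" "b \<in> carrier G"
    using a(1) b(1) assms subgroup.mem_carrier unfolding int_like_def by metis+
  have "G\<lparr>carrier := range (\<lambda>k::int. a [^] k)\<rparr> \<cong> G\<lparr>carrier := range (\<lambda>k::int. b [^] k)\<rparr>"
    using infinite_cyclic_iso_integer_group[OF carr(1) a(2)] infinite_cyclic_iso_integer_group[OF carr(2) b(2)]
      group.iso_sym[OF group_integer_group] iso_trans by blast
  then show ?thesis unfolding virt_iso_def using a(3) b(3) by blast
qed

lemma int_like_fin_index:
  assumes "int_like G K" "fin_index G M K" "infinite K"
  shows "int_like G M"
proof -
  have "infinite M" by (rule fin_index_infinite[OF assms(2,3)])
  then have "M \<noteq> {\<one>}" by auto
  moreover have "subgroup M G" "M \<subseteq> K" using assms(2) unfolding fin_index_def by auto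
  ultimately show ?thesis using assms(1) unfolding int_like_def by blast
qed

lemma centreless_fin_index:
  assumes "centreless G K" "fin_index G M K"
  shows "centreless G M"
proof -
  have "infinite M" "subgroup M G"
    using fin_index_infinite[OF assms(2)] assms unfolding centreless_def fin_index_def by auto
  then show ?thesis using assms(1) fin_index_trans[OF _ assms(2)] unfolding centreless_def by blast
qed

lemma tame_fin_index:
  assumes "tame G K" "fin_index G M K"
  shows "tame G M" and "centreless G M \<longleftrightarrow> centreless G K"
proof -
  have "infinite K" using assms unfolding tame_def str_indec_def by blast
  then show "tame G M" "centreless G M \<longleftrightarrow> centreless G K"
    using assms int_like_fin_index centreless_fin_index str_indec_fin_index int_like_not_centreless
    unfolding tame_def by blast+
qed

lemma hom_lprod:
  assumes K: "subgroup K G" and carr: "\<And>x. x \<in> K \<Longrightarrow> p x \<in> carrier G"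
    and hom: "\<And>x y. x \<in> K \<Longrightarrow> y \<in> K \<Longrightarrow> p (x \<otimes> y) = p x \<otimes> p y" and xs: "set xs \<subseteq> K"
  shows "lprod G xs \<in> K" "p (lprod G xs) = lprod G (map p xs)"
proof -
  have "lprod G xs \<in> K \<and> p (lprod G xs) = lprod G (map p xs)"
    using xs
  proof (induction xs)
    case Nil
    then show ?case using hom_on_one[OF K carr hom] subgroup.one_closed[OF K] by simp
  next
    case (Cons x xs)
    then show ?case using hom subgroup.m_closed[OF K] by auto
  qed
  then show "lprod G xs \<in> K" "p (lprod G xs) = lprod G (map p xs)" by auto
qed

lemma hom_int_lprod:
  fixes \<tau> :: "'a \<Rightarrow> int"
  assumes K: "subgroup K G" and hom: "\<And>x y. x \<in> K \<Longrightarrow> y \<in> K \<Longrightarrow> \<tau> (x \<otimes> y) = \<tau> x + \<tau> y"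
    and x: "\<And>i. i < n \<Longrightarrow> x i \<in> K"
  shows "lprod G (map x [0..<n]) \<in> K" "\<tau> (lprod G (map x [0..<n])) = (\<Sum>i<n. \<tau> (x i))"
proof -
  have "lprod G (map x is) \<in> K \<and> \<tau> (lprod G (map x is)) = sum_list (map (\<lambda>i. \<tau> (x i)) is)"
    if "set is \<subseteq> {..<n}" for "is"
    using that
  proof (induction "is")
    case Nil
    then show ?case using hom_int_one[OF K hom] subgroup.one_closed[OF K] by simp
  next
    case (Cons i "is")
    then show ?case using hom x subgroup.m_closed[OF K] by auto
  qed
  from this[of "[0..<n]"]
  show "lprod G (map x [0..<n]) \<in> K" "\<tau> (lprod G (map x [0..<n])) = (\<Sum>i<n. \<tau> (x i))"
    by (auto simp: interv_sum_list_conv_sum_set_nat lessThan_atLeast0)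
qed

end

section \<open>Comparison of two decompositions\<close>

definition centreless_part :: "('a, 'b) monoid_scheme \<Rightarrow> 'a set list \<Rightarrow> nat set" where
  "centreless_part G Hs = {i. i < length Hs \<and> centreless G (Hs ! i)}"

definition central_part :: "('a, 'b) monoid_scheme \<Rightarrow> 'a set list \<Rightarrow> nat set" where
  "central_part G Hs = {i. i < length Hs \<and> \<not> centreless G (Hs ! i)}"

context group
begin

lemma projections_eqI:
  assumes "projections G H Hs q" "x \<in> H" "y \<in> H" "\<And>i. i < length Hs \<Longrightarrow> q i x = q i y"
  shows "x = y"
proof -
  have "map (\<lambda>i. q i x) [0..<length Hs] = map (\<lambda>i. q i y) [0..<length Hs]" using assms(4) by simp
  then show ?thesis using projectionsD(3)[OF assms(1,2)] projectionsD(3)[OF assms(1,3)] by metis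
qed

text \<open>Let \<open>p\<close> map a product \<open>L\<close> of commuting factors onto a finite index subgroup of a strongly
  indecomposable \<open>K\<close> with no nontrivial central elements in finite index subgroups. For a factor \<open>Ls ! i\<close> with
  nontrivial image let \<open>C\<close> be the product of the others. The images of \<open>Ls ! i\<close> and \<open>C\<close> commute and
  generate \<open>p ` L\<close>, so their intersection is central and therefore trivial: \<open>p ` L\<close> is their direct
  product. As \<open>K\<close> is strongly indecomposable, the image of \<open>C\<close> is trivial. Thus \<open>p\<close> sees exactly one
  factor of \<open>L\<close>.\<close>

lemma dominating_factor:
  assumes ddL: "direct_decomp G L Ls" and q: "projections G L Ls q"
    and K: "str_indec G K" "centreless G K"
    and p: "\<And>x. x \<in> L \<Longrightarrow> p x \<in> K" "\<And>x y. x \<in> L \<Longrightarrow> y \<in> L \<Longrightarrow> p (x \<otimes> y) = p x \<otimes> p y"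
    and fi: "fin_index G (p ` L) K"
  obtains i where "i < length Ls" "p ` (Ls ! i) \<noteq> {\<one>}" "p ` (Ls ! i) = p ` L"
    "\<And>k x. k < length Ls \<Longrightarrow> k \<noteq> i \<Longrightarrow> x \<in> Ls ! k \<Longrightarrow> p x = \<one>"
proof -
  note D = direct_decompD[OF ddL] and Q = projectionsD[OF q]
  have subK: "subgroup K G" using K(1) unfolding str_indec_def by blast
  have pc: "p x \<in> carrier G" if "x \<in> L" for x using subgroup.mem_carrier[OF subK p(1)[OF that]] .
  have lc: "x \<in> carrier G" if "x \<in> L" for x using subgroup.mem_carrier[OF D(1) that] .
  note one = hom_on_one[OF D(1) pc p(2)] and pinv = hom_on_inv[OF D(1) pc p(2)]
  have subL: "Ls ! i \<subseteq> L" if "i < length Ls" for i using Q(5)[OF that] by blast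
  have infQ: "infinite (p ` L)"
    using fin_index_infinite[OF fi] K(1) unfolding str_indec_def by blast
  have "\<exists>i<length Ls. p ` (Ls ! i) \<noteq> {\<one>}"
  proof (rule ccontr)
    assume "\<not> ?thesis"
    then have triv: "p x = \<one>" if "i < length Ls" "x \<in> Ls ! i" for i x using that by blast
    have "p x = \<one>" if x: "x \<in> L" for x
    proof -
      have "set (map (\<lambda>i. q i x) [0..<length Ls]) \<subseteq> L" using Q(1) x subL by fastforce
      from hom_lprod(2)[OF D(1) pc p(2) this]
      have "p x = lprod G (map (\<lambda>i. p (q i x)) [0..<length Ls])" using Q(3)[OF x] by (simp add: o_def)
      also have "\<dots> = \<one>" by (rule lprod_one) (use triv Q(1) x in auto)
      finally show ?thesis .
    qed
    then have "p ` L \<subseteq> {\<one>}" by blast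
    then show False using infQ finite_subset by blast
  qed
  then obtain i where i: "i < length Ls" "p ` (Ls ! i) \<noteq> {\<one>}" by blast
  define C where "C = {x \<in> L. q i x = \<one>}"
  have qc: "q i x \<in> carrier G" if "x \<in> L" for x
    using subgroup.mem_carrier[OF D(2)[OF i(1)] Q(1)[OF i(1) that]] .
  have subC: "subgroup C G"
  proof (rule subgroupI)
    show "C \<subseteq> carrier G" using lc by (auto simp: C_def)
    have "\<one> \<in> C" using hom_on_one[OF D(1) qc Q(2)[OF i(1)]] subgroup.one_closed[OF D(1)] by (simp add: C_def)
    then show "C \<noteq> {}" by blast
  qed (use Q(2)[OF i(1)] hom_on_inv[OF D(1) qc Q(2)[OF i(1)]] D(1) in
        \<open>auto simp: C_def subgroup.m_closed subgroup.m_inv_closed\<close>)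
  have comm: "y \<otimes> c = c \<otimes> y" if y: "y \<in> Ls ! i" and c: "c \<in> C" for y c
  proof (rule projections_eqI[OF q])
    have yc: "y \<in> L" "c \<in> L" using subL[OF i(1)] y c by (auto simp: C_def)
    then show "y \<otimes> c \<in> L" "c \<otimes> y \<in> L" using D(1) by (auto simp: subgroup.m_closed)
    fix k assume k: "k < length Ls"
    have kc: "q k y \<in> carrier G" "q k c \<in> carrier G"
      using subgroup.mem_carrier[OF D(2)[OF k] Q(1)[OF k]] yc by auto
    have "q k y = \<one> \<or> q k c = \<one>"
      using Q(7)[OF k i(1) _ y] c by (cases "k = i") (auto simp: C_def)
    then show "q k (y \<otimes> c) = q k (c \<otimes> y)"
      using Q(2)[OF k yc] Q(2)[OF k yc(2,1)] kc by auto
  qed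
  have decomp: "\<exists>y\<in>Ls ! i. \<exists>c\<in>C. x = y \<otimes> c \<and> y = q i x" if x: "x \<in> L" for x
  proof -
    let ?y = "q i x" and ?c = "inv (q i x) \<otimes> x"
    have y: "?y \<in> Ls ! i" "?y \<in> L" using Q(1)[OF i(1) x] subL[OF i(1)] by auto
    have cL: "?c \<in> L" using y x D(1) by (simp add: subgroup.m_closed subgroup.m_inv_closed)
    have "q i ?c = inv (q i ?y) \<otimes> q i x"
      using Q(2)[OF i(1) subgroup.m_inv_closed[OF D(1) y(2)] x] hom_on_inv[OF D(1) qc Q(2)[OF i(1)] y(2)]
      by simp
    also have "\<dots> = \<one>" using Q(6)[OF i(1) y(1)] qc[OF x] by simp
    finally have "?c \<in> C" using cL by (simp add: C_def)
    moreover have "x = ?y \<otimes> ?c" using qc[OF x] lc[OF x] by (simp add: m_assoc[symmetric])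
    ultimately show ?thesis using y(1) by blast
  qed
  have CL: "C \<subseteq> L" by (auto simp: C_def)
  have dd: "direct_decomp G (p ` L) [p ` (Ls ! i), p ` C]"
  proof (rule direct_decomp_pairI)
    show "subgroup (p ` (Ls ! i)) G"
      by (rule subgroup_hom_image[OF D(2)[OF i(1)]]) (use pc p(2) subL[OF i(1)] in blast)+
    show "subgroup (p ` C) G" by (rule subgroup_hom_image[OF subC]) (use pc p(2) CL in blast)+
    have pcomm: "p y \<otimes> p c = p c \<otimes> p y" if "y \<in> Ls ! i" "c \<in> C" for y c
    proof -
      have "y \<in> L" "c \<in> L" using that subL[OF i(1)] CL by auto
      then show ?thesis using p(2)[of y c] p(2)[of c y] comm[OF that] by simp
    qed
    then show "a \<otimes> b = b \<otimes> a" if "a \<in> p ` (Ls ! i)" "b \<in> p ` C" for a b using that by blast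
    show "p ` L = {a \<otimes> b | a b. a \<in> p ` (Ls ! i) \<and> b \<in> p ` C}"
    proof (intro equalityI subsetI)
      fix z assume "z \<in> p ` L"
      then obtain x where x: "x \<in> L" "z = p x" by blast
      obtain y c where yc: "y \<in> Ls ! i" "c \<in> C" "x = y \<otimes> c" using decomp[OF x(1)] by blast
      then have "z = p y \<otimes> p c" using x(2) p(2)[of y c] subL[OF i(1)] CL by auto
      then show "z \<in> {a \<otimes> b | a b. a \<in> p ` (Ls ! i) \<and> b \<in> p ` C}" using yc by blast
    next
      fix z assume "z \<in> {a \<otimes> b | a b. a \<in> p ` (Ls ! i) \<and> b \<in> p ` C}"
      then obtain y c where yc: "y \<in> Ls ! i" "c \<in> C" "z = p y \<otimes> p c" by blast
      then have ycL: "y \<in> L" "c \<in> L" using subL[OF i(1)] CL by auto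
      then have "z = p (y \<otimes> c)" using yc p(2) by simp
      then show "z \<in> p ` L" using subgroup.m_closed[OF D(1) ycL] by blast
    qed
    show "p ` (Ls ! i) \<inter> p ` C \<subseteq> {\<one>}"
    proof
      fix z assume "z \<in> p ` (Ls ! i) \<inter> p ` C"
      then obtain y c where z: "z = p y" "z = p c" and yc: "y \<in> Ls ! i" "c \<in> C" by blast
      have zc: "z \<in> carrier G" unfolding z(2) by (rule pc) (use yc CL in blast)
      have "z \<otimes> w = w \<otimes> z" if "w \<in> p ` L" for w
      proof -
        obtain x where x: "x \<in> L" "w = p x" using \<open>w \<in> p ` L\<close> by blast
        obtain y' c' where yc': "y' \<in> Ls ! i" "c' \<in> C" "x = y' \<otimes> c'" using decomp[OF x(1)] by blast
        have L': "y' \<in> L" "c' \<in> L" using yc' subL[OF i(1)] CL by auto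
        have w: "w = p y' \<otimes> p c'" using x yc' p(2)[OF L'] by simp
        have "p y' \<otimes> z = z \<otimes> p y'" "z \<otimes> p c' = p c' \<otimes> z"
          using pcomm[OF yc'(1) yc(2)] pcomm[OF yc(1) yc'(2)] unfolding z(1)[symmetric] z(2)[symmetric] by auto
        then show ?thesis
          using zc pc[OF L'(1)] pc[OF L'(2)] unfolding w by (metis m_assoc)
      qed
      moreover have "z \<in> p ` L" unfolding z(2) using yc(2) CL by blast
      ultimately show "z \<in> {\<one>}" using K(2) fi unfolding centreless_def by blast
    qed
  qed
  then have "p ` C = {\<one>}" using K(1) fi i(2) unfolding str_indec_def by blast
  then have pC: "p c = \<one>" if "c \<in> C" for c using that by blast
  show thesis
  proof (rule that[OF i])
    show "p x = \<one>" if "k < length Ls" "k \<noteq> i" "x \<in> Ls ! k" for k x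
      using pC[of x] Q(7)[OF i(1) that(1) _ that(3)] subL[OF that(1)] that by (auto simp: C_def)
    show "p ` (Ls ! i) = p ` L"
    proof
      show "p ` (Ls ! i) \<subseteq> p ` L" using subL[OF i(1)] by blast
      show "p ` L \<subseteq> p ` (Ls ! i)"
      proof
        fix z assume "z \<in> p ` L"
        then obtain x where x: "x \<in> L" "z = p x" by blast
        obtain y c where yc: "y \<in> Ls ! i" "c \<in> C" "x = y \<otimes> c" using decomp[OF x(1)] by blast
        then have "y \<in> L" "c \<in> L" using subL[OF i(1)] CL by auto
        then have "z = p y" using x yc p(2) pC pc by simp
        then show "z \<in> p ` (Ls ! i)" using yc by blast
      qed
    qed
  qed
qed

text \<open>Each centreless factor \<open>Ms ! j\<close> determines, via the projection of \<open>L\<close> to it, a unique factor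
  \<open>Ls ! \<sigma> j\<close> that survives. If a centreless factor of \<open>L\<close> survived nowhere, its projections would all
  lie in the abelian factors of \<open>M\<close> and it would be abelian; so \<open>\<sigma>\<close> is onto. If \<open>\<sigma>\<close> is moreover injective,
  an element of \<open>Ls ! \<sigma> j\<close> killed by the \<open>j\<close>-th projection has all its nontrivial coordinates in
  abelian factors, hence is central, hence trivial; so the projection is an isomorphism onto a
  subgroup of finite index. Finally, elements of infinite order chosen in the factors of \<open>L\<close> isomorphic to \<open>\<int>\<close> are
  independent and project trivially to the centreless factors of \<open>M\<close>, so there are at most as many
  of them as factors of \<open>M\<close> isomorphic to \<open>\<int>\<close>.\<close>

lemma compare_decompositions:
  assumes ddL: "direct_decomp G L Ls" and ddM: "direct_decomp G M Ms" and fi: "fin_index G L M"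
    and tL: "\<And>i. i < length Ls \<Longrightarrow> tame G (Ls ! i)" and tM: "\<And>j. j < length Ms \<Longrightarrow> tame G (Ms ! j)"
  obtains \<sigma> where "\<sigma> ` centreless_part G Ms = centreless_part G Ls"
    "inj_on \<sigma> (centreless_part G Ms) \<Longrightarrow> \<forall>j\<in>centreless_part G Ms. virt_iso G (Ls ! \<sigma> j) (Ms ! j)"
    "card (central_part G Ls) \<le> card (central_part G Ms)"
proof -
  note D = direct_decompD[OF ddL] and E = direct_decompD[OF ddM]
  have LM: "L \<subseteq> M" using fi unfolding fin_index_def by blast
  obtain q where q: "projections G L Ls q" using direct_decomp_projections[OF ddL] by blast
  obtain p where p: "projections G M Ms p" using direct_decomp_projections[OF ddM] by blast
  note Q = projectionsD[OF q] and P = projectionsD[OF p]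
  let ?I1 = "centreless_part G Ls" and ?J1 = "centreless_part G Ms"
  let ?I0 = "central_part G Ls" and ?J0 = "central_part G Ms"
  have subL: "Ls ! i \<subseteq> L" if "i < length Ls" for i using Q(5)[OF that] by blast
  have pc: "p j x \<in> carrier G" if "j < length Ms" "x \<in> M" for j x
    using subgroup.mem_carrier[OF E(2)[OF that(1)] P(1)[OF that]] .
  have J0: "int_like G (Ms ! j)" if "j \<in> ?J0" for j using that tM unfolding central_part_def tame_def by blast
  have I0: "int_like G (Ls ! i)" if "i \<in> ?I0" for i using that tL unfolding central_part_def tame_def by blast
  have "\<exists>i. i < length Ls \<and> p j ` (Ls ! i) \<noteq> {\<one>} \<and> p j ` (Ls ! i) = p j ` L \<and>
      fin_index G (p j ` L) (Ms ! j) \<and>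
      (\<forall>k<length Ls. k \<noteq> i \<longrightarrow> (\<forall>x\<in>Ls ! k. p j x = \<one>))" if j: "j \<in> ?J1" for j
  proof -
    have jl: "j < length Ms" and cj: "centreless G (Ms ! j)" and sj: "str_indec G (Ms ! j)"
      using j tM unfolding centreless_part_def tame_def by auto
    have "p j ` M = Ms ! j" using P(1)[OF jl] P(5,6)[OF jl] by force
    then have fj: "fin_index G (p j ` L) (Ms ! j)"
      using fin_index_hom_image[OF fi pc[OF jl] P(2)[OF jl]] by simp
    have in1: "p j x \<in> Ms ! j" if "x \<in> L" for x using P(1)[OF jl] LM that by blast
    have hom1: "p j (x \<otimes> y) = p j x \<otimes> p j y" if "x \<in> L" "y \<in> L" for x y using P(2)[OF jl] LM that by blast
    show ?thesis
      by (rule dominating_factor[OF ddL q sj cj in1 hom1 fj]) (use fj in blast)+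
  qed
  then have "\<forall>j\<in>?J1. \<exists>i. i < length Ls \<and> p j ` (Ls ! i) \<noteq> {\<one>} \<and> p j ` (Ls ! i) = p j ` L \<and>
      fin_index G (p j ` L) (Ms ! j) \<and>
      (\<forall>k<length Ls. k \<noteq> i \<longrightarrow> (\<forall>x\<in>Ls ! k. p j x = \<one>))" by blast
  from bchoice[OF this] obtain \<sigma> where "\<forall>j\<in>?J1. \<sigma> j < length Ls \<and> p j ` (Ls ! \<sigma> j) \<noteq> {\<one>} \<and>
      p j ` (Ls ! \<sigma> j) = p j ` L \<and> fin_index G (p j ` L) (Ms ! j) \<and>
      (\<forall>k<length Ls. k \<noteq> \<sigma> j \<longrightarrow> (\<forall>x\<in>Ls ! k. p j x = \<one>))" by blast
  then have \<sigma>: "\<And>j. j \<in> ?J1 \<Longrightarrow> \<sigma> j < length Ls"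
    "\<And>j. j \<in> ?J1 \<Longrightarrow> p j ` (Ls ! \<sigma> j) \<noteq> {\<one>}" "\<And>j. j \<in> ?J1 \<Longrightarrow> p j ` (Ls ! \<sigma> j) = p j ` L"
    "\<And>j. j \<in> ?J1 \<Longrightarrow> fin_index G (p j ` L) (Ms ! j)"
    "\<And>j k x. j \<in> ?J1 \<Longrightarrow> k < length Ls \<Longrightarrow> k \<noteq> \<sigma> j \<Longrightarrow> x \<in> Ls ! k \<Longrightarrow> p j x = \<one>"
    by blast+
  have jl: "j < length Ms" if "j \<in> ?J1" for j using that unfolding centreless_part_def by blast
  have hom: "p j (x \<otimes> y) = p j x \<otimes> p j y" if "j < length Ms" "x \<in> L" "y \<in> L" for j x y
    using P(2) LM that by blast
  have commI: "x \<otimes> y = y \<otimes> x"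
    if x: "x \<in> L" and y: "y \<in> L" and 1: "\<And>j. j \<in> ?J1 \<Longrightarrow> p j x = \<one>" for x y
  proof (rule projections_eqI[OF p])
    show "x \<otimes> y \<in> M" "y \<otimes> x \<in> M" using x y LM subgroup.m_closed[OF D(1)] by blast+
    fix j assume j: "j < length Ms"
    have xy: "p j x \<in> Ms ! j" "p j y \<in> Ms ! j" using P(1)[OF j] x y LM by auto
    have "p j x \<otimes> p j y = p j y \<otimes> p j x"
    proof (cases "j \<in> ?J1")
      case True
      have "p j y \<in> carrier G" using pc[OF j] y LM by blast
      then show ?thesis using 1[OF True] by simp
    next
      case False
      then have "j \<in> ?J0" using j unfolding centreless_part_def central_part_def by blast
      then show ?thesis using int_like_commute[OF J0 xy] by blast
    qed
    then show "p j (x \<otimes> y) = p j (y \<otimes> x)" using hom[OF j x y] hom[OF j y x] by simp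
  qed
  have sI1: "\<sigma> j \<in> ?I1" if j: "j \<in> ?J1" for j
  proof (rule ccontr)
    assume "\<sigma> j \<notin> ?I1"
    then have "\<sigma> j \<in> ?I0" using \<sigma>(1)[OF j] unfolding centreless_part_def central_part_def by blast
    then have ab: "x \<otimes> y = y \<otimes> x" if "x \<in> Ls ! \<sigma> j" "y \<in> Ls ! \<sigma> j" for x y
      using int_like_commute[OF I0] that by blast
    have "z = \<one>" if z: "z \<in> p j ` L" for z
    proof -
      have "z \<otimes> w = w \<otimes> z" if w: "w \<in> p j ` L" for w
      proof -
        obtain x y where xy: "x \<in> Ls ! \<sigma> j" "y \<in> Ls ! \<sigma> j" "z = p j x" "w = p j y"
          using z w \<sigma>(3)[OF j] by blast
        then have "x \<in> L" "y \<in> L" using subL[OF \<sigma>(1)[OF j]] by auto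
        then show ?thesis
          using xy(3,4) ab[OF xy(1,2)] hom[OF jl[OF j], of x y] hom[OF jl[OF j], of y x] by simp
      qed
      then show ?thesis using j \<sigma>(4)[OF j] z unfolding centreless_part_def centreless_def by blast
    qed
    then have "p j ` (Ls ! \<sigma> j) \<subseteq> {\<one>}" unfolding \<sigma>(3)[OF j] by blast
    moreover have "p j ` (Ls ! \<sigma> j) \<noteq> {}" using subgroup.one_closed[OF D(2)[OF \<sigma>(1)[OF j]]] by blast
    ultimately show False using \<sigma>(2)[OF j] subset_singletonD by metis
  qed
  have "i \<in> \<sigma> ` ?J1" if i: "i \<in> ?I1" for i
  proof (rule ccontr)
    assume n: "i \<notin> \<sigma> ` ?J1"
    have il: "i < length Ls" and ci: "centreless G (Ls ! i)" using i unfolding centreless_part_def by auto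
    have "x = \<one>" if x: "x \<in> Ls ! i" for x
    proof -
      have "x \<otimes> y = y \<otimes> x" if y: "y \<in> Ls ! i" for y
        by (rule commI) (use x y subL[OF il] \<sigma>(5)[OF _ il] n in auto)
      then show ?thesis using ci x fin_index_refl[OF D(2)[OF il]] unfolding centreless_def by blast
    qed
    then have "Ls ! i \<subseteq> {\<one>}" by blast
    then show False using ci finite_subset unfolding centreless_def by blast
  qed
  then have surj: "\<sigma> ` ?J1 = ?I1" using sI1 by blast
  have viso: "\<forall>j\<in>?J1. virt_iso G (Ls ! \<sigma> j) (Ms ! j)" if inj: "inj_on \<sigma> ?J1"
  proof
    fix j assume j: "j \<in> ?J1"
    let ?K = "Ls ! \<sigma> j"
    note il = \<sigma>(1)[OF j]
    have K: "subgroup ?K G" by (rule D(2)[OF il])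
    have ci: "centreless G ?K" using sI1[OF j] unfolding centreless_part_def by blast
    have KL: "?K \<subseteq> L" by (rule subL[OF il])
    have ker: "x = \<one>" if x: "x \<in> ?K" and 1: "p j x = \<one>" for x
    proof -
      have "x \<otimes> y = y \<otimes> x" if y: "y \<in> ?K" for y
      proof (rule commI)
        fix k assume k: "k \<in> ?J1"
        show "p k x = \<one>"
        proof (cases "k = j")
          case False
          then have "\<sigma> j \<noteq> \<sigma> k" using inj j k by (auto dest: inj_onD)
          then show ?thesis using \<sigma>(5)[OF k il _ x] by blast
        qed (use 1 in simp)
      qed (use x y KL in auto)
      then show ?thesis using ci x fin_index_refl[OF K] unfolding centreless_def by blast
    qed
    have pcK: "p j x \<in> carrier G" if "x \<in> ?K" for x using pc[OF jl[OF j]] that KL LM by blast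
    have homK: "p j (x \<otimes> y) = p j x \<otimes> p j y" if "x \<in> ?K" "y \<in> ?K" for x y
      using hom[OF jl[OF j]] that KL by blast
    have "inj_on (p j) ?K"
    proof (rule inj_onI)
      fix x y assume xy: "x \<in> ?K" "y \<in> ?K" "p j x = p j y"
      have iy: "inv y \<in> ?K" using xy K by (simp add: subgroup.m_inv_closed)
      have "p j (x \<otimes> inv y) = \<one>"
        using homK[OF xy(1) iy] hom_on_inv[OF K pcK homK xy(2)] xy(3) pcK[OF xy(2)] by simp
      then have "x \<otimes> inv y = \<one>" using ker[OF subgroup.m_closed[OF K xy(1) iy]] by blast
      then show "x = y" using subgroup.mem_carrier[OF K] xy by (metis inv_closed inv_equality inv_inv)
    qed
    then have "p j \<in> iso (G\<lparr>carrier := ?K\<rparr>) (G\<lparr>carrier := p j ` ?K\<rparr>)"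
      using homK by (auto simp: iso_def hom_def bij_betw_def)
    then show "virt_iso G ?K (Ms ! j)"
      using fin_index_refl[OF K] \<sigma>(3,4)[OF j] unfolding virt_iso_def is_iso_def by auto
  qed
  \<comment> \<open>if there were too many factors embedding into \<open>\<int>\<close>, some nontrivial product of powers of their
    elements \<open>b i\<close> would be killed by all projections to the corresponding factors of \<open>M\<close>\<close>
  have "card ?I0 \<le> card ?J0"
  proof (rule ccontr)
    assume less: "\<not> ?thesis"
    have "\<exists>b. b \<in> Ls ! i \<and> (i \<in> ?I0 \<longrightarrow> (\<forall>k::int. b [^] k = \<one> \<longrightarrow> k = 0)) \<and> (i \<notin> ?I0 \<longrightarrow> b = \<one>)"
      if il: "i < length Ls" for i
    proof (cases "i \<in> ?I0")
      case True
      then show ?thesis using int_like_obtain[OF I0[OF True]] by metis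
    qed (use subgroup.one_closed[OF D(2)[OF il]] in blast)
    then obtain b where b: "\<And>i. i < length Ls \<Longrightarrow> b i \<in> Ls ! i"
      "\<And>i k. i < length Ls \<Longrightarrow> i \<in> ?I0 \<Longrightarrow> b i [^] (k::int) = \<one> \<Longrightarrow> k = 0"
      "\<And>i. i < length Ls \<Longrightarrow> i \<notin> ?I0 \<Longrightarrow> b i = \<one>"
      by metis
    have "\<exists>\<tau> :: 'a \<Rightarrow> int. (\<forall>x\<in>Ms ! j. \<forall>y\<in>Ms ! j. \<tau> (x \<otimes> y) = \<tau> x + \<tau> y) \<and> (\<forall>x\<in>Ms ! j. \<tau> x = 0 \<longrightarrow> x = \<one>)"
      if "j \<in> ?J0" for j using J0[OF that] unfolding int_like_def by blast
    then obtain \<tau> :: "nat \<Rightarrow> 'a \<Rightarrow> int" where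
      \<tau>hom: "\<And>j x y. j \<in> ?J0 \<Longrightarrow> x \<in> Ms ! j \<Longrightarrow> y \<in> Ms ! j \<Longrightarrow> \<tau> j (x \<otimes> y) = \<tau> j x + \<tau> j y"
      and \<tau>inj: "\<And>j x. j \<in> ?J0 \<Longrightarrow> x \<in> Ms ! j \<Longrightarrow> \<tau> j x = 0 \<Longrightarrow> x = \<one>" by metis
    have fin: "finite ?I0" "finite ?J0" unfolding central_part_def by auto
    obtain n where n: "\<exists>i\<in>?I0. n i \<noteq> 0" "\<forall>j\<in>?J0. (\<Sum>i\<in>?I0. n i * \<tau> j (p j (b i))) = 0"
      using dependent_family[of ?J0 ?I0 "\<lambda>i j. \<tau> j (p j (b i))"] fin less by auto
    let ?x = "\<lambda>i. b i [^] n i"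
    have bn: "?x i \<in> Ls ! i" if "i < length Ls" for i
      using subgroup_int_pow_closed[OF D(2)[OF that] b(1)[OF that]] .
    define \<phi> where "\<phi> = lprod G (map ?x [0..<length Ls])"
    have \<phi>L: "\<phi> \<in> L" unfolding \<phi>_def by (rule D(5)[OF bn])
    have sets: "set (map ?x [0..<length Ls]) \<subseteq> L" using bn subL by fastforce
    have "p j \<phi> = \<one>" if j: "j < length Ms" for j
    proof -
      have cj: "p j x \<in> carrier G" if "x \<in> L" for x using pc[OF j] that LM by blast
      have eq: "p j \<phi> = lprod G (map (\<lambda>i. p j (?x i)) [0..<length Ls])"
        unfolding \<phi>_def using hom_lprod(2)[OF D(1) cj hom[OF j] sets] by (simp add: o_def)
      show ?thesis
      proof (cases "j \<in> ?J1")
        case True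
        show ?thesis unfolding eq
        proof (rule lprod_one)
          fix i assume "i \<in> set [0..<length Ls]"
          then have i: "i < length Ls" by simp
          show "p j (?x i) = \<one>"
          proof (cases "i \<in> ?I0")
            case True
            then have "i \<noteq> \<sigma> j" using sI1[OF \<open>j \<in> ?J1\<close>] unfolding centreless_part_def central_part_def by blast
            then show ?thesis using \<sigma>(5)[OF \<open>j \<in> ?J1\<close> i _ bn[OF i]] by blast
          next
            case False
            then show ?thesis using b(3)[OF i] hom_on_one[OF D(1) cj hom[OF j]] by simp
          qed
        qed
      next
        case False
        then have j0: "j \<in> ?J0" using j unfolding centreless_part_def central_part_def by blast
        have in_j: "p j (?x i) \<in> Ms ! j" if "i < length Ls" for i
          using P(1)[OF j] bn[OF that] subL[OF that] LM by blast
        define t where "t x = \<tau> j (p j x)" for x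
        have homL: "t (x \<otimes> y) = t x + t y" if "x \<in> L" "y \<in> L" for x y
          unfolding t_def using hom[OF j that] \<tau>hom[OF j0] P(1)[OF j] that LM by auto
        have bL: "b i \<in> L" "?x i \<in> L" if "i < length Ls" for i using b(1) bn subL that by blast+
        have "t \<phi> = (\<Sum>i<length Ls. t (?x i))"
          unfolding \<phi>_def by (rule hom_int_lprod(2)[OF D(1)]) (use homL bL in auto)
        also have "\<dots> = (\<Sum>i<length Ls. n i * t (b i))"
          by (rule sum.cong) (use hom_int_int_pow[OF D(1), of t, OF homL bL(1)] in auto)
        also have "\<dots> = (\<Sum>i\<in>?I0. n i * t (b i))"
        proof (rule sum.mono_neutral_right)
          show "\<forall>i\<in>{..<length Ls} - ?I0. n i * t (b i) = 0"
            using b(3) hom_int_one[OF D(1), of t, OF homL] by auto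
        qed (auto simp: central_part_def)
        also have "\<dots> = 0" unfolding t_def using n(2) j0 by blast
        finally have "\<tau> j (p j \<phi>) = 0" unfolding t_def .
        then show ?thesis using \<tau>inj[OF j0] P(1)[OF j] \<phi>L LM by blast
      qed
    qed
    moreover have "p j \<one> = \<one>" if j: "j < length Ms" for j
      using hom_on_one[OF E(1) pc[OF j] P(2)[OF j]] by blast
    ultimately have "\<phi> = \<one>"
      using projections_eqI[OF p, of \<phi> \<one>] \<phi>L LM subgroup.one_closed[OF E(1)] by auto
    then have "?x i = \<one>" if "i < length Ls" for i
      using D(4)[of ?x, OF bn _ that] unfolding \<phi>_def by blast
    then have "n i = 0" if "i \<in> ?I0" for i
      using b(2)[of i "n i"] that unfolding central_part_def by blast
    then show False using n(1) by blast
  qed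
  then show thesis using that surj viso by blast
qed

end

section \<open>Existence and uniqueness from three group-theoretic hypotheses\<close>

text \<open>The hypotheses are what the argument uses of a Coxeter group: it is virtually torsion-free, every
  central element of infinite order in a subgroup is detected by a homomorphism of that subgroup to
  \<open>\<int>\<close>, and the rank of free abelian subgroups is bounded. The last condition is phrased for families
  of commuting elements whose only relation is the trivial one.\<close>

locale detecting_group = group G for G (structure) +
  fixes \<Gamma> :: "'a set" and r :: nat
  assumes torsion_free_index: "fin_index G \<Gamma> (carrier G)"
    and torsion_free: "\<And>x n. x \<in> \<Gamma> \<Longrightarrow> 0 < n \<Longrightarrow> x [^] (n::nat) = \<one> \<Longrightarrow> x = \<one>"
    and detect: "\<And>B a. subgroup B G \<Longrightarrow> a \<in> B \<Longrightarrow> (\<And>x. x \<in> B \<Longrightarrow> a \<otimes> x = x \<otimes> a) \<Longrightarrow>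
        (\<And>n. 0 < n \<Longrightarrow> a [^] (n::nat) \<noteq> \<one>) \<Longrightarrow>
        \<exists>\<tau> :: 'a \<Rightarrow> int. (\<forall>x\<in>B. \<forall>y\<in>B. \<tau> (x \<otimes> y) = \<tau> x + \<tau> y) \<and> \<tau> a \<noteq> 0"
    and rank_bound: "\<And>b m. (\<And>i. i < m \<Longrightarrow> b i \<in> carrier G) \<Longrightarrow>
        (\<And>i j. i < m \<Longrightarrow> j < m \<Longrightarrow> b i \<otimes> b j = b j \<otimes> b i) \<Longrightarrow>
        (\<And>(n :: nat \<Rightarrow> int) i. lprod G (map (\<lambda>i. b i [^] n i) [0..<m]) = \<one> \<Longrightarrow> i < m \<Longrightarrow> n i = 0) \<Longrightarrow>
        m \<le> r"
begin

lemma torsion_free_int: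
  assumes "x \<in> \<Gamma>" "x [^] (k::int) = \<one>" "x \<noteq> \<one>"
  shows "k = 0"
proof (cases k rule: int_cases2)
  case (nonneg n)
  then have "x [^] n = \<one>" using assms(2) by (simp add: int_pow_int)
  then show ?thesis using torsion_free[OF assms(1), of n] assms(3) nonneg by auto
next
  case (nonpos n)
  have xc: "x \<in> carrier G"
    using assms(1) torsion_free_index unfolding fin_index_def by blast
  have "inv (x [^] n) = \<one>" using assms(2) nonpos int_pow_neg_int[OF xc] by simp
  then have "x [^] n = \<one>" using xc by (metis inv_inv inv_one nat_pow_closed)
  then show ?thesis using torsion_free[OF assms(1), of n] assms(3) nonpos by auto
qed

lemma nontrivial_infinite:
  assumes K: "subgroup K G" "K \<subseteq> \<Gamma>" "K \<noteq> {\<one>}"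
  shows "infinite K"
proof
  assume fin: "finite K"
  obtain x where x: "x \<in> K" "x \<noteq> \<one>" using K subgroup.one_closed by blast
  interpret K: group "G\<lparr>carrier := K\<rparr>" by (rule subgroup_imp_group[OF K(1)])
  let ?n = "order (G\<lparr>carrier := K\<rparr>)"
  have "0 < ?n" using fin K.order_gt_0_iff_finite by simp
  moreover have "x [^] ?n = \<one>"
    using K.pow_order_eq_1[of x] x(1) nat_pow_consistent[of x ?n K] by simp
  ultimately show False using torsion_free[of x ?n] x K(2) by blast
qed

text \<open>If some subgroup of finite index has a nontrivial central element, this element is detected by a
  homomorphism to \<open>\<int>\<close>, so it splits off virtually; strong indecomposability then forces the kernel of
  the homomorphism to be trivial.\<close>

lemma tame_finite_index_subgroup:
  assumes K: "str_indec G K" "K \<subseteq> \<Gamma>"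
  shows "\<exists>M. fin_index G M K \<and> tame G M"
proof (cases "centreless G K")
  case True
  then show ?thesis using K fin_index_refl unfolding tame_def str_indec_def by blast
next
  case False
  then obtain M a where M: "fin_index G M K" and a: "a \<in> M" "a \<noteq> \<one>"
    and central: "\<And>x. x \<in> M \<Longrightarrow> a \<otimes> x = x \<otimes> a"
    using K(1) unfolding centreless_def str_indec_def by blast
  have subM: "subgroup M G" "M \<subseteq> K" using M unfolding fin_index_def by auto
  have inf: "a [^] n \<noteq> \<one>" if "0 < n" for n :: nat using torsion_free[of a n] a subM(2) K(2) that by blast
  obtain \<tau> :: "'a \<Rightarrow> int" where hom: "\<And>x y. x \<in> M \<Longrightarrow> y \<in> M \<Longrightarrow> \<tau> (x \<otimes> y) = \<tau> x + \<tau> y" and ta: "\<tau> a \<noteq> 0"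
    using detect[OF subM(1) a(1) central inf] by blast
  note dd = central_splits[OF subM(1) hom a(1) ta central]
  have "fin_index G {x \<in> M. \<tau> a dvd \<tau> x} K"
    by (rule fin_index_trans[OF fin_index_kernel_mod[OF subM(1) hom ta] M])
  then have "range (\<lambda>k::int. a [^] k) = {\<one>} \<or> {x \<in> M. \<tau> x = 0} = {\<one>}"
    using K(1) dd unfolding str_indec_def by blast
  moreover have "a [^] (1::int) = a" using subgroup.mem_carrier[OF subM(1) a(1)] by simp
  then have "range (\<lambda>k::int. a [^] k) \<noteq> {\<one>}" using a(2) by (metis rangeI singletonD)
  ultimately have ker: "{x \<in> M. \<tau> x = 0} = {\<one>}" by blast
  have "int_like G M"
    unfolding int_like_def using subM(1) a hom ker by (intro conjI exI[of _ \<tau>]) auto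
  then show ?thesis using M str_indec_fin_index[OF K(1) M] unfolding tame_def by blast
qed

definition splits_into :: "nat \<Rightarrow> bool" where
  "splits_into m \<longleftrightarrow> (\<exists>H Hs. fin_index G H (carrier G) \<and> H \<subseteq> \<Gamma> \<and> direct_decomp G H Hs \<and>
     (\<forall>i<length Hs. Hs ! i \<noteq> {\<one>}) \<and> length Hs = m)"

text \<open>One nontrivial element from each factor gives commuting elements of infinite order, and the
  uniqueness of coordinates makes them independent.\<close>

lemma splits_into_bounded:
  assumes "splits_into m" shows "m \<le> r"
proof -
  obtain H Hs where H: "H \<subseteq> \<Gamma>" and dd: "direct_decomp G H Hs"
    and nt: "\<And>i. i < length Hs \<Longrightarrow> Hs ! i \<noteq> {\<one>}" and len: "length Hs = m"
    using assms unfolding splits_into_def by blast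
  note D = direct_decompD[OF dd]
  obtain q where "projections G H Hs q" using direct_decomp_projections[OF dd] by blast
  note Q = projectionsD[OF this]
  have "\<forall>i\<in>{..<m}. \<exists>b. b \<in> Hs ! i \<and> b \<noteq> \<one>"
    using nt D(2) len subgroup.one_closed by (metis lessThan_iff singletonI subsetI subset_antisym empty_iff insert_iff)
  from bchoice[OF this] obtain b where b: "\<And>i. i < m \<Longrightarrow> b i \<in> Hs ! i" "\<And>i. i < m \<Longrightarrow> b i \<noteq> \<one>" by blast
  have b\<Gamma>: "b i \<in> \<Gamma>" if "i < m" for i using Q(5)[of i "b i"] b(1) H len that by blast
  show ?thesis
  proof (rule rank_bound[of m b])
    show "b i \<in> carrier G" if "i < m" for i
      using subgroup.mem_carrier[OF D(2) b(1)[OF that]] that len by simp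
    show "b i \<otimes> b j = b j \<otimes> b i" if "i < m" "j < m" for i j
      using D(3)[of i j] b(1) that len by (cases "i = j") auto
    fix n :: "nat \<Rightarrow> int" and i
    assume one: "lprod G (map (\<lambda>i. b i [^] n i) [0..<m]) = \<one>" and i: "i < m"
    have "b i [^] n i = \<one>"
    proof (rule D(4)[of "\<lambda>i. b i [^] n i"])
      show "b i [^] n i \<in> Hs ! i" if "i < length Hs" for i
        using subgroup_int_pow_closed[OF D(2)[OF that] b(1)] that len by simp
    qed (use one i len in auto)
    then show "n i = 0" using torsion_free_int[OF b\<Gamma>[OF i]] b(2)[OF i] by blast
  qed
qed

lemma splits_into_something: "\<exists>m. splits_into m"
proof (cases "\<Gamma> = {\<one>}")
  case True
  have "direct_decomp G \<Gamma> []" by (rule direct_decompI) (auto simp: True)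
  then show ?thesis unfolding splits_into_def using torsion_free_index
    by (intro exI[of _ 0] exI[of _ \<Gamma>] exI[of _ "[]"]) auto
next
  case False
  have \<Gamma>: "subgroup \<Gamma> G" using torsion_free_index unfolding fin_index_def by blast
  have one: "lprod G (map x [0..<length [\<Gamma>]]) = x 0" if "x 0 \<in> \<Gamma>" for x
    using subgroup.mem_carrier[OF \<Gamma> that] by simp
  have "direct_decomp G \<Gamma> [\<Gamma>]"
  proof (rule direct_decompI)
    show "\<Gamma> = {lprod G (map x [0..<length [\<Gamma>]]) | x. \<forall>i<length [\<Gamma>]. x i \<in> [\<Gamma>] ! i}"
    proof (intro equalityI subsetI)
      fix g assume "g \<in> \<Gamma>"
      then show "g \<in> {lprod G (map x [0..<length [\<Gamma>]]) | x. \<forall>i<length [\<Gamma>]. x i \<in> [\<Gamma>] ! i}"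
        using one[of "\<lambda>_. g"] by (intro CollectI exI[of _ "\<lambda>_. g"]) auto
    next
      fix g assume "g \<in> {lprod G (map x [0..<length [\<Gamma>]]) | x. \<forall>i<length [\<Gamma>]. x i \<in> [\<Gamma>] ! i}"
      then obtain x where x: "g = lprod G (map x [0..<length [\<Gamma>]])" "\<forall>i<length [\<Gamma>]. x i \<in> [\<Gamma>] ! i" by blast
      then have "x 0 \<in> \<Gamma>" by simp
      then show "g \<in> \<Gamma>" using one[of x] x(1) by simp
    qed
    show "x i = \<one>" if x: "\<And>i. i < length [\<Gamma>] \<Longrightarrow> x i \<in> [\<Gamma>] ! i"
      and 1: "lprod G (map x [0..<length [\<Gamma>]]) = \<one>" and i: "i < length [\<Gamma>]" for x i
    proof -
      have "x 0 \<in> \<Gamma>" using x[of 0] by simp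
      then show ?thesis using one[of x] 1 i by simp
    qed
  qed (use \<Gamma> in auto)
  then show ?thesis unfolding splits_into_def using torsion_free_index False
    by (intro exI[of _ 1] exI[of _ \<Gamma>] exI[of _ "[\<Gamma>]"]) auto
qed

text \<open>Choose a decomposition, within the torsion-free subgroup, with the largest number of nontrivial
  factors. A nontrivial splitting of a finite index subgroup of one of the factors would give a longer
  one. All nontrivial subgroups involved are infinite because there is no torsion.\<close>

theorem virtual_strong_Remak_decomposition_exists:
  "\<exists>H Hs. virtual_strong_Remak_decomposition G H Hs"
proof -
  have fin: "finite {m. splits_into m}"
    using splits_into_bounded by (meson finite_nat_set_iff_bounded_le mem_Collect_eq)
  define m where "m = Max {m. splits_into m}"
  have m: "splits_into m" "\<And>k. splits_into k \<Longrightarrow> k \<le> m"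
    using Max_in[OF fin] Max_ge[OF fin] splits_into_something unfolding m_def by auto
  obtain H Hs where H: "fin_index G H (carrier G)" "H \<subseteq> \<Gamma>" and dd: "direct_decomp G H Hs"
    and nt: "\<And>i. i < length Hs \<Longrightarrow> Hs ! i \<noteq> {\<one>}" and len: "length Hs = m"
    using m(1) unfolding splits_into_def by blast
  note D = direct_decompD[OF dd]
  obtain q where "projections G H Hs q" using direct_decomp_projections[OF dd] by blast
  note Q = projectionsD[OF this]
  have "str_indec G (Hs ! i)" if i: "i < length Hs" for i
    unfolding str_indec_def
  proof (intro conjI allI impI)
    show "subgroup (Hs ! i) G" by (rule D(2)[OF i])
    show "infinite (Hs ! i)" by (rule nontrivial_infinite[OF D(2)[OF i] _ nt[OF i]]) (use Q(5)[OF i] H in blast)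
    fix M A B assume M: "fin_index G M (Hs ! i)" and AB: "direct_decomp G M [A, B]"
    show "A = {\<one>} \<or> B = {\<one>}"
    proof (rule ccontr)
      assume n: "\<not> ?thesis"
      let ?Ls = "Hs[i := M]"
      have fi: "fin_index G (?Ls ! k) (Hs ! k)" if "k < length Hs" for k
        using M fin_index_refl[OF D(2)[OF that]] that by (cases "k = i") auto
      obtain L where L: "direct_decomp G L ?Ls" "fin_index G L H"
        using direct_decomp_fin_index[OF dd _ fi] by auto
      have "direct_decomp G L (?Ls[i := A] @ [B])"
        by (rule direct_decomp_split[OF L(1)]) (use AB i in auto)
      moreover have "(?Ls[i := A] @ [B]) ! k \<noteq> {\<one>}" if "k < length (?Ls[i := A] @ [B])" for k
        using that n nt i by (auto simp: nth_append nth_list_update less_Suc_eq)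
      moreover have "fin_index G L (carrier G)" by (rule fin_index_trans[OF L(2) H(1)])
      moreover have "L \<subseteq> \<Gamma>" using L(2) H(2) unfolding fin_index_def by blast
      ultimately have "splits_into (length (?Ls[i := A] @ [B]))" unfolding splits_into_def by blast
      then have "splits_into (Suc m)" using len by simp
      then show False using m(2) by fastforce
    qed
  qed
  then show ?thesis using H(1) dd unfolding virtual_strong_Remak_decomposition_iff by blast
qed

text \<open>Passing to finite index in each factor changes it only within its commensurability class, so it may
  be assumed to be either a copy of \<open>\<int>\<close> or centreless.\<close>

lemma tame_refinement:
  assumes H: "fin_index G H (carrier G)" and dd: "direct_decomp G H Hs"
    and si: "\<And>i. i < length Hs \<Longrightarrow> str_indec G (Hs ! i)"
  obtains M Ms where "fin_index G M (carrier G)" "direct_decomp G M Ms" "length Ms = length Hs"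
    "\<And>i. i < length Hs \<Longrightarrow> fin_index G (Ms ! i) (Hs ! i)" "\<And>i. i < length Hs \<Longrightarrow> tame G (Ms ! i)"
proof -
  have "\<exists>M. fin_index G M (Hs ! i) \<and> tame G M" if i: "i < length Hs" for i
  proof -
    have Hi: "subgroup (Hs ! i) G" using direct_decompD(2)[OF dd i] .
    have fi: "fin_index G (\<Gamma> \<inter> Hs ! i) (Hs ! i)"
      by (rule fin_index_Int[OF torsion_free_index Hi subgroup.subset[OF Hi]])
    obtain M where "fin_index G M (\<Gamma> \<inter> Hs ! i)" "tame G M"
      using tame_finite_index_subgroup[OF str_indec_fin_index[OF si[OF i] fi]] by blast
    then show ?thesis using fin_index_trans[OF _ fi] by blast
  qed
  then obtain Ms where Ms: "length Ms = length Hs" "\<And>i. i < length Hs \<Longrightarrow> fin_index G (Ms ! i) (Hs ! i)"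
    "\<And>i. i < length Hs \<Longrightarrow> tame G (Ms ! i)"
    using Skolem_list_nth[of "length Hs" "\<lambda>i M. fin_index G M (Hs ! i) \<and> tame G M"] by auto
  obtain M where "direct_decomp G M Ms" "fin_index G M H"
    using direct_decomp_fin_index[OF dd Ms(1,2)] by blast
  then show thesis using that fin_index_trans[OF _ H] Ms by blast
qed

lemma tame_comparison:
  assumes H: "fin_index G H (carrier G)" and ddH: "direct_decomp G H Hs"
    and tH: "\<And>i. i < length Hs \<Longrightarrow> tame G (Hs ! i)"
    and M: "fin_index G M (carrier G)" and ddM: "direct_decomp G M Ms"
    and tM: "\<And>i. i < length Ms \<Longrightarrow> tame G (Ms ! i)"
  obtains \<sigma> where "\<sigma> ` centreless_part G Ms = centreless_part G Hs"
    "inj_on \<sigma> (centreless_part G Ms) \<Longrightarrow> \<forall>j\<in>centreless_part G Ms. virt_iso G (Hs ! \<sigma> j) (Ms ! j)"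
    "card (central_part G Hs) \<le> card (central_part G Ms)"
proof -
  note D = direct_decompD[OF ddH]
  have subM: "subgroup M G" using M unfolding fin_index_def by blast
  define Ls where "Ls = map (\<lambda>K. M \<inter> K) Hs"
  have len: "length Ls = length Hs" by (simp add: Ls_def)
  have fi: "fin_index G (Ls ! i) (Hs ! i)" if "i < length Hs" for i
    using fin_index_Int[OF M D(2)[OF that] subgroup.subset[OF D(2)[OF that]]] that by (simp add: Ls_def)
  obtain L where L: "direct_decomp G L Ls" "fin_index G L H"
    using direct_decomp_fin_index[OF ddH len fi] by blast
  have "L \<subseteq> M"
  proof
    fix x assume "x \<in> L"
    then obtain y where y: "x = lprod G (map y [0..<length Ls])" "\<forall>i<length Ls. y i \<in> Ls ! i"
      using direct_decompD(6)[OF L(1)] by blast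
    have "set (map y [0..<length Ls]) \<subseteq> M" using y(2) len by (auto simp: Ls_def)
    from hom_lprod(1)[OF subM _ _ this, of "\<lambda>x. x"] show "x \<in> M"
      using y(1) subgroup.mem_carrier[OF subM] by simp
  qed
  have LG: "fin_index G L (carrier G)" by (rule fin_index_trans[OF L(2) H])
  have LM: "fin_index G L M"
    by (rule fin_index_restrict[OF LG subM \<open>L \<subseteq> M\<close> subgroup.subset[OF subM]])
  have tL: "tame G (Ls ! i)" "centreless G (Ls ! i) \<longleftrightarrow> centreless G (Hs ! i)" if "i < length Hs" for i
    using tame_fin_index[OF tH fi] that by auto
  have parts: "centreless_part G Ls = centreless_part G Hs" "central_part G Ls = central_part G Hs"
    using tL(2) len by (auto simp: centreless_part_def central_part_def)
  have tL': "tame G (Ls ! i)" if "i < length Ls" for i using tL(1) that len by simp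
  obtain \<sigma> where \<sigma>: "\<sigma> ` centreless_part G Ms = centreless_part G Hs"
    "inj_on \<sigma> (centreless_part G Ms) \<Longrightarrow> \<forall>j\<in>centreless_part G Ms. virt_iso G (Ls ! \<sigma> j) (Ms ! j)"
    "card (central_part G Hs) \<le> card (central_part G Ms)"
    using compare_decompositions[OF L(1) ddM LM tL' tM] unfolding parts by blast
  show thesis
  proof (rule that[OF \<sigma>(1) _ \<sigma>(3)], rule ballI)
    fix j assume "inj_on \<sigma> (centreless_part G Ms)" and j: "j \<in> centreless_part G Ms"
    then have v: "virt_iso G (Ls ! \<sigma> j) (Ms ! j)" using \<sigma>(2) by blast
    have "\<sigma> j < length Hs" using \<sigma>(1) j unfolding centreless_part_def by blast
    moreover have "j < length Ms" using j unfolding centreless_part_def by blast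
    ultimately show "virt_iso G (Hs ! \<sigma> j) (Ms ! j)"
      using virt_iso_mono[OF v fi fin_index_refl[OF direct_decompD(2)[OF ddM]]] by blast
  qed
qed

text \<open>The comparison applies in both directions, so the number of centreless factors and the number of
  factors of type \<open>\<int>\<close> agree. Hence the surjection between the indices of centreless factors is a
  bijection, and any bijection will do for the remaining indices, as all copies of \<open>\<int>\<close> are
  commensurable.\<close>

theorem virtual_strong_Remak_decomposition_unique:
  assumes "virtual_strong_Remak_decomposition G H Hs" "virtual_strong_Remak_decomposition G H' Hs'"
  shows "equivalent_decompositions G Hs Hs'"
proof -
  have H: "fin_index G H (carrier G)" "direct_decomp G H Hs" "\<And>i. i < length Hs \<Longrightarrow> str_indec G (Hs ! i)"
    and H': "fin_index G H' (carrier G)" "direct_decomp G H' Hs'" "\<And>i. i < length Hs' \<Longrightarrow> str_indec G (Hs' ! i)"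
    using assms unfolding virtual_strong_Remak_decomposition_iff by auto
  obtain M Ms where M: "fin_index G M (carrier G)" "direct_decomp G M Ms" "length Ms = length Hs"
    "\<And>i. i < length Hs \<Longrightarrow> fin_index G (Ms ! i) (Hs ! i)" "\<And>i. i < length Hs \<Longrightarrow> tame G (Ms ! i)"
    using tame_refinement[OF H] by blast
  obtain N Ns where N: "fin_index G N (carrier G)" "direct_decomp G N Ns" "length Ns = length Hs'"
    "\<And>i. i < length Hs' \<Longrightarrow> fin_index G (Ns ! i) (Hs' ! i)" "\<And>i. i < length Hs' \<Longrightarrow> tame G (Ns ! i)"
    using tame_refinement[OF H'] by blast
  have tM: "tame G (Ms ! i)" if "i < length Ms" for i using M that by simp
  have tN: "tame G (Ns ! i)" if "i < length Ns" for i using N that by simp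
  let ?I1 = "centreless_part G Ms" and ?J1 = "centreless_part G Ns"
  let ?I0 = "central_part G Ms" and ?J0 = "central_part G Ns"
  have fin: "finite ?I1" "finite ?J1" "finite ?I0" "finite ?J0"
    by (auto simp: centreless_part_def central_part_def)
  obtain \<sigma> where \<sigma>: "\<sigma> ` ?J1 = ?I1"
    "inj_on \<sigma> ?J1 \<Longrightarrow> \<forall>j\<in>?J1. virt_iso G (Ms ! \<sigma> j) (Ns ! j)" "card ?I0 \<le> card ?J0"
    using tame_comparison[OF M(1,2) tM N(1,2) tN] by blast
  obtain \<rho> where \<rho>: "\<rho> ` ?I1 = ?J1" "card ?J0 \<le> card ?I0"
    using tame_comparison[OF N(1,2) tN M(1,2) tM] by blast
  have "card ?J1 = card (\<sigma> ` ?J1)"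
    using card_image_le[OF fin(2), of \<sigma>] card_image_le[OF fin(1), of \<rho>] \<sigma>(1) \<rho>(1) by simp
  then have inj: "inj_on \<sigma> ?J1" using eq_card_imp_inj_on[OF fin(2)] by metis
  obtain \<upsilon> where \<upsilon>: "bij_betw \<upsilon> ?J0 ?I0"
    using \<sigma>(3) \<rho>(2) fin bij_betw_iff_card[of ?J0 ?I0] by auto
  define \<pi> where "\<pi> j = (if j \<in> ?J1 then \<sigma> j else if j \<in> ?J0 then \<upsilon> j else j)" for j
  have disj: "?J1 \<inter> ?J0 = {}" "?I1 \<inter> ?I0 = {}"
    and un: "?J1 \<union> ?J0 = {..<length Ns}" "?I1 \<union> ?I0 = {..<length Ms}"
    by (auto simp: centreless_part_def central_part_def)
  have b1: "bij_betw \<pi> ?J1 ?I1"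
    using inj \<sigma>(1) by (subst bij_betw_cong[of _ _ \<sigma>]) (auto simp: \<pi>_def bij_betw_def)
  have b0: "bij_betw \<pi> ?J0 ?I0"
    using \<upsilon> disj(1) by (subst bij_betw_cong[of _ _ \<upsilon>]) (auto simp: \<pi>_def)
  have bij: "bij_betw \<pi> {..<length Ns} {..<length Ms}"
    using bij_betw_combine[OF b1 b0 disj(2)] un by simp
  then have len: "length Hs' = length Hs" using bij_betw_same_card[OF bij] M(3) N(3) by simp
  have perm: "\<pi> permutes {..<length Hs}"
  proof (rule bij_imp_permutes)
    show "bij_betw \<pi> {..<length Hs} {..<length Hs}" using bij M(3) N(3) len by simp
    show "\<pi> j = j" if "j \<notin> {..<length Hs}" for j
      using that un N(3) len unfolding \<pi>_def by auto
  qed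
  have "commensurable (G\<lparr>carrier := Hs ! \<pi> j\<rparr>) (G\<lparr>carrier := Hs' ! j\<rparr>)" if j: "j < length Hs" for j
  proof -
    have pj: "\<pi> j < length Hs" using permutes_in_image[OF perm, of j] j by simp
    have jl: "j < length Hs'" using j len by simp
    have "virt_iso G (Ms ! \<pi> j) (Ns ! j)"
    proof (cases "j \<in> ?J1")
      case True
      then show ?thesis using \<sigma>(2)[OF inj] by (simp add: \<pi>_def)
    next
      case False
      then have j0: "j \<in> ?J0" using un(1) j len N(3) by auto
      then have "\<pi> j \<in> ?I0" using b0 bij_betwE by blast
      then show ?thesis
        using j0 tM tN int_like_virt_iso unfolding central_part_def tame_def by blast
    qed
    from virt_iso_mono[OF this M(4)[OF pj] N(4)[OF jl]]
    show ?thesis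
      using commensurable_iff_virt_iso[OF direct_decompD(2)[OF H(2) pj] direct_decompD(2)[OF H'(2) jl]] by blast
  qed
  then show ?thesis unfolding equivalent_decompositions_def using perm len by auto
qed

end

section \<open>Signed root systems and odd roots\<close>

lemma not_injE:
  fixes f :: "'x::linorder \<Rightarrow> 'y"
  assumes "\<not> inj f"
  obtains i j where "f i = f j" "i < j"
proof -
  obtain x y where xy: "f x = f y" "x \<noteq> y" using assms unfolding inj_def by blast
  show thesis
  proof (cases "x < y")
    case True
    then show thesis using that[of x y] xy by simp
  next
    case False
    then show thesis using that[of y x] xy by simp
  qed
qed

text \<open>A group acting linearly on a set of real vectors closed under negation, each of them positive or
  negative, such that every element changes the sign of finitely many roots only, and only finitely
  many elements invert a bounded number of positive roots. Linearity is stated as preservation of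
  linear relations between roots.\<close>

locale root_action = group G for G (structure) +
  fixes act :: "'a \<Rightarrow> ('s \<Rightarrow> real) \<Rightarrow> ('s \<Rightarrow> real)"
    and roots :: "('s \<Rightarrow> real) set" and pos :: "('s \<Rightarrow> real) \<Rightarrow> bool" and S :: "'s set"
  assumes finite_S: "finite S"
    and root_support: "\<And>\<alpha> s. \<alpha> \<in> roots \<Longrightarrow> s \<notin> S \<Longrightarrow> \<alpha> s = 0"
    and act_closed: "\<And>w \<alpha>. w \<in> carrier G \<Longrightarrow> \<alpha> \<in> roots \<Longrightarrow> act w \<alpha> \<in> roots"
    and act_mult: "\<And>x y \<alpha>. x \<in> carrier G \<Longrightarrow> y \<in> carrier G \<Longrightarrow> \<alpha> \<in> roots \<Longrightarrow>
        act (x \<otimes> y) \<alpha> = act x (act y \<alpha>)"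
    and act_one: "\<And>\<alpha>. \<alpha> \<in> roots \<Longrightarrow> act \<one> \<alpha> = \<alpha>"
    and act_relation: "\<And>w (\<alpha> :: nat \<Rightarrow> _) c I. w \<in> carrier G \<Longrightarrow> finite I \<Longrightarrow> (\<And>i. i \<in> I \<Longrightarrow> \<alpha> i \<in> roots) \<Longrightarrow>
        (\<And>s. s \<in> S \<Longrightarrow> (\<Sum>i\<in>I. c i * \<alpha> i s) = 0) \<Longrightarrow>
        (\<And>s. s \<in> S \<Longrightarrow> (\<Sum>i\<in>I. c i * act w (\<alpha> i) s) = 0)"
    and root_uminus: "\<And>\<alpha>. \<alpha> \<in> roots \<Longrightarrow> (\<lambda>s. - \<alpha> s) \<in> roots"
    and act_uminus: "\<And>w \<alpha>. w \<in> carrier G \<Longrightarrow> \<alpha> \<in> roots \<Longrightarrow> act w (\<lambda>s. - \<alpha> s) = (\<lambda>s. - act w \<alpha> s)"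
    and pos_uminus: "\<And>\<alpha>. \<alpha> \<in> roots \<Longrightarrow> pos (\<lambda>s. - \<alpha> s) \<longleftrightarrow> \<not> pos \<alpha>"
    and finite_sign_changes: "\<And>w. w \<in> carrier G \<Longrightarrow> finite {\<alpha> \<in> roots. pos \<alpha> \<noteq> pos (act w \<alpha>)}"
    and finite_bounded_inversions:
      "\<And>c. finite {w \<in> carrier G. card {\<alpha> \<in> roots. pos \<alpha> \<and> \<not> pos (act w \<alpha>)} \<le> c}"
begin

abbreviation shift :: "'a \<Rightarrow> int \<Rightarrow> ('s \<Rightarrow> real) \<Rightarrow> ('s \<Rightarrow> real)" where
  "shift a k \<alpha> \<equiv> act (a [^] k) \<alpha>"

text \<open>Positive far along the orbit of \<open>\<alpha>\<close> under the powers of \<open>a\<close>, and negative far in the opposite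
  direction: geometrically, the images of the base chamber under the powers of \<open>a\<close> end up on different
  sides of the wall of \<open>\<alpha>\<close> in the two directions.\<close>

definition odd_root :: "'a \<Rightarrow> ('s \<Rightarrow> real) \<Rightarrow> bool" where
  "odd_root a \<alpha> \<longleftrightarrow> \<alpha> \<in> roots \<and>
     (\<exists>n. (\<forall>k\<ge>n. pos (shift a k \<alpha>)) \<and> (\<forall>k\<le>- n. \<not> pos (shift a k \<alpha>)))"

declare act_one [simp]

lemma shift_closed: "a \<in> carrier G \<Longrightarrow> \<alpha> \<in> roots \<Longrightarrow> shift a k \<alpha> \<in> roots"
  by (simp add: act_closed)

lemma shift_add:
  "a \<in> carrier G \<Longrightarrow> \<alpha> \<in> roots \<Longrightarrow> shift a (k + l) \<alpha> = shift a k (shift a l \<alpha>)"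
  by (simp add: act_mult int_pow_mult)

lemma shift_zero: "\<alpha> \<in> roots \<Longrightarrow> shift a 0 \<alpha> = \<alpha>"
  by (simp add: act_one)

lemma act_inv_act: "w \<in> carrier G \<Longrightarrow> \<alpha> \<in> roots \<Longrightarrow> act (inv w) (act w \<alpha>) = \<alpha>"
  using act_mult[of "inv w" w \<alpha>] by (simp add: act_one)

lemma act_act_inv: "w \<in> carrier G \<Longrightarrow> \<alpha> \<in> roots \<Longrightarrow> act w (act (inv w) \<alpha>) = \<alpha>"
  using act_mult[of w "inv w" \<alpha>] by (simp add: act_one)

text \<open>An injective orbit meets the finite set of roots at which \<open>a\<close> changes the sign only finitely often.\<close>

lemma eventual_signs:
  assumes a: "a \<in> carrier G" and \<alpha>: "\<alpha> \<in> roots" and inj: "inj (\<lambda>k. shift a k \<alpha>)"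
  shows "\<exists>n\<ge>0. (\<forall>k\<ge>n. pos (shift a k \<alpha>) \<longleftrightarrow> pos (shift a n \<alpha>)) \<and>
             (\<forall>k\<le>- n. pos (shift a k \<alpha>) \<longleftrightarrow> pos (shift a (- n) \<alpha>))"
proof -
  let ?E = "{\<beta> \<in> roots. pos \<beta> \<noteq> pos (shift a 1 \<beta>)}"
  define J where "J = (\<lambda>k. shift a k \<alpha>) -` ?E"
  have fin: "finite J"
    unfolding J_def using finite_sign_changes[of "a [^] (1::int)"] a inj by (intro finite_vimageI) auto
  define n where "n = Max (insert 0 (abs ` J)) + 1"
  have n: "\<bar>k\<bar> < n" if "k \<in> J" for k
    using Max_ge[of "insert 0 (abs ` J)" "\<bar>k\<bar>"] fin that unfolding n_def by simp
  have n0: "n \<ge> 0" using Max_ge[of "insert 0 (abs ` J)" 0] fin unfolding n_def by simp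
  have sg: "pos (shift a (k + 1) \<alpha>) \<longleftrightarrow> pos (shift a k \<alpha>)" if "\<bar>k\<bar> \<ge> n" for k
  proof -
    have "k \<notin> J" using n[of k] that by linarith
    then have "shift a k \<alpha> \<notin> ?E" by (simp add: J_def)
    then show ?thesis using shift_add[OF a \<alpha>, of 1 k] shift_closed[OF a \<alpha>] by (auto simp: add.commute)
  qed
  have "pos (shift a k \<alpha>) \<longleftrightarrow> pos (shift a n \<alpha>)" if "k \<ge> n" for k
    using that
  proof (induction k rule: int_ge_induct)
    case (step i)
    then show ?case using sg[of i] n0 by simp
  qed simp
  moreover have "pos (shift a k \<alpha>) \<longleftrightarrow> pos (shift a (- n) \<alpha>)" if "k \<le> - n" for k
    using that
  proof (induction k rule: int_le_induct)
    case (step i)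
    then show ?case using sg[of "i - 1"] n0 by simp
  qed simp
  ultimately show ?thesis using n0 by blast
qed

lemma shift_periodic:
  assumes a: "a \<in> carrier G" and \<alpha>: "\<alpha> \<in> roots" and "shift a i \<alpha> = shift a j \<alpha>" "i < j"
  shows "shift a (j - i) \<alpha> = \<alpha>"
proof -
  have "shift a (- i) (shift a i \<alpha>) = shift a (- i) (shift a j \<alpha>)" using assms by simp
  then show ?thesis using shift_add[OF a \<alpha>, of "- i" i] shift_add[OF a \<alpha>, of "- i" j] \<alpha> by simp
qed

lemma shift_mod:
  assumes a: "a \<in> carrier G" and \<alpha>: "\<alpha> \<in> roots" and p: "shift a p \<alpha> = \<alpha>"
  shows "shift a (k mod p) \<alpha> = shift a k \<alpha>"
proof -
  have n: "shift a (int n * p) \<alpha> = \<alpha>" for n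
  proof (induction n)
    case (Suc n)
    then show ?case using shift_add[OF a \<alpha>, of p "int n * p"] p by (simp add: algebra_simps)
  qed (simp add: \<alpha>)
  have q: "shift a (q * p) \<alpha> = \<alpha>" for q
  proof (cases q rule: int_cases2)
    case (nonpos m)
    have "shift a (q * p) (shift a (int m * p) \<alpha>) = \<alpha>"
      using shift_add[OF a \<alpha>, of "q * p" "int m * p"] nonpos by (simp add: \<alpha>)
    then show ?thesis using n by simp
  qed (use n in simp)
  then show ?thesis
    using shift_add[OF a \<alpha>, of "k mod p" "k div p * p"] q[of "k div p"] by simp
qed

lemma odd_root_inj:
  assumes a: "a \<in> carrier G" and odd: "odd_root a \<alpha>"
  shows "inj (\<lambda>k. shift a k \<alpha>)"
proof -
  obtain n where \<alpha>: "\<alpha> \<in> roots" and n: "\<And>k. k \<ge> n \<Longrightarrow> pos (shift a k \<alpha>)" "\<And>k. k \<le> - n \<Longrightarrow> \<not> pos (shift a k \<alpha>)"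
    using odd unfolding odd_root_def by blast
  have False if ij: "shift a i \<alpha> = shift a j \<alpha>" "i < j" for i j
  proof -
    let ?p = "j - i" and ?N = "\<bar>n\<bar> + 1"
    have p: "shift a ?p \<alpha> = \<alpha>" by (rule shift_periodic[OF a \<alpha> ij])
    have "?p \<ge> 1" using ij by simp
    then have big: "?N * ?p \<ge> ?N" using mult_left_mono[of 1 ?p ?N] by simp
    have "shift a (?N * ?p) \<alpha> = shift a (- (?N * ?p)) \<alpha>"
      using shift_mod[OF a \<alpha> p, of "?N * ?p"] shift_mod[OF a \<alpha> p, of "- (?N * ?p)"]
      by (metis mod_mult_self2_is_0 mult_minus_left)
    moreover have "?N * ?p \<ge> n" "- (?N * ?p) \<le> - n" using big by linarith+
    ultimately show False using n(1)[of "?N * ?p"] n(2)[of "- (?N * ?p)"] by simp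
  qed
  then show ?thesis using not_injE by blast
qed

text \<open>Suppose that there is no odd root. Every sign change along an orbit of \<open>a\<close> happens at one of the
  finitely many roots \<open>e\<close> whose sign is changed by \<open>a\<close>, so a positive root inverted by the \<open>m\<close>-th power
  of \<open>a\<close> lies in the orbit of such an \<open>e\<close>. A finite orbit contains a bounded number of roots. An infinite
  one has the same sign at both ends, since neither \<open>e\<close> nor \<open>- e\<close> is odd, so that one of the two ends
  of an inversion must lie in a bounded stretch of the orbit. Thus the number of inversions of the
  powers of \<open>a\<close> is bounded, and \<open>a\<close> has finite order.\<close>

lemma odd_root_exists:
  assumes a: "a \<in> carrier G" and inf: "\<And>n. 0 < n \<Longrightarrow> a [^] (n::nat) \<noteq> \<one>"
  shows "\<exists>\<alpha>. odd_root a \<alpha>"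
proof (rule ccontr)
  assume no: "\<nexists>\<alpha>. odd_root a \<alpha>"
  let ?E = "{\<beta> \<in> roots. pos \<beta> \<noteq> pos (act a \<beta>)}"
  have finE: "finite ?E" by (rule finite_sign_changes[OF a])
  let ?T = "\<lambda>e (m::nat). {shift a (- k) e | k. pos (shift a (- k) e) \<and> \<not> pos (shift a (int m - k) e)}"
  have "\<exists>c. \<forall>m. finite (?T e m) \<and> card (?T e m) \<le> c" if "e \<in> ?E" for e
  proof -
    have e: "e \<in> roots" using that by blast
    have interval: ?thesis if H: "\<And>m. \<exists>l::int. \<forall>k. pos (shift a (- k) e) \<longrightarrow> \<not> pos (shift a (int m - k) e) \<longrightarrow>
        shift a (- k) e \<in> (\<lambda>j. shift a j e) ` {l..<l + int c}" for c
    proof (intro exI[of _ c] allI)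
      fix m
      obtain l :: int where l: "\<forall>k. pos (shift a (- k) e) \<longrightarrow> \<not> pos (shift a (int m - k) e) \<longrightarrow>
        shift a (- k) e \<in> (\<lambda>j. shift a j e) ` {l..<l + int c}" using H[of m] by blast
      then have sub: "?T e m \<subseteq> (\<lambda>j. shift a j e) ` {l..<l + int c}" by blast
      have "card ((\<lambda>j. shift a j e) ` {l..<l + int c}) \<le> c"
        using card_image_le[of "{l..<l + int c}" "\<lambda>j. shift a j e"] by simp
      then show "finite (?T e m) \<and> card (?T e m) \<le> c"
        using finite_subset[OF sub] card_mono[OF _ sub] by simp
    qed
    show ?thesis
    proof (cases "inj (\<lambda>k. shift a k e)")
      case False
      then obtain i j where "shift a i e = shift a j e" "i < j" by (rule not_injE)
      then have p: "shift a (j - i) e = e" "j - i > 0" using shift_periodic[OF a e] by auto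
      show ?thesis
      proof (rule interval[of "nat (j - i)"], rule exI[of _ 0], intro allI impI)
        fix k
        show "shift a (- k) e \<in> (\<lambda>j. shift a j e) ` {0..<0 + int (nat (j - i))}"
          using shift_mod[OF a e p(1), of "- k"] p(2) by (intro image_eqI[of _ _ "(- k) mod (j - i)"]) auto
      qed
    next
      case True
      obtain n where n: "n \<ge> 0" "\<And>k. k \<ge> n \<Longrightarrow> pos (shift a k e) \<longleftrightarrow> pos (shift a n e)"
        "\<And>k. k \<le> - n \<Longrightarrow> pos (shift a k e) \<longleftrightarrow> pos (shift a (- n) e)"
        using eventual_signs[OF a e True] by blast
      have "\<not> (pos (shift a n e) \<and> \<not> pos (shift a (- n) e))"
        using no n(2,3) e unfolding odd_root_def by blast
      moreover have "\<not> (\<not> pos (shift a n e) \<and> pos (shift a (- n) e))"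
      proof
        assume *: "\<not> pos (shift a n e) \<and> pos (shift a (- n) e)"
        have "pos (shift a k (\<lambda>s. - e s)) \<longleftrightarrow> \<not> pos (shift a k e)" for k
          using act_uminus[OF _ e, of "a [^] k"] pos_uminus[OF shift_closed[OF a e]] a by simp
        then have "odd_root a (\<lambda>s. - e s)"
          using * n(2,3) root_uminus[OF e] unfolding odd_root_def by blast
        then show False using no by blast
      qed
      ultimately consider "pos (shift a n e)" "pos (shift a (- n) e)" | "\<not> pos (shift a n e)" "\<not> pos (shift a (- n) e)"
        by blast
      then show ?thesis
      proof cases
        case 1
        show ?thesis
        proof (rule interval[of "nat (2 * n + 1)"])
          fix m :: nat
          show "\<exists>l. \<forall>k. pos (shift a (- k) e) \<longrightarrow> \<not> pos (shift a (int m - k) e) \<longrightarrow>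
            shift a (- k) e \<in> (\<lambda>j. shift a j e) ` {l..<l + int (nat (2 * n + 1))}"
          proof (rule exI[of _ "- int m - n"], intro allI impI)
            fix k assume "\<not> pos (shift a (int m - k) e)"
            then have "\<not> int m - k \<ge> n" "\<not> int m - k \<le> - n" using 1 n(2,3) by blast+
            then show "shift a (- k) e \<in> (\<lambda>j. shift a j e) ` {- int m - n..<- int m - n + int (nat (2 * n + 1))}"
              using n(1) by (intro image_eqI[of _ _ "- k"]) auto
          qed
        qed
      next
        case 2
        show ?thesis
        proof (rule interval[of "nat (2 * n + 1)"])
          fix m :: nat
          show "\<exists>l. \<forall>k. pos (shift a (- k) e) \<longrightarrow> \<not> pos (shift a (int m - k) e) \<longrightarrow>
            shift a (- k) e \<in> (\<lambda>j. shift a j e) ` {l..<l + int (nat (2 * n + 1))}"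
          proof (rule exI[of _ "- n"], intro allI impI)
            fix k assume "pos (shift a (- k) e)"
            then have "\<not> - k \<ge> n" "\<not> - k \<le> - n" using 2 n(2,3) by blast+
            then show "shift a (- k) e \<in> (\<lambda>j. shift a j e) ` {- n..<- n + int (nat (2 * n + 1))}"
              using n(1) by (intro image_eqI[of _ _ "- k"]) auto
          qed
        qed
      qed
    qed
  qed
  then have "\<forall>e\<in>?E. \<exists>c. \<forall>m. finite (?T e m) \<and> card (?T e m) \<le> c" by blast
  from bchoice[OF this] obtain c where c: "\<And>e m. e \<in> ?E \<Longrightarrow> finite (?T e m) \<and> card (?T e m) \<le> c e" by blast
  let ?N = "\<lambda>w. {\<alpha> \<in> roots. pos \<alpha> \<and> \<not> pos (act w \<alpha>)}"
  have "card (?N (a [^] m)) \<le> sum c ?E" for m :: nat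
  proof -
    have "?N (a [^] m) \<subseteq> (\<Union>e\<in>?E. ?T e m)"
    proof
      fix \<alpha> assume "\<alpha> \<in> ?N (a [^] m)"
      then have \<alpha>: "\<alpha> \<in> roots" "pos \<alpha>" "\<not> pos (shift a (int m) \<alpha>)" by (auto simp: int_pow_int)
      have "\<exists>k. pos (shift a (int k) \<alpha>) \<and> \<not> pos (shift a (int (Suc k)) \<alpha>)"
      proof (rule ccontr)
        assume n: "\<nexists>k. pos (shift a (int k) \<alpha>) \<and> \<not> pos (shift a (int (Suc k)) \<alpha>)"
        have "pos (shift a (int k) \<alpha>)" for k
          by (induction k) (use n \<alpha>(1,2) shift_zero in auto)
        then show False using \<alpha>(3) by blast
      qed
      then obtain k where k: "pos (shift a (int k) \<alpha>)" "\<not> pos (shift a (int (Suc k)) \<alpha>)" by blast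
      let ?e = "shift a (int k) \<alpha>"
      have e: "?e \<in> ?E"
        using k shift_closed[OF a \<alpha>(1)] shift_add[OF a \<alpha>(1), of 1 "int k"] a by simp
      have "\<alpha> = shift a (- int k) ?e"
        using shift_add[OF a \<alpha>(1), of "- int k" "int k"] \<alpha>(1) by simp
      moreover have "shift a (int m - int k) ?e = shift a (int m) \<alpha>"
        using shift_add[OF a \<alpha>(1), of "int m - int k" "int k"] by simp
      ultimately have "\<alpha> \<in> ?T ?e m" using \<alpha> by (intro CollectI exI[of _ "int k"]) auto
      then show "\<alpha> \<in> (\<Union>e\<in>?E. ?T e m)" using e by blast
    qed
    moreover have "finite (\<Union>e\<in>?E. ?T e m)" using c finE by blast
    ultimately have "card (?N (a [^] m)) \<le> card (\<Union>e\<in>?E. ?T e m)" using card_mono by blast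
    also have "\<dots> \<le> (\<Sum>e\<in>?E. card (?T e m))" by (rule card_UN_le[OF finE])
    also have "\<dots> \<le> sum c ?E" by (rule sum_mono) (use c in blast)
    finally show ?thesis .
  qed
  then have "range (\<lambda>m::nat. a [^] m) \<subseteq> {w \<in> carrier G. card (?N w) \<le> sum c ?E}" using a by auto
  then have "finite (range (\<lambda>m::nat. a [^] m))" using finite_bounded_inversions finite_subset by blast
  then have "\<not> inj (\<lambda>m::nat. a [^] m)" using finite_imageD infinite_UNIV_nat by blast
  then obtain i j :: nat where ij: "a [^] i = a [^] j" "i < j" by (rule not_injE)
  then have "a [^] (j - i) = \<one>" using pow_eq_div2[OF a] by metis
  then show False using inf[of "j - i"] ij by simp
qed

section \<open>Crossing numbers as homomorphisms to the integers\<close>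

text \<open>The contribution of the wall of \<open>\<delta>\<close> to the passage from the base chamber to its image under \<open>w\<close>.\<close>

definition crossing :: "'a \<Rightarrow> ('s \<Rightarrow> real) \<Rightarrow> int" where
  "crossing w \<delta> = of_bool (pos \<delta>) - of_bool (pos (act (inv w) \<delta>))"

definition net_crossing :: "('s \<Rightarrow> real) set \<Rightarrow> 'a \<Rightarrow> int" where
  "net_crossing Y w = (\<Sum>\<delta> \<in> {\<delta> \<in> Y. crossing w \<delta> \<noteq> 0}. crossing w \<delta>)"

lemma finite_crossing:
  assumes "w \<in> carrier G" "Y \<subseteq> roots"
  shows "finite {\<delta> \<in> Y. crossing w \<delta> \<noteq> 0}"
proof (rule finite_subset)
  show "{\<delta> \<in> Y. crossing w \<delta> \<noteq> 0} \<subseteq> {\<alpha> \<in> roots. pos \<alpha> \<noteq> pos (act (inv w) \<alpha>)}"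
    using assms(2) by (auto simp: crossing_def)
qed (use finite_sign_changes[of "inv w"] assms(1) in simp)

lemma net_crossing_eq:
  assumes "finite T" "T \<subseteq> Y" "\<And>\<delta>. \<delta> \<in> Y \<Longrightarrow> crossing w \<delta> \<noteq> 0 \<Longrightarrow> \<delta> \<in> T"
  shows "net_crossing Y w = (\<Sum>\<delta>\<in>T. crossing w \<delta>)"
  unfolding net_crossing_def by (rule sum.mono_neutral_left) (use assms in auto)

text \<open>The passage to the image under \<open>g h\<close> is the passage to the image under \<open>g\<close> followed by the \<open>g\<close>-translate
  of the passage belonging to \<open>h\<close>; as \<open>Y\<close> is invariant under \<open>g\<close>, translating does not change the count.\<close>

lemma net_crossing_mult:
  assumes B: "subgroup B G" and Y: "Y \<subseteq> roots" and inv: "\<And>b \<delta>. b \<in> B \<Longrightarrow> \<delta> \<in> Y \<Longrightarrow> act b \<delta> \<in> Y"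
    and g: "g \<in> B" and h: "h \<in> B"
  shows "net_crossing Y (g \<otimes> h) = net_crossing Y g + net_crossing Y h"
proof -
  have c: "g \<in> carrier G" "h \<in> carrier G" "g \<otimes> h \<in> carrier G"
    using subgroup.mem_carrier[OF B] g h by auto
  have ginv: "inv g \<in> B" by (rule subgroup.m_inv_closed[OF B g])
  let ?D = "\<lambda>w. {\<delta> \<in> Y. crossing w \<delta> \<noteq> 0}"
  define T where "T = ?D g \<union> ?D (g \<otimes> h) \<union> act g ` ?D h"
  have T: "finite T" "T \<subseteq> Y"
    using finite_crossing[OF _ Y] c inv[OF g] unfolding T_def by auto
  have split: "crossing (g \<otimes> h) \<delta> = crossing g \<delta> + crossing h (act (inv g) \<delta>)" if "\<delta> \<in> Y" for \<delta>
    using act_mult[of "inv h" "inv g" \<delta>] c that Y by (simp add: crossing_def inv_mult_group subset_iff)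
  have "net_crossing Y (g \<otimes> h) = (\<Sum>\<delta>\<in>T. crossing (g \<otimes> h) \<delta>)"
    by (rule net_crossing_eq[OF T]) (auto simp: T_def)
  also have "\<dots> = (\<Sum>\<delta>\<in>T. crossing g \<delta>) + (\<Sum>\<delta>\<in>T. crossing h (act (inv g) \<delta>))"
    unfolding sum.distrib[symmetric] by (rule sum.cong) (use split T(2) in auto)
  also have "(\<Sum>\<delta>\<in>T. crossing g \<delta>) = net_crossing Y g"
    by (rule net_crossing_eq[OF T, symmetric]) (auto simp: T_def)
  also have "(\<Sum>\<delta>\<in>T. crossing h (act (inv g) \<delta>)) = (\<Sum>\<delta>\<in>act (inv g) ` T. crossing h \<delta>)"
  proof (rule sum.reindex_cong[symmetric, OF _ refl refl])
    show "inj_on (act (inv g)) T"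
    proof (rule inj_onI)
      fix x y assume "x \<in> T" "y \<in> T" and eq: "act (inv g) x = act (inv g) y"
      then have "x \<in> roots" "y \<in> roots" using T(2) Y by auto
      then show "x = y" using act_act_inv[OF c(1)] eq by metis
    qed
  qed
  also have "\<dots> = net_crossing Y h"
  proof (rule net_crossing_eq[symmetric])
    show "finite (act (inv g) ` T)" using T(1) by simp
    show "act (inv g) ` T \<subseteq> Y" using inv[OF ginv] T(2) by blast
    fix \<delta> assume \<delta>: "\<delta> \<in> Y" "crossing h \<delta> \<noteq> 0"
    then have "act g \<delta> \<in> T" by (auto simp: T_def)
    moreover have "act (inv g) (act g \<delta>) = \<delta>" using act_inv_act[OF c(1)] \<delta>(1) Y by blast
    ultimately show "\<delta> \<in> act (inv g) ` T" by (metis image_eqI)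
  qed
  finally show ?thesis .
qed

lemma odd_orbit_crossing:
  assumes a: "a \<in> carrier G" and odd: "odd_root a \<delta>"
  shows "\<exists>k. crossing a (shift a k \<delta>) \<noteq> 0"
proof -
  obtain n where \<delta>: "\<delta> \<in> roots" and n: "\<And>k. k \<ge> n \<Longrightarrow> pos (shift a k \<delta>)" "\<And>k. k \<le> - n \<Longrightarrow> \<not> pos (shift a k \<delta>)"
    using odd unfolding odd_root_def by blast
  have ainv: "act (inv a) (shift a k \<delta>) = shift a (k - 1) \<delta>" for k
  proof -
    have "act (inv a) (shift a k \<delta>) = shift a (- 1) (shift a k \<delta>)" using a by (simp add: int_pow_neg)
    also have "\<dots> = shift a (k - 1) \<delta>" using shift_add[OF a \<delta>, of "- 1" k] by simp
    finally show ?thesis .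
  qed
  show ?thesis
  proof (rule ccontr)
    assume "\<nexists>k. crossing a (shift a k \<delta>) \<noteq> 0"
    then have same: "pos (shift a k \<delta>) \<longleftrightarrow> pos (shift a (k - 1) \<delta>)" for k
      unfolding crossing_def ainv by (metis diff_numeral_special(9) eq_iff_diff_eq_0 of_bool_eq_iff)
    have "pos (shift a k \<delta>)" if "k \<le> n" for k
      using that
    proof (induction k rule: int_le_induct)
      case base
      show ?case using n(1) by simp
    next
      case (step i)
      then show ?case using same[of i] by simp
    qed
    then show False using n(2)[of "min n (- n)"] by auto
  qed
qed

text \<open>Every orbit of \<open>a\<close> in \<open>Y\<close> runs from negative to positive roots. All of them pass through the finite
  set of roots crossed by \<open>a\<close>, so for a sufficiently large power of \<open>a\<close> all crossings have the same sign
  and at least one occurs. The homomorphism property brings this back to \<open>a\<close> itself.\<close>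

lemma net_crossing_nonzero:
  assumes B: "subgroup B G" and a: "a \<in> B" and odd: "\<And>\<delta>. \<delta> \<in> Y \<Longrightarrow> odd_root a \<delta>" and ne: "Y \<noteq> {}"
    and inv: "\<And>b \<delta>. b \<in> B \<Longrightarrow> \<delta> \<in> Y \<Longrightarrow> act b \<delta> \<in> Y"
  shows "net_crossing Y a \<noteq> 0"
proof -
  have ac: "a \<in> carrier G" by (rule subgroup.mem_carrier[OF B a])
  have Y: "Y \<subseteq> roots" using odd unfolding odd_root_def by blast
  let ?E = "{\<delta> \<in> Y. crossing a \<delta> \<noteq> 0}"
  have fin: "finite ?E" by (rule finite_crossing[OF ac Y])
  have "\<forall>e\<in>?E. \<exists>n. (\<forall>k\<ge>n. pos (shift a k e)) \<and> (\<forall>k\<le>- n. \<not> pos (shift a k e))"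
    using odd unfolding odd_root_def by blast
  from bchoice[OF this] obtain n where
    n: "\<And>e k. e \<in> ?E \<Longrightarrow> k \<ge> n e \<Longrightarrow> pos (shift a k e)" "\<And>e k. e \<in> ?E \<Longrightarrow> k \<le> - n e \<Longrightarrow> \<not> pos (shift a k e)"
    by blast
  define N where "N = Max (insert 0 (n ` ?E))"
  have N: "n e \<le> N" if "e \<in> ?E" for e unfolding N_def using fin that by (intro Max_ge) auto
  have N0: "N \<ge> 0" unfolding N_def using fin by (intro Max_ge) auto
  have p: "pos (shift a k e)" if "e \<in> ?E" "k \<ge> N" for e k using n(1)[OF that(1)] N[OF that(1)] that(2) by simp
  have m: "\<not> pos (shift a k e)" if "e \<in> ?E" "k \<le> - N" for e k using n(2)[OF that(1)] N[OF that(1)] that(2) by simp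
  \<comment> \<open>a shift by more than \<open>2 N\<close> takes every position below \<open>N\<close> to one at most \<open>- N\<close>\<close>
  define m where "m = nat (2 * N + 1)"
  have ainv: "act (inv (a [^] m)) (shift a k \<delta>) = shift a (k - int m) \<delta>" if "\<delta> \<in> roots" for k \<delta>
  proof -
    have "act (inv (a [^] m)) (shift a k \<delta>) = shift a (- int m) (shift a k \<delta>)" using ac by (simp add: int_pow_neg_int)
    also have "\<dots> = shift a (k - int m) \<delta>" using shift_add[OF ac that, of "- int m" k] by simp
    finally show ?thesis .
  qed
  have rep: "\<exists>e\<in>?E. \<exists>k. \<delta> = shift a k e" if \<delta>: "\<delta> \<in> Y" for \<delta>
  proof -
    obtain k where k: "crossing a (shift a k \<delta>) \<noteq> 0" using odd_orbit_crossing[OF ac odd[OF \<delta>]] by blast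
    have "a [^] k \<in> B" by (rule subgroup_int_pow_closed[OF B a])
    then have "shift a k \<delta> \<in> ?E" using k inv \<delta> by blast
    moreover have "\<delta> = shift a (- k) (shift a k \<delta>)"
      using shift_add[OF ac, of \<delta> "- k" k] \<delta> Y by (simp add: subset_iff)
    ultimately show ?thesis by blast
  qed
  have nonneg: "crossing (a [^] m) \<delta> \<ge> 0" if \<delta>: "\<delta> \<in> Y" for \<delta>
  proof -
    obtain e k where e: "e \<in> ?E" "\<delta> = shift a k e" using rep[OF \<delta>] by blast
    have er: "e \<in> roots" using e(1) Y by blast
    have "\<not> pos (act (inv (a [^] m)) \<delta>)" if np: "\<not> pos \<delta>"
    proof -
      have "k < N" using p[OF e(1), of k] np e(2) by (meson not_le)
      then have "k - int m \<le> - N" using N0 by (simp add: m_def)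
      then show ?thesis unfolding e(2) ainv[OF er] by (rule m[OF e(1)])
    qed
    then show ?thesis by (auto simp: crossing_def)
  qed
  obtain e where e: "e \<in> ?E" using ne rep by blast
  have er: "e \<in> roots" using e Y by blast
  have eX: "shift a N e \<in> Y" using inv[OF subgroup_int_pow_closed[OF B a]] e by blast
  have one: "crossing (a [^] m) (shift a N e) = 1"
    using p[OF e order_refl] m[OF e, of "N - int m"] N0 unfolding crossing_def ainv[OF er] by (simp add: m_def)
  have mc: "a [^] m \<in> carrier G" using ac by simp
  have "net_crossing Y (a [^] m) \<ge> 1"
  proof -
    let ?D = "{\<delta> \<in> Y. crossing (a [^] m) \<delta> \<noteq> 0}"
    have "shift a N e \<in> ?D" using eX one by simp
    from member_le_sum[OF this _ finite_crossing[OF mc Y], of "crossing (a [^] m)"] one nonneg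
    show ?thesis unfolding net_crossing_def by auto
  qed
  moreover have "net_crossing Y (a [^] m) = int m * net_crossing Y a"
    by (rule hom_int_nat_pow[OF B net_crossing_mult[OF B Y inv] a])
  ultimately show ?thesis by auto
qed

text \<open>The element \<open>b\<close> changes the sign of finitely many roots only, so it does not affect the signs far out
  in the orbit of \<open>\<alpha>\<close>.\<close>

lemma odd_root_commute:
  assumes a: "a \<in> carrier G" and b: "b \<in> carrier G" "a \<otimes> b = b \<otimes> a" and odd: "odd_root a \<alpha>"
  shows "odd_root a (act b \<alpha>)"
proof -
  obtain n where \<alpha>: "\<alpha> \<in> roots" and n: "\<And>k. k \<ge> n \<Longrightarrow> pos (shift a k \<alpha>)" "\<And>k. k \<le> - n \<Longrightarrow> \<not> pos (shift a k \<alpha>)"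
    using odd unfolding odd_root_def by blast
  have sh: "shift a k (act b \<alpha>) = act b (shift a k \<alpha>)" for k
    using act_mult[of "a [^] k" b \<alpha>] act_mult[of b "a [^] k" \<alpha>] int_pow_commute[OF a b, of k] a b \<alpha> by simp
  define J where "J = (\<lambda>k. shift a k \<alpha>) -` {\<beta> \<in> roots. pos \<beta> \<noteq> pos (act b \<beta>)}"
  have fin: "finite J"
    unfolding J_def by (rule finite_vimageI[OF finite_sign_changes[OF b(1)] odd_root_inj[OF a odd]])
  define N where "N = max n (Max (insert 0 (abs ` J)) + 1)"
  have "k \<notin> J" if "\<bar>k\<bar> \<ge> N" for k
  proof
    assume "k \<in> J"
    then have "\<bar>k\<bar> \<le> Max (insert 0 (abs ` J))" using fin by (intro Max_ge) auto
    then show False using that unfolding N_def by linarith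
  qed
  then have same: "pos (shift a k (act b \<alpha>)) \<longleftrightarrow> pos (shift a k \<alpha>)" if "\<bar>k\<bar> \<ge> N" for k
    using that shift_closed[OF a \<alpha>] unfolding sh J_def by auto
  have "N \<ge> n" by (simp add: N_def)
  have "pos (shift a k (act b \<alpha>))" if k: "k \<ge> N" for k
  proof -
    have "\<bar>k\<bar> \<ge> N" "k \<ge> n" using k \<open>N \<ge> n\<close> by linarith+
    then show ?thesis using same n(1) by blast
  qed
  moreover have "\<not> pos (shift a k (act b \<alpha>))" if k: "k \<le> - N" for k
  proof -
    have "\<bar>k\<bar> \<ge> N" "k \<le> - n" using k \<open>N \<ge> n\<close> by linarith+
    then show ?thesis using same n(2) by blast
  qed
  ultimately show ?thesis using act_closed[OF b(1) \<alpha>] unfolding odd_root_def by blast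
qed

lemma orbit_transfer:
  assumes B: "subgroup B G" and a: "a \<in> B" and central: "\<And>x. x \<in> B \<Longrightarrow> a \<otimes> x = x \<otimes> a"
    and odd: "odd_root a \<alpha>"
  defines "Y \<equiv> (\<lambda>b. act b \<alpha>) ` B"
  shows "Y \<subseteq> roots" "\<And>b \<delta>. b \<in> B \<Longrightarrow> \<delta> \<in> Y \<Longrightarrow> act b \<delta> \<in> Y"
    "\<And>x y. x \<in> B \<Longrightarrow> y \<in> B \<Longrightarrow> net_crossing Y (x \<otimes> y) = net_crossing Y x + net_crossing Y y"
    "net_crossing Y a \<noteq> 0"
proof -
  have ac: "a \<in> carrier G" by (rule subgroup.mem_carrier[OF B a])
  have \<alpha>: "\<alpha> \<in> roots" using odd unfolding odd_root_def by blast
  show Y: "Y \<subseteq> roots" using act_closed[OF _ \<alpha>] subgroup.mem_carrier[OF B] unfolding Y_def by blast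
  show inv: "act b \<delta> \<in> Y" if bB: "b \<in> B" and dY: "\<delta> \<in> Y" for b \<delta>
  proof -
    obtain b' where b': "b' \<in> B" "\<delta> = act b' \<alpha>" using dY unfolding Y_def by blast
    then have "act b \<delta> = act (b \<otimes> b') \<alpha>" using act_mult[OF _ _ \<alpha>] subgroup.mem_carrier[OF B] bB by simp
    then show ?thesis using subgroup.m_closed[OF B bB b'(1)] unfolding Y_def by blast
  qed
  show "net_crossing Y (x \<otimes> y) = net_crossing Y x + net_crossing Y y" if "x \<in> B" "y \<in> B" for x y
    by (rule net_crossing_mult[OF B Y inv that])
  show "net_crossing Y a \<noteq> 0"
  proof (rule net_crossing_nonzero[OF B a _ _ inv])
    show "odd_root a \<delta>" if "\<delta> \<in> Y" for \<delta>
      using that odd_root_commute[OF ac _ _ odd] central subgroup.mem_carrier[OF B] unfolding Y_def by auto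
    show "Y \<noteq> {}" using a unfolding Y_def by blast
  qed
qed

theorem central_element_detected:
  assumes "subgroup B G" "a \<in> B" "\<And>x. x \<in> B \<Longrightarrow> a \<otimes> x = x \<otimes> a" "\<And>n. 0 < n \<Longrightarrow> a [^] (n::nat) \<noteq> \<one>"
  shows "\<exists>\<tau> :: 'a \<Rightarrow> int. (\<forall>x\<in>B. \<forall>y\<in>B. \<tau> (x \<otimes> y) = \<tau> x + \<tau> y) \<and> \<tau> a \<noteq> 0"
proof -
  obtain \<alpha> where "odd_root a \<alpha>" using odd_root_exists[OF subgroup.mem_carrier[OF assms(1,2)] assms(4)] by blast
  from orbit_transfer(3,4)[OF assms(1,2,3) this] show ?thesis by blast
qed

text \<open>The kernel of the crossing homomorphism of an orbit virtually fixes the root: the powers of \<open>c\<close> move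
  \<open>\<alpha>\<close> through finitely many orbits of \<open>a\<close>, so some \<open>a\<^sup>l c\<^sup>d\<close> with \<open>d > 0\<close> fixes \<open>\<alpha>\<close>, and hence, \<open>B\<close> being
  abelian, the whole orbit. Its crossing number \<open>l \<tau> a + d \<tau> c\<close> is therefore \<open>0\<close>, and \<open>\<tau> c = 0\<close> forces
  \<open>l = 0\<close>.\<close>

lemma abelian_transfer:
  assumes B: "subgroup B G" and ab: "\<And>x y. x \<in> B \<Longrightarrow> y \<in> B \<Longrightarrow> x \<otimes> y = y \<otimes> x"
    and a: "a \<in> B" "\<And>n. 0 < n \<Longrightarrow> a [^] (n::nat) \<noteq> \<one>"
  shows "\<exists>\<alpha> \<tau>. \<alpha> \<in> roots \<and> (\<forall>x\<in>B. \<forall>y\<in>B. \<tau> (x \<otimes> y) = \<tau> x + (\<tau> y :: int)) \<and>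
      (\<forall>c\<in>B. \<tau> c = 0 \<longrightarrow> (\<exists>k>0. act (c [^] (k::nat)) \<alpha> = \<alpha>)) \<and>
      (\<forall>k>0. act (a [^] (k::nat)) \<alpha> \<noteq> \<alpha>)"
proof -
  have ac: "a \<in> carrier G" by (rule subgroup.mem_carrier[OF B a(1)])
  obtain \<alpha> where odd: "odd_root a \<alpha>" using odd_root_exists[OF ac a(2)] by blast
  then have \<alpha>: "\<alpha> \<in> roots" unfolding odd_root_def by blast
  define Y where "Y = (\<lambda>b. act b \<alpha>) ` B"
  have central: "a \<otimes> x = x \<otimes> a" if "x \<in> B" for x using ab[OF a(1) that] .
  have T: "Y \<subseteq> roots" "\<And>b \<delta>. b \<in> B \<Longrightarrow> \<delta> \<in> Y \<Longrightarrow> act b \<delta> \<in> Y"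
    "\<And>x y. x \<in> B \<Longrightarrow> y \<in> B \<Longrightarrow> net_crossing Y (x \<otimes> y) = net_crossing Y x + net_crossing Y y"
    "net_crossing Y a \<noteq> 0"
    unfolding Y_def by (rule orbit_transfer[OF B a(1) central odd]; assumption)+
  let ?\<tau> = "net_crossing Y"
  have oddX: "odd_root a \<delta>" if "\<delta> \<in> Y" for \<delta>
    using that odd_root_commute[OF ac _ _ odd] ab[OF a(1)] subgroup.mem_carrier[OF B] unfolding Y_def by auto
  \<comment> \<open>elements of \<open>B\<close> fixing \<open>\<alpha>\<close> fix its whole orbit\<close>
  have fix0: "?\<tau> g = 0" if g: "g \<in> B" "act g \<alpha> = \<alpha>" for g
  proof -
    have gc: "g \<in> carrier G" by (rule subgroup.mem_carrier[OF B g(1)])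
    have "act (inv g) \<delta> = \<delta>" if \<delta>: "\<delta> \<in> Y" for \<delta>
    proof -
      obtain b where b: "b \<in> B" "\<delta> = act b \<alpha>" using \<delta> unfolding Y_def by blast
      have bc: "b \<in> carrier G" by (rule subgroup.mem_carrier[OF B b(1)])
      have "act g \<delta> = act b (act g \<alpha>)"
        unfolding b(2) using act_mult[OF gc bc \<alpha>] act_mult[OF bc gc \<alpha>] ab[OF g(1) b(1)] by simp
      then have "act g \<delta> = \<delta>" using g(2) b(2) by simp
      then show ?thesis using act_inv_act[OF gc, of \<delta>] \<delta> T(1) by auto
    qed
    then have "{\<delta> \<in> Y. crossing g \<delta> \<noteq> 0} = {}" by (auto simp: crossing_def)
    then show ?thesis unfolding net_crossing_def by simp
  qed
  have ker: "\<exists>k>0. act (c [^] (k::nat)) \<alpha> = \<alpha>" if c: "c \<in> B" "?\<tau> c = 0" for c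
  proof -
    have cc: "c \<in> carrier G" by (rule subgroup.mem_carrier[OF B c(1)])
    let ?E = "{\<delta> \<in> Y. crossing a \<delta> \<noteq> 0}"
    have fin: "finite ?E" by (rule finite_crossing[OF ac T(1)])
    have cX: "act (c [^] (j::nat)) \<alpha> \<in> Y" for j
      using subgroup_int_pow_closed[OF B c(1), of "int j"] unfolding Y_def by (simp add: int_pow_int)
    have "\<forall>j::nat. \<exists>k. shift a k (act (c [^] j) \<alpha>) \<in> ?E"
    proof
      fix j :: nat
      obtain k where "crossing a (shift a k (act (c [^] j) \<alpha>)) \<noteq> 0"
        using odd_orbit_crossing[OF ac oddX[OF cX]] by blast
      moreover have "shift a k (act (c [^] j) \<alpha>) \<in> Y" using T(2)[OF subgroup_int_pow_closed[OF B a(1)] cX] .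
      ultimately show "\<exists>k. shift a k (act (c [^] j) \<alpha>) \<in> ?E" by blast
    qed
    from choice[OF this] obtain k where k: "\<And>j::nat. shift a (k j) (act (c [^] j) \<alpha>) \<in> ?E" by blast
    have "finite (range (\<lambda>j::nat. shift a (k j) (act (c [^] j) \<alpha>)))"
      by (rule finite_subset[OF _ fin]) (use k in blast)
    then have "\<not> inj (\<lambda>j::nat. shift a (k j) (act (c [^] j) \<alpha>))" using finite_imageD infinite_UNIV_nat by blast
    then obtain i j where ij: "shift a (k i) (act (c [^] i) \<alpha>) = shift a (k j) (act (c [^] j) \<alpha>)" "i < j"
      by (rule not_injE)
    define l where "l = k j - k i"
    define d where "d = j - i"
    let ?g = "a [^] l \<otimes> c [^] d"
    have alB: "a [^] l \<in> B" by (rule subgroup_int_pow_closed[OF B a(1)])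
    have cdB: "c [^] d \<in> B" using subgroup_int_pow_closed[OF B c(1), of "int d"] by (simp add: int_pow_int)
    have ciB: "c [^] i \<in> B" using subgroup_int_pow_closed[OF B c(1), of "int i"] by (simp add: int_pow_int)
    have gB: "?g \<in> B" by (rule subgroup.m_closed[OF B alB cdB])
    note carr = subgroup.mem_carrier[OF B]
    have ri: "act (c [^] i) \<alpha> \<in> roots" "act (c [^] j) \<alpha> \<in> roots" using act_closed[OF _ \<alpha>] cc by auto
    have "shift a (- k i) (shift a (k i) (act (c [^] i) \<alpha>)) = shift a (- k i) (shift a (k j) (act (c [^] j) \<alpha>))"
      using ij(1) by simp
    then have "act (c [^] i) \<alpha> = shift a l (act (c [^] j) \<alpha>)"
      using shift_add[OF ac ri(1), of "- k i" "k i"] shift_add[OF ac ri(2), of "- k i" "k j"] ri by (simp add: l_def)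
    also have "c [^] j = c [^] d \<otimes> c [^] i" using ij(2) cc by (simp add: d_def nat_pow_mult)
    also have "shift a l (act (c [^] d \<otimes> c [^] i) \<alpha>) = act (?g \<otimes> c [^] i) \<alpha>"
      using act_mult[OF carr[OF alB] carr[OF subgroup.m_closed[OF B cdB ciB]] \<alpha>] carr[OF alB] carr[OF cdB] carr[OF ciB]
      by (simp add: m_assoc)
    also have "\<dots> = act (c [^] i) (act ?g \<alpha>)"
      using ab[OF gB ciB] act_mult[OF carr[OF ciB] carr[OF gB] \<alpha>] by simp
    finally have "act (c [^] i) (act ?g \<alpha>) = act (c [^] i) \<alpha>" by simp
    then have gfix: "act ?g \<alpha> = \<alpha>"
      using act_inv_act[OF carr[OF ciB] \<alpha>] act_inv_act[OF carr[OF ciB] act_closed[OF carr[OF gB] \<alpha>]] by simp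
    have "?\<tau> ?g = l * ?\<tau> a + int d * ?\<tau> c"
      using T(3)[OF alB cdB] hom_int_int_pow[OF B T(3) a(1), of l] hom_int_nat_pow[OF B T(3) c(1), of d] by simp
    then have "l = 0" using fix0[OF gB gfix] c(2) T(4) by simp
    then have "act (c [^] d) \<alpha> = \<alpha>" using gfix carr[OF cdB] by simp
    moreover have "d > 0" using ij(2) by (simp add: d_def)
    ultimately show ?thesis by blast
  qed
  have "act (a [^] k) \<alpha> \<noteq> \<alpha>" if "k > 0" for k :: nat
  proof
    assume "act (a [^] k) \<alpha> = \<alpha>"
    then have "shift a (int k) \<alpha> = shift a 0 \<alpha>" using \<alpha> by (simp add: int_pow_int)
    then have "int k = 0" using odd_root_inj[OF ac odd] by (metis injD)
    then show False using that by simp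
  qed
  then show ?thesis using \<alpha> T(3) ker by blast
qed

section \<open>Commuting independent elements and linear independence of roots\<close>

text \<open>One row of a triangular system: the root \<open>\<alpha>\<close> is moved by all powers of \<open>a\<close> and virtually fixed by the
  kernel of \<open>\<tau>\<close>.\<close>

definition separating_triple :: "'a set \<Rightarrow> 'a \<Rightarrow> ('s \<Rightarrow> real) \<Rightarrow> ('a \<Rightarrow> int) \<Rightarrow> bool" where
  "separating_triple B a \<alpha> \<tau> \<longleftrightarrow> a \<in> B \<and> \<alpha> \<in> roots \<and> (\<forall>x\<in>B. \<forall>y\<in>B. \<tau> (x \<otimes> y) = \<tau> x + \<tau> y) \<and>
     (\<forall>c\<in>B. \<tau> c = 0 \<longrightarrow> (\<exists>k>0. act (c [^] (k::nat)) \<alpha> = \<alpha>)) \<and>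
     (\<forall>k>0. act (a [^] (k::nat)) \<alpha> \<noteq> \<alpha>)"

lemma act_pow_fixed:
  assumes c: "c \<in> carrier G" and \<alpha>: "\<alpha> \<in> roots" and fixed: "act (c [^] (k::nat)) \<alpha> = \<alpha>"
  shows "act (c [^] (k * l)) \<alpha> = \<alpha>"
proof (induction l)
  case (Suc l)
  have "c [^] (k * Suc l) = c [^] k \<otimes> c [^] (k * l)" using c by (simp add: nat_pow_mult)
  then show ?case using act_mult[of "c [^] k" "c [^] (k * l)" \<alpha>] c \<alpha> fixed Suc by simp
qed (use \<alpha> in simp)

text \<open>The roots are linearly independent. In a relation let \<open>K\<close> be the last index that occurs; a power of
  \<open>a K\<close> fixes all the earlier roots but not the last one, so applying it and subtracting contradicts
  the relation.\<close>

lemma triangular_bound: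
  assumes B: "subgroup B G"
    and triple: "\<And>j. j < m \<Longrightarrow> separating_triple B (a j) (\<alpha> j) (\<tau> j)"
    and tri: "\<And>i j. i < j \<Longrightarrow> j < m \<Longrightarrow> \<tau> i (a j) = 0"
  shows "m \<le> card S"
proof (rule ccontr)
  assume "\<not> m \<le> card S"
  then obtain c :: "nat \<Rightarrow> real" where c: "\<exists>i\<in>{..<m}. c i \<noteq> 0" "\<forall>s\<in>S. (\<Sum>i<m. c i * \<alpha> i s) = 0"
    using dependent_family[of S "{..<m}" \<alpha>] finite_S by auto
  define K where "K = Max {i. i < m \<and> c i \<noteq> 0}"
  have "K \<in> {i. i < m \<and> c i \<noteq> 0}" unfolding K_def using c(1) by (intro Max_in) auto
  then have K: "K < m" "c K \<noteq> 0" by auto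
  have above: "c i = 0" if "K < i" "i < m" for i
    using Max_ge[of "{i. i < m \<and> c i \<noteq> 0}" i] that unfolding K_def by fastforce
  have aB: "a K \<in> B" and roots: "\<And>i. i < m \<Longrightarrow> \<alpha> i \<in> roots"
    using triple K(1) unfolding separating_triple_def by blast+
  have ac: "a K \<in> carrier G" by (rule subgroup.mem_carrier[OF B aB])
  have "\<forall>i\<in>{..<K}. \<exists>N>0. act (a K [^] (N::nat)) (\<alpha> i) = \<alpha> i"
  proof
    fix i assume "i \<in> {..<K}"
    then have i: "i < K" by simp
    then have "separating_triple B (a i) (\<alpha> i) (\<tau> i)" using triple[of i] K(1) by simp
    then show "\<exists>N>0. act (a K [^] (N::nat)) (\<alpha> i) = \<alpha> i"
      using aB tri[OF i K(1)] unfolding separating_triple_def by blast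
  qed
  from bchoice[OF this] obtain N :: "nat \<Rightarrow> nat" where
    N: "\<And>i. i < K \<Longrightarrow> N i > 0" "\<And>i. i < K \<Longrightarrow> act (a K [^] N i) (\<alpha> i) = \<alpha> i" by blast
  define M where "M = (\<Prod>i<K. N i)"
  have M0: "M > 0" unfolding M_def using N(1) by (intro prod_pos) auto
  let ?g = "a K [^] M"
  have gfix: "act ?g (\<alpha> i) = \<alpha> i" if "i < K" for i
  proof -
    have "N i dvd M" unfolding M_def using that by (intro dvd_prodI) auto
    then obtain l where "M = N i * l" by (auto simp: dvd_def)
    then show ?thesis using act_pow_fixed[OF ac roots N(2)[OF that]] that K(1) by simp
  qed
  have "act ?g (\<alpha> K) s = \<alpha> K s" for s
  proof (cases "s \<in> S")
    case True
    have gc: "?g \<in> carrier G" using ac by simp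
    have rel: "(\<Sum>i<m. c i * act ?g (\<alpha> i) s) = 0"
      by (rule act_relation[OF gc, where \<alpha> = \<alpha>]) (use roots c(2) True in auto)
    have "(\<Sum>i<m. c i * act ?g (\<alpha> i) s) - (\<Sum>i<m. c i * \<alpha> i s) = (\<Sum>i<m. c i * (act ?g (\<alpha> i) s - \<alpha> i s))"
      by (simp add: sum_subtractf right_diff_distrib)
    also have "\<dots> = (\<Sum>i\<in>{K}. c i * (act ?g (\<alpha> i) s - \<alpha> i s))"
    proof (rule sum.mono_neutral_right)
      show "\<forall>i\<in>{..<m} - {K}. c i * (act ?g (\<alpha> i) s - \<alpha> i s) = 0"
      proof
        fix i assume "i \<in> {..<m} - {K}"
        then consider "i < K" | "K < i" "i < m" by force
        then show "c i * (act ?g (\<alpha> i) s - \<alpha> i s) = 0"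
          by cases (use gfix above in auto)
      qed
    qed (use K(1) in auto)
    finally show ?thesis using rel c(2) True K(2) by simp
  next
    case False
    then show ?thesis
      using root_support[OF roots[OF K(1)]] root_support[OF act_closed[OF _ roots[OF K(1)]]] ac by simp
  qed
  then have "act ?g (\<alpha> K) = \<alpha> K" by blast
  then show False using triple[OF K(1)] M0 unfolding separating_triple_def by blast
qed

text \<open>As long as fewer homomorphisms than generators have been chosen, they have a common kernel element
  of infinite order; it supplies the next root and the next homomorphism of a triangular system.\<close>

theorem commuting_rank_bound:
  assumes bc: "\<And>i. i < m \<Longrightarrow> b i \<in> carrier G"
    and comm: "\<And>i j. i < m \<Longrightarrow> j < m \<Longrightarrow> b i \<otimes> b j = b j \<otimes> b i"
    and indep: "\<And>(n :: nat \<Rightarrow> int) i. lprod G (map (\<lambda>i. b i [^] n i) [0..<m]) = \<one> \<Longrightarrow> i < m \<Longrightarrow> n i = 0"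
  shows "m \<le> card S"
proof -
  define \<phi> where "\<phi> n = lprod G (map (\<lambda>i. b i [^] n i) [0..<m])" for n :: "nat \<Rightarrow> int"
  have pcomm: "b i [^] k \<otimes> b j [^] l = b j [^] l \<otimes> b i [^] k" if "i < m" "j < m" for i j and k l :: int
  proof -
    have "b j [^] l \<otimes> b i = b i \<otimes> b j [^] l" by (rule int_pow_commute[OF bc[OF that(2)] bc[OF that(1)] comm[OF that(2,1)]])
    then show ?thesis using int_pow_commute[OF bc[OF that(1)] _ , of "b j [^] l" k] bc[OF that(2)] by simp
  qed
  have \<phi>c: "\<phi> n \<in> carrier G" for n unfolding \<phi>_def using bc by (intro lprod_closed) auto
  have \<phi>_add: "\<phi> (\<lambda>i. n i + n' i) = \<phi> n \<otimes> \<phi> n'" for n n'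
  proof -
    have "\<phi> (\<lambda>i. n i + n' i) = lprod G (map (\<lambda>i. b i [^] n i \<otimes> b i [^] n' i) [0..<m])"
      unfolding \<phi>_def using bc by (intro arg_cong[of _ _ "lprod G"] map_cong) (auto simp: int_pow_mult)
    also have "\<dots> = \<phi> n \<otimes> \<phi> n'"
      unfolding \<phi>_def by (rule lprod_mult) (use bc pcomm in auto)
    finally show ?thesis .
  qed
  have \<phi>_zero: "\<phi> (\<lambda>_. 0) = \<one>" unfolding \<phi>_def by (rule lprod_one) simp
  define B where "B = range \<phi>"
  have B: "subgroup B G"
  proof (rule subgroupI)
    show "B \<subseteq> carrier G" "B \<noteq> {}" using \<phi>c unfolding B_def by auto
    fix x assume "x \<in> B"
    then obtain n where n: "x = \<phi> n" unfolding B_def by blast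
    have "\<phi> (\<lambda>i. - n i) \<otimes> x = \<one>" unfolding n \<phi>_add[symmetric] by (simp add: \<phi>_zero)
    then have "inv x = \<phi> (\<lambda>i. - n i)" using n \<phi>c by (intro inv_equality) auto
    then show "inv x \<in> B" unfolding B_def by blast
  next
    fix x y assume "x \<in> B" "y \<in> B"
    then obtain n n' where "x = \<phi> n" "y = \<phi> n'" unfolding B_def by blast
    then have "x \<otimes> y = \<phi> (\<lambda>i. n i + n' i)" by (simp add: \<phi>_add)
    then show "x \<otimes> y \<in> B" unfolding B_def by blast
  qed
  have ab: "x \<otimes> y = y \<otimes> x" if xy: "x \<in> B" "y \<in> B" for x y
  proof -
    obtain n n' where nn: "x = \<phi> n" "y = \<phi> n'" using xy unfolding B_def by blast
    have "\<phi> (\<lambda>i. n i + n' i) = \<phi> (\<lambda>i. n' i + n i)" by (simp add: add.commute)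
    then show ?thesis unfolding nn \<phi>_add .
  qed
  have bB: "b i \<in> B" if "i < m" for i
  proof -
    have "\<phi> (\<lambda>k. of_bool (k = i)) = lprod G (map (\<lambda>k. if k = i then b i else \<one>) [0..<m])"
      unfolding \<phi>_def using bc that by (intro arg_cong[of _ _ "lprod G"] map_cong) auto
    also have "\<dots> = b i" using lprod_single[of "[0..<m]" i "b i"] that bc by simp
    finally show ?thesis unfolding B_def by (metis rangeI)
  qed
  have \<phi>_pow: "\<phi> n [^] k = \<phi> (\<lambda>i. int k * n i)" for n and k :: nat
  proof (induction k)
    case (Suc k)
    have "\<phi> (\<lambda>i. int (Suc k) * n i) = \<phi> (\<lambda>i. int k * n i + n i)" by (simp add: algebra_simps)
    then show ?case using Suc \<phi>_add[of "\<lambda>i. int k * n i" n] by simp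
  qed (simp add: \<phi>_zero)
  have \<tau>\<phi>: "\<tau> (\<phi> n) = (\<Sum>i<m. n i * \<tau> (b i))"
    if hom: "\<And>x y. x \<in> B \<Longrightarrow> y \<in> B \<Longrightarrow> \<tau> (x \<otimes> y) = \<tau> x + \<tau> y" for \<tau> :: "'a \<Rightarrow> int" and n
  proof -
    have "\<tau> (\<phi> n) = (\<Sum>i<m. \<tau> (b i [^] n i))"
      unfolding \<phi>_def by (rule hom_int_lprod(2)[OF B hom]) (use subgroup_int_pow_closed[OF B bB] in auto)
    also have "\<dots> = (\<Sum>i<m. n i * \<tau> (b i))"
      by (rule sum.cong) (use hom_int_int_pow[OF B hom bB] in auto)
    finally show ?thesis .
  qed
  have "\<exists>a \<alpha> \<tau>. (\<forall>j<k. separating_triple B (a j) (\<alpha> j) (\<tau> j)) \<and> (\<forall>j<k. \<forall>i<j. \<tau> i (a j) = 0)"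
    if "k \<le> m" for k
    using that
  proof (induction k)
    case (Suc k)
    have "k \<le> m" using Suc.prems by simp
    from Suc.IH[OF this] obtain a \<alpha> \<tau> where "\<forall>j<k. separating_triple B (a j) (\<alpha> j) (\<tau> j)"
      "\<forall>j<k. \<forall>i<j. \<tau> i (a j) = 0" by (elim exE conjE)
    then have IH: "\<And>j. j < k \<Longrightarrow> separating_triple B (a j) (\<alpha> j) (\<tau> j)"
      "\<And>i j. j < k \<Longrightarrow> i < j \<Longrightarrow> \<tau> i (a j) = 0" by blast+
    obtain n where n: "\<exists>i\<in>{..<m}. n i \<noteq> 0" "\<forall>j\<in>{..<k}. (\<Sum>i<m. n i * \<tau> j (b i)) = 0"
      using dependent_family[of "{..<k}" "{..<m}" "\<lambda>i j. \<tau> j (b i)"] Suc.prems by auto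
    have \<phi>B: "\<phi> n \<in> B" unfolding B_def by blast
    have inf: "\<phi> n [^] N \<noteq> \<one>" if "0 < N" for N :: nat
    proof
      assume "\<phi> n [^] N = \<one>"
      then have "int N * n i = 0" if "i < m" for i
        using indep[of "\<lambda>i. int N * n i", OF _ that] unfolding \<phi>_pow unfolding \<phi>_def by simp
      then show False using n(1) \<open>0 < N\<close> by auto
    qed
    obtain \<alpha>' \<tau>' where new: "separating_triple B (\<phi> n) \<alpha>' \<tau>'"
      using abelian_transfer[OF B ab \<phi>B inf] \<phi>B unfolding separating_triple_def by blast
    have zero: "\<tau> j (\<phi> n) = 0" if "j < k" for j
    proof -
      have "\<tau> j (\<phi> n) = (\<Sum>i<m. n i * \<tau> j (b i))"
        by (rule \<tau>\<phi>) (use IH(1)[OF that] in \<open>auto simp: separating_triple_def\<close>)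
      then show ?thesis using n(2) that by simp
    qed
    show ?case
      by (rule exI[of _ "a(k := \<phi> n)"], rule exI[of _ "\<alpha>(k := \<alpha>')"], rule exI[of _ "\<tau>(k := \<tau>')"])
         (use IH new zero in \<open>auto simp: less_Suc_eq\<close>)
  qed simp
  from this[OF order_refl] obtain a \<alpha> \<tau> where "\<forall>j<m. separating_triple B (a j) (\<alpha> j) (\<tau> j)"
    "\<forall>j<m. \<forall>i<j. \<tau> i (a j) = 0" by (elim exE conjE)
  then show ?thesis using triangular_bound[OF B, of m a \<alpha> \<tau>] by blast
qed

end

section \<open>The geometric representation of a Coxeter matrix\<close>

text \<open>Chebyshev polynomials of the second kind, with the index shifted by one: they are the coefficients
  that occur in a dihedral orbit of a simple root.\<close>

fun chebyshev_U :: "real \<Rightarrow> nat \<Rightarrow> real" where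
  "chebyshev_U c 0 = 0"
| "chebyshev_U c (Suc 0) = 1"
| "chebyshev_U c (Suc (Suc k)) = 2 * c * chebyshev_U c (Suc k) - chebyshev_U c k"

lemma chebyshev_U_cos: "sin \<theta> * chebyshev_U (cos \<theta>) k = sin (real k * \<theta>)"
proof (induction k rule: chebyshev_U.induct[where ?a0.0 = "cos \<theta>" and P = "\<lambda>_ k. sin \<theta> * chebyshev_U (cos \<theta>) k = sin (real k * \<theta>)"])
  case (3 c k)
  have "sin (real (Suc (Suc k)) * \<theta>) + sin (real k * \<theta>) = 2 * cos \<theta> * sin (real (Suc k) * \<theta>)"
  proof -
    have e: "real (Suc (Suc k)) * \<theta> = real (Suc k) * \<theta> + \<theta>" "real k * \<theta> = real (Suc k) * \<theta> - \<theta>"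
      by (simp_all add: algebra_simps)
    show ?thesis unfolding e sin_add sin_diff by simp
  qed
  then show ?case using 3 by (simp add: algebra_simps)
qed auto

lemma chebyshev_U_one: "chebyshev_U 1 k = real k"
  by (induction k rule: chebyshev_U.induct[where ?a0.0 = 1 and P = "\<lambda>_ k. chebyshev_U 1 k = real k"]) auto

text \<open>The matrix of the invariant bilinear form in the basis of simple roots.\<close>

definition cox_form :: "('s \<Rightarrow> 's \<Rightarrow> enat) \<Rightarrow> 's \<Rightarrow> 's \<Rightarrow> real" where
  "cox_form M s t = (if s = t then 1 else case M s t of enat k \<Rightarrow> - cos (pi / real k) | \<infinity> \<Rightarrow> - 1)"

definition simple_root :: "'s \<Rightarrow> 's \<Rightarrow> real" where
  "simple_root s = (\<lambda>t. of_bool (t = s))"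

locale coxeter_matrix_on =
  fixes S :: "'s set" and M :: "'s \<Rightarrow> 's \<Rightarrow> enat"
  assumes finite_S: "finite S" and matrix: "coxeter_matrix S M"
begin

definition pairing :: "'s \<Rightarrow> ('s \<Rightarrow> real) \<Rightarrow> real" where
  "pairing s v = (\<Sum>t\<in>S. cox_form M s t * v t)"

definition refl :: "'s \<Rightarrow> ('s \<Rightarrow> real) \<Rightarrow> ('s \<Rightarrow> real)" where
  "refl s v = (\<lambda>t. v t - 2 * pairing s v * simple_root s t)"

lemma cox_form_refl [simp]: "cox_form M s s = 1"
  by (simp add: cox_form_def)

lemma cox_form_sym: "s \<in> S \<Longrightarrow> t \<in> S \<Longrightarrow> cox_form M s t = cox_form M t s"
  using matrix by (auto simp: cox_form_def coxeter_matrix_def)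

lemma pairing_simple: "t \<in> S \<Longrightarrow> pairing s (simple_root t) = cox_form M s t"
proof -
  assume t: "t \<in> S"
  have "pairing s (simple_root t) = (\<Sum>r\<in>S. if r = t then cox_form M s r else 0)"
    unfolding pairing_def by (rule sum.cong) (auto simp: simple_root_def)
  then show ?thesis using t finite_S by simp
qed

lemma pairing_comb: "pairing s (\<lambda>t. \<Sum>i\<in>I. c i * v i t) = (\<Sum>i\<in>I. c i * pairing s (v i))"
proof -
  have "pairing s (\<lambda>t. \<Sum>i\<in>I. c i * v i t) = (\<Sum>t\<in>S. \<Sum>i\<in>I. c i * (cox_form M s t * v i t))"
    unfolding pairing_def by (simp add: sum_distrib_left mult_ac)
  also have "\<dots> = (\<Sum>i\<in>I. \<Sum>t\<in>S. c i * (cox_form M s t * v i t))" by (rule sum.swap)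
  finally show ?thesis unfolding pairing_def by (simp add: sum_distrib_left)
qed

lemma pairing_lin: "pairing s (\<lambda>t. a * u t + b * v t) = a * pairing s u + b * pairing s v"
  unfolding pairing_def by (simp add: sum_distrib_left sum.distrib algebra_simps)

lemma refl_lin: "refl s (\<lambda>t. a * u t + b * v t) = (\<lambda>t. a * refl s u t + b * refl s v t)"
  by (simp add: refl_def pairing_lin algebra_simps)

lemma refl_comb: "refl s (\<lambda>t. \<Sum>i\<in>I. c i * v i t) = (\<lambda>t. \<Sum>i\<in>I. c i * refl s (v i) t)"
  by (simp add: refl_def pairing_comb sum_subtractf sum_distrib_left sum_distrib_right algebra_simps)

lemma refl_refl: "s \<in> S \<Longrightarrow> refl s (refl s v) = v"
proof -
  assume s: "s \<in> S"
  have "refl s v = (\<lambda>t. 1 * v t + (- 2 * pairing s v) * simple_root s t)" by (simp add: refl_def)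
  then have "pairing s (refl s v) = - pairing s v"
    using pairing_lin[of s 1 v "- 2 * pairing s v" "simple_root s"] pairing_simple[OF s, of s] by simp
  then show ?thesis by (simp add: refl_def)
qed

lemma refl_simple: "t \<in> S \<Longrightarrow> refl s (simple_root t) = (\<lambda>r. simple_root t r - 2 * cox_form M s t * simple_root s r)"
  by (simp add: refl_def pairing_simple)

definition word_act :: "'s list \<Rightarrow> ('s \<Rightarrow> real) \<Rightarrow> ('s \<Rightarrow> real)" where
  "word_act ss v = foldr refl ss v"

lemma word_act_simps [simp]: "word_act [] v = v" "word_act (s # ss) v = refl s (word_act ss v)"
  by (auto simp: word_act_def)

lemma word_act_append: "word_act (xs @ ys) v = word_act xs (word_act ys v)"
  by (simp add: word_act_def)

lemma word_act_lin: "word_act ss (\<lambda>t. a * u t + b * v t) = (\<lambda>t. a * word_act ss u t + b * word_act ss v t)"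
  by (induction ss) (auto simp: refl_lin)

lemma word_act_comb: "word_act ss (\<lambda>t. \<Sum>i\<in>I. c i * v i t) = (\<lambda>t. \<Sum>i\<in>I. c i * word_act ss (v i) t)"
  by (induction ss) (auto simp: refl_comb)

text \<open>The alternating word of length \<open>k\<close> in \<open>s\<close> and \<open>t\<close> that ends with \<open>t\<close>; new letters are added on the
  left because words act from the left.\<close>

fun alt :: "'s \<Rightarrow> 's \<Rightarrow> nat \<Rightarrow> 's list" where
  "alt s t 0 = []"
| "alt s t (Suc k) = (if even k then t else s) # alt s t k"

lemma length_alt [simp]: "length (alt s t k) = k" by (induction k) auto

lemma set_alt: "set (alt s t k) \<subseteq> {s, t}" by (induction k) auto

lemma alt_add: "\<exists>zs. set zs \<subseteq> {s, t} \<and> length zs = j \<and> alt s t (j + q) = zs @ alt s t q"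
proof (induction j)
  case (Suc j)
  then obtain zs where "set zs \<subseteq> {s, t}" "length zs = j" "alt s t (j + q) = zs @ alt s t q" by blast
  then show ?case by (intro exI[of _ "(if even (j + q) then t else s) # zs"]) auto
qed auto

lemma alt_even: "alt s t (2 * n) = concat (replicate n [s, t])"
  by (induction n) auto

lemma word_act_alt:
  assumes s: "s \<in> S" and t: "t \<in> S" and c: "c = - cox_form M s t"
  shows "word_act (alt s t k) (simple_root s) =
    (\<lambda>r. chebyshev_U c (if even k then Suc k else k) * simple_root s r
       + chebyshev_U c (if even k then k else Suc k) * simple_root t r)"
proof (induction k)
  case (Suc k)
  have c': "c = - cox_form M t s" using c cox_form_sym[OF s t] by simp
  show ?case
  proof (cases "even k")
    case True
    then show ?thesis using Suc
      by (simp add: refl_lin refl_simple s t c'[symmetric]) (simp add: c' algebra_simps)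
  next
    case False
    then show ?thesis using Suc
      by (simp add: refl_lin refl_simple s t) (simp add: c algebra_simps)
  qed
qed simp

text \<open>A vector is the sum of a combination of the two simple roots and a vector orthogonal to both. The
  latter is fixed by both reflections; on the plane of the two roots the product is a rotation by
  \<open>2 \<pi> / k\<close>, computed by the Chebyshev coefficients.\<close>

lemma dihedral_relation:
  assumes s: "s \<in> S" and t: "t \<in> S" and st: "s \<noteq> t" and k: "M s t = enat k"
  shows "word_act (concat (replicate k [s, t])) v = v"
proof -
  define \<theta> where "\<theta> = pi / real k"
  define c where "c = cos \<theta>"
  have "2 \<le> M s t" using matrix s t st unfolding coxeter_matrix_def by blast
  then have k2: "k \<ge> 2" using k by (simp add: numeral_eq_enat)
  have form: "cox_form M s t = - c" using st k by (simp add: cox_form_def c_def \<theta>_def)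
  have form': "cox_form M t s = - c" using form cox_form_sym[OF s t] by simp
  have k\<theta>: "real k * \<theta> = pi" using k2 by (simp add: \<theta>_def)
  have "\<theta> > 0" "\<theta> < pi" using k2 by (auto simp: \<theta>_def field_simps)
  then have sin0: "sin \<theta> > 0" by (rule sin_gt_zero)
  have U: "chebyshev_U c j = sin (real j * \<theta>) / sin \<theta>" for j
    using chebyshev_U_cos[of \<theta> j] sin0 by (simp add: c_def field_simps)
  have U0: "chebyshev_U c (2 * k) = 0" and U1: "chebyshev_U c (Suc (2 * k)) = 1"
    and U2: "chebyshev_U c (2 * k - 1) = - 1"
  proof -
    have e: "real (2 * k) * \<theta> = 2 * pi" using k\<theta> by simp
    have e1: "real (Suc (2 * k)) * \<theta> = 2 * pi + \<theta>" using e by (simp add: algebra_simps)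
    have e2: "real (2 * k - 1) * \<theta> = 2 * pi - \<theta>" using e k2 by (simp add: of_nat_diff algebra_simps)
    show "chebyshev_U c (2 * k) = 0" unfolding U e by simp
    show "chebyshev_U c (Suc (2 * k)) = 1" unfolding U e1 using sin0 by (simp add: sin_add)
    show "chebyshev_U c (2 * k - 1) = - 1" unfolding U e2 using sin0 by (simp add: sin_diff)
  qed
  let ?R = "word_act (alt s t (2 * k))"
  have Rs: "?R (simple_root s) = simple_root s"
    using word_act_alt[OF s t, of c "2 * k"] form U0 U1 by simp
  have Rt: "?R (simple_root t) = simple_root t"
  proof -
    have alt': "alt s t (2 * k) = alt t s (2 * k - 1) @ [t]"
    proof -
      have "alt s t (Suc j) = alt t s j @ [t]" for j by (induction j) auto
      from this[of "2 * k - 1"] show ?thesis using k2 by simp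
    qed
    have neg: "refl t (simple_root t) = (\<lambda>r. - simple_root t r)"
      by (simp add: refl_simple t)
    have "odd (2 * k - 1)" "Suc (2 * k - 1) = 2 * k" using k2 by auto
    then have "word_act (alt t s (2 * k - 1)) (simple_root t) = (\<lambda>r. (- 1) * simple_root t r)"
      using word_act_alt[OF t s, of c "2 * k - 1"] form' U0 U2 by simp
    then show ?thesis
      unfolding alt' word_act_append
      using word_act_lin[of "alt t s (2 * k - 1)" "- 1" "simple_root t" 0 "simple_root t"] by (simp add: neg)
  qed
  have fixv: "?R u = u" if "pairing s u = 0" "pairing t u = 0" for u
  proof -
    have r: "refl s u = u" "refl t u = u" using that by (auto simp: refl_def)
    have "word_act (alt s t j) u = u" for j by (induction j) (auto simp: r)
    then show ?thesis .
  qed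
  define p where "p = pairing s v"
  define q where "q = pairing t v"
  define d where "d = 1 - c * c"
  have d: "d \<noteq> 0"
    using sin0 sin_cos_squared_add[of \<theta>] by (auto simp: d_def c_def power2_eq_square)
  \<comment> \<open>coordinates of the projection of \<open>v\<close> to the plane, by inverting the Gram matrix, whose determinant is \<open>d\<close>\<close>
  define x where "x = (p + c * q) / d"
  define y where "y = (c * p + q) / d"
  define u where "u = (\<lambda>r. 1 * v r + (- 1) * (x * simple_root s r + y * simple_root t r))"
  have pu: "pairing s u = p - (x - c * y)" "pairing t u = q - (y - c * x)"
    unfolding u_def pairing_lin by (simp_all add: pairing_simple s t form form' p_def q_def)
  have "x - c * y = p * d / d" "y - c * x = q * d / d"
    by (simp_all add: x_def y_def d_def diff_divide_distrib[symmetric] algebra_simps)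
  then have "pairing s u = 0" "pairing t u = 0" using pu d by auto
  then have Ru: "?R u = u" by (rule fixv)
  have v: "v = (\<lambda>r. 1 * u r + 1 * (x * simple_root s r + y * simple_root t r))" by (simp add: u_def)
  have "?R v = v"
    by (subst (1 2) v) (simp only: word_act_lin Ru Rs Rt)
  then show ?thesis by (simp add: alt_even)
qed

lemma chebyshev_U_nonneg:
  assumes s: "s \<in> S" and t: "t \<in> S" and st: "s \<noteq> t" and j: "enat j \<le> M s t"
  shows "chebyshev_U (- cox_form M s t) j \<ge> 0"
proof (cases "M s t")
  case (enat k)
  have "2 \<le> M s t" using matrix s t st unfolding coxeter_matrix_def by blast
  then have k2: "k \<ge> 2" using enat by (simp add: numeral_eq_enat)
  let ?\<theta> = "pi / real k"
  have c: "- cox_form M s t = cos ?\<theta>" using st enat by (simp add: cox_form_def)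
  have "?\<theta> > 0" "?\<theta> < pi" using k2 by (auto simp: field_simps)
  then have sin0: "sin ?\<theta> > 0" by (rule sin_gt_zero)
  have "real j * ?\<theta> \<le> pi" using j enat k2 by (simp add: field_simps)
  then have "sin (real j * ?\<theta>) \<ge> 0" by (intro sin_ge_zero) auto
  then show ?thesis using chebyshev_U_cos[of ?\<theta> j] sin0 unfolding c by (metis zero_le_mult_iff not_less order_less_imp_le order.asym)
next
  case infinity
  then have "- cox_form M s t = 1" using st by (simp add: cox_form_def)
  then show ?thesis by (simp add: chebyshev_U_one)
qed

lemma word_act_alt_nonneg:
  assumes s: "s \<in> S" and t: "t \<in> S" and st: "s \<noteq> t" and k: "enat (Suc k) \<le> M s t"
  obtains a b where "a \<ge> 0" "b \<ge> 0"
    "word_act (alt s t k) (simple_root s) = (\<lambda>r. a * simple_root s r + b * simple_root t r)"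
proof -
  have "enat k \<le> M s t" using k by (metis Suc_ile_eq order_less_imp_le)
  then show thesis
    using that[OF _ _ word_act_alt[OF s t refl, of k]] chebyshev_U_nonneg[OF s t st] k by auto
qed

definition form :: "('s \<Rightarrow> real) \<Rightarrow> ('s \<Rightarrow> real) \<Rightarrow> real" where
  "form u v = (\<Sum>s\<in>S. u s * pairing s v)"

text \<open>Invariance of the quadratic form gives all roots norm \<open>1\<close>; it serves to exclude that a proper
  multiple of a simple root is a root.\<close>

lemma form_refl:
  assumes s: "s \<in> S" shows "form (refl s v) (refl s v) = form v v"
proof -
  let ?p = "pairing s v"
  have pr: "pairing r (refl s v) = pairing r v - 2 * ?p * cox_form M r s" for r
  proof -
    have "refl s v = (\<lambda>t. 1 * v t + (- 2 * ?p) * simple_root s t)" by (simp add: refl_def)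
    then show ?thesis using pairing_lin[of r 1 v "- 2 * ?p" "simple_root s"] pairing_simple[OF s, of r] by simp
  qed
  have delta: "(\<Sum>r\<in>S. simple_root s r * f r) = f s" for f :: "'s \<Rightarrow> real"
  proof -
    have "(\<Sum>r\<in>S. simple_root s r * f r) = (\<Sum>r\<in>S. if r = s then f r else 0)"
      by (rule sum.cong) (auto simp: simple_root_def)
    then show ?thesis using s finite_S by simp
  qed
  have vs: "(\<Sum>r\<in>S. v r * cox_form M r s) = ?p"
    unfolding pairing_def by (rule sum.cong) (auto simp: cox_form_sym s)
  have "form (refl s v) (refl s v) =
     (\<Sum>r\<in>S. v r * pairing r v) - 2 * ?p * (\<Sum>r\<in>S. v r * cox_form M r s)
     - 2 * ?p * (\<Sum>r\<in>S. simple_root s r * pairing r v)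
     + 4 * ?p * ?p * (\<Sum>r\<in>S. simple_root s r * cox_form M r s)"
    unfolding form_def pr unfolding refl_def
    by (simp add: sum_subtractf sum.distrib sum_distrib_left algebra_simps)
  then show ?thesis unfolding delta vs by (simp add: form_def)
qed

lemma form_simple: "s \<in> S \<Longrightarrow> form (\<lambda>r. a * simple_root s r) (\<lambda>r. a * simple_root s r) = a * a"
proof -
  assume s: "s \<in> S"
  have "pairing r (\<lambda>r. a * simple_root s r) = a * cox_form M r s" for r
    using pairing_lin[of r a "simple_root s" 0 "simple_root s"] pairing_simple[OF s, of r] by simp
  then have "form (\<lambda>r. a * simple_root s r) (\<lambda>r. a * simple_root s r) = (\<Sum>r\<in>S. if r = s then a * a else 0)"
    unfolding form_def by (intro sum.cong) (auto simp: simple_root_def)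
  then show ?thesis using s finite_S by simp
qed

end

section \<open>Length and positivity in a Coxeter group\<close>

locale coxeter_presentation = group G + coxeter_matrix_on S M
  for G :: "('a, 'b) monoid_scheme" (structure) and S :: "'a set" and M :: "'a \<Rightarrow> 'a \<Rightarrow> enat" +
  assumes presentation: "has_presentation G S (coxeter_relators S M)"
begin

lemma S_carrier: "S \<subseteq> carrier G" and gen: "generate G S = carrier G"
  and word_eq: "\<And>u v. u \<in> lists (S \<times> UNIV) \<Longrightarrow> v \<in> lists (S \<times> UNIV) \<Longrightarrow>
     word_val G u = word_val G v \<longleftrightarrow> pres_eq S (coxeter_relators S M) u v"
  using presentation unfolding has_presentation_def by blast+

definition positive_word :: "'a list \<Rightarrow> 'a gword" where
  "positive_word ss = map (\<lambda>s. (s, True)) ss"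

lemma positive_word_val: "word_val G (positive_word ss) = lprod G ss"
  by (induction ss) (auto simp: word_val_def positive_word_def)

lemma positive_word_lists: "ss \<in> lists S \<Longrightarrow> positive_word ss \<in> lists (S \<times> UNIV)"
  by (induction ss) (auto simp: positive_word_def)

lemma lprod_S_closed: "ss \<in> lists S \<Longrightarrow> lprod G ss \<in> carrier G"
  using S_carrier by (intro lprod_closed) auto

lemma lprod_S_append: "xs \<in> lists S \<Longrightarrow> ys \<in> lists S \<Longrightarrow> lprod G (xs @ ys) = lprod G xs \<otimes> lprod G ys"
  using S_carrier by (intro lprod_append) auto

lemma relator_trivial:
  assumes "positive_word ss \<in> coxeter_relators S M" "ss \<in> lists S"
  shows "lprod G ss = \<one>"
proof -
  have "pres_step S (coxeter_relators S M) ([] @ positive_word ss @ []) ([] @ [])"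
    by (rule pres_step.relator[OF assms(1)])
  then have "pres_eq S (coxeter_relators S M) (positive_word ss) (positive_word [])"
    unfolding pres_eq_def by (auto simp: positive_word_def)
  then show ?thesis
    using word_eq[OF positive_word_lists[OF assms(2)] positive_word_lists[of "[]"]] by (simp add: positive_word_val)
qed

lemma gen_square: "s \<in> S \<Longrightarrow> s \<otimes> s = \<one>"
proof -
  assume s: "s \<in> S"
  have "positive_word [s, s] \<in> coxeter_relators S M"
    using s by (auto simp: positive_word_def coxeter_relators_def)
  from relator_trivial[OF this] show ?thesis using s S_carrier by auto
qed

lemma gen_inv: "s \<in> S \<Longrightarrow> inv s = s"
  using gen_square S_carrier by (metis inv_equality subsetD)

lemma gen_cancel: "s \<in> S \<Longrightarrow> w \<in> carrier G \<Longrightarrow> w \<otimes> s \<otimes> s = w"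
  using gen_square S_carrier by (simp add: m_assoc subset_iff)

lemma gen_cancel_left: "s \<in> S \<Longrightarrow> w \<in> carrier G \<Longrightarrow> s \<otimes> (s \<otimes> w) = w"
  using gen_square S_carrier by (simp add: m_assoc[symmetric] subset_iff)

lemma gen_braid:
  assumes "s \<in> S" "t \<in> S" "s \<noteq> t" "M s t = enat k"
  shows "lprod G (concat (replicate k [s, t])) = \<one>"
proof (rule relator_trivial)
  have "positive_word (concat (replicate k [s, t])) = concat (replicate k [(s, True), (t, True)])"
    by (induction k) (auto simp: positive_word_def)
  then show "positive_word (concat (replicate k [s, t])) \<in> coxeter_relators S M"
    using assms by (auto simp: coxeter_relators_def)
  show "concat (replicate k [s, t]) \<in> lists S" using assms(1,2) by (auto simp: set_replicate_conv_if split: if_splits)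
qed

lemma word_exists: "w \<in> carrier G \<Longrightarrow> \<exists>ss\<in>lists S. lprod G ss = w"
  unfolding gen[symmetric]
proof (induction rule: generate.induct)
  case one
  show ?case by (rule bexI[of _ "[]"]) auto
next
  case (incl h)
  then show ?case using S_carrier by (intro bexI[of _ "[h]"]) auto
next
  case (inv h)
  then show ?case using S_carrier gen_inv by (intro bexI[of _ "[h]"]) auto
next
  case (eng h1 h2)
  then obtain xs ys where "xs \<in> lists S" "lprod G xs = h1" "ys \<in> lists S" "lprod G ys = h2" by blast
  then show ?case using lprod_S_append by (intro bexI[of _ "xs @ ys"]) auto
qed

lemma word_act_pres_step:
  assumes "pres_step S (coxeter_relators S M) u v"
  shows "word_act (map fst u) x = word_act (map fst v) x"
  using assms
proof cases
  case (cancel s u' b v')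
  then show ?thesis by (simp add: word_act_append refl_refl)
next
  case (relator r u' v')
  have "word_act (map fst r) y = y" for y
  proof -
    consider s where "s \<in> S" "r = [(s, True), (s, True)]"
      | s t k where "s \<in> S" "t \<in> S" "s \<noteq> t" "M s t = enat k" "r = concat (replicate k [(s, True), (t, True)])"
      using relator(3) unfolding coxeter_relators_def by blast
    then show ?thesis
    proof cases
      case 1
      then show ?thesis by (simp add: refl_refl)
    next
      case 2
      then have "map fst r = concat (replicate k [s, t])" by (simp add: map_concat)
      then show ?thesis using dihedral_relation[OF 2(1-4)] by simp
    qed
  qed
  then show ?thesis using relator by (simp add: word_act_append)
qed

lemma word_act_cong:
  assumes "xs \<in> lists S" "ys \<in> lists S" "lprod G xs = lprod G ys"
  shows "word_act xs v = word_act ys v"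
proof -
  have "pres_eq S (coxeter_relators S M) (positive_word xs) (positive_word ys)"
    using word_eq[OF positive_word_lists[OF assms(1)] positive_word_lists[OF assms(2)]] assms(3)
    by (simp add: positive_word_val)
  then have "word_act (map fst (positive_word xs)) v = word_act (map fst (positive_word ys)) v"
    unfolding pres_eq_def
  proof (induction rule: equivclp_induct)
    case (step y z)
    then show ?case using word_act_pres_step by metis
  qed simp
  then show ?thesis by (simp add: positive_word_def o_def)
qed

definition act :: "'a \<Rightarrow> ('a \<Rightarrow> real) \<Rightarrow> ('a \<Rightarrow> real)" where
  "act w = word_act (SOME ss. ss \<in> lists S \<and> lprod G ss = w)"

lemma act_word: "ss \<in> lists S \<Longrightarrow> act (lprod G ss) v = word_act ss v"
proof -
  assume ss: "ss \<in> lists S"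
  define xs where "xs = (SOME xs. xs \<in> lists S \<and> lprod G xs = lprod G ss)"
  have "xs \<in> lists S \<and> lprod G xs = lprod G ss"
    unfolding xs_def by (rule someI[of _ ss]) (use ss in simp)
  then show ?thesis unfolding act_def xs_def[symmetric] using word_act_cong ss by blast
qed

lemma act_one: "act \<one> v = v"
  using act_word[of "[]"] by simp

lemma act_mult:
  assumes "x \<in> carrier G" "y \<in> carrier G"
  shows "act (x \<otimes> y) v = act x (act y v)"
proof -
  obtain xs ys where "xs \<in> lists S" "lprod G xs = x" "ys \<in> lists S" "lprod G ys = y"
    using word_exists assms by blast
  then show ?thesis using act_word[of "xs @ ys" v] act_word[of xs] act_word[of ys] lprod_S_append
    by (simp add: word_act_append)
qed

lemma act_gen: "s \<in> S \<Longrightarrow> act s v = refl s v"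
  using act_word[of "[s]" v] S_carrier by auto

lemma act_lin: "w \<in> carrier G \<Longrightarrow> act w (\<lambda>t. a * u t + b * v t) = (\<lambda>t. a * act w u t + b * act w v t)"
  using word_exists[of w] act_word word_act_lin by metis

lemma act_comb: "w \<in> carrier G \<Longrightarrow> act w (\<lambda>t. \<Sum>i\<in>I. c i * v i t) = (\<lambda>t. \<Sum>i\<in>I. c i * act w (v i) t)"
proof -
  assume "w \<in> carrier G"
  then obtain ss where "ss \<in> lists S" "w = lprod G ss" using word_exists by blast
  then show ?thesis by (simp add: act_word word_act_comb)
qed

lemma act_zero: "w \<in> carrier G \<Longrightarrow> act w (\<lambda>_. 0) = (\<lambda>_. 0)"
  using act_lin[of w 0 "\<lambda>_. 0" 0 "\<lambda>_. 0"] by simp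

lemma act_neg: "w \<in> carrier G \<Longrightarrow> act w (\<lambda>t. - v t) = (\<lambda>t. - act w v t)"
  using act_lin[of w "- 1" v 0 v] by simp

lemma act_inv_act: "w \<in> carrier G \<Longrightarrow> act (inv w) (act w v) = v"
  using act_mult[of "inv w" w v] act_one by simp

definition wlen :: "'a \<Rightarrow> nat" where
  "wlen w = (LEAST n. \<exists>ss\<in>lists S. length ss = n \<and> lprod G ss = w)"

lemma wlen_le: "ss \<in> lists S \<Longrightarrow> wlen (lprod G ss) \<le> length ss"
  unfolding wlen_def by (rule Least_le) blast

lemma reduced_word:
  assumes "w \<in> carrier G" obtains ss where "ss \<in> lists S" "length ss = wlen w" "lprod G ss = w"
proof -
  have "\<exists>n. \<exists>ss\<in>lists S. length ss = n \<and> lprod G ss = w" using word_exists[OF assms] by blast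
  from LeastI_ex[OF this] show thesis unfolding wlen_def[symmetric] using that by blast
qed

lemma wlen_mult_word:
  assumes "w \<in> carrier G" "ss \<in> lists S" shows "wlen (w \<otimes> lprod G ss) \<le> wlen w + length ss"
proof -
  obtain xs where "xs \<in> lists S" "length xs = wlen w" "lprod G xs = w" using reduced_word[OF assms(1)] by blast
  then show ?thesis using wlen_le[of "xs @ ss"] lprod_S_append assms(2) by simp
qed

lemma wlen_mult_gen: "w \<in> carrier G \<Longrightarrow> s \<in> S \<Longrightarrow> wlen (w \<otimes> s) \<le> wlen w + 1"
  using wlen_mult_word[of w "[s]"] S_carrier by auto

lemma wlen_mult_gen': "w \<in> carrier G \<Longrightarrow> s \<in> S \<Longrightarrow> wlen w \<le> wlen (w \<otimes> s) + 1"
  using wlen_mult_gen[of "w \<otimes> s" s] gen_cancel S_carrier by auto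

lemma descent_exists:
  assumes w: "w \<in> carrier G" "w \<noteq> \<one>"
  obtains s where "s \<in> S" "wlen (w \<otimes> s) < wlen w"
proof -
  obtain ss where ss: "ss \<in> lists S" "length ss = wlen w" "lprod G ss = w" using reduced_word[OF w(1)] by blast
  then have "ss \<noteq> []" using w(2) by auto
  then obtain xs s where xs: "ss = xs @ [s]" by (metis rev_exhaust)
  then have s: "s \<in> S" "xs \<in> lists S" using ss(1) by auto
  have "w = lprod G xs \<otimes> s" using lprod_S_append[of xs "[s]"] s S_carrier ss(3) xs by auto
  then have "w \<otimes> s = lprod G xs" using gen_cancel[OF s(1)] lprod_S_closed[OF s(2)] by simp
  then have "wlen (w \<otimes> s) < wlen w" using wlen_le[OF s(2)] ss(2) xs by simp
  then show thesis using that s by blast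
qed

lemma alt_lists: "s \<in> S \<Longrightarrow> t \<in> S \<Longrightarrow> alt s t k \<in> lists S"
  using set_alt[of s t k] by auto

text \<open>The quotient of the two alternating words of length \<open>k\<close> is the \<open>k\<close>-th power of \<open>s t\<close> or of \<open>t s\<close>.\<close>

lemma braid_alt:
  assumes s: "s \<in> S" and t: "t \<in> S" and st: "s \<noteq> t" and k: "M s t = enat k"
  shows "lprod G (alt s t k) = lprod G (alt t s k)"
proof -
  let ?P = "\<lambda>k. lprod G (alt s t k)" and ?Q = "\<lambda>k. lprod G (alt t s k)"
  have c: "s \<in> carrier G" "t \<in> carrier G" "?P k \<in> carrier G" "?Q k \<in> carrier G" for k
    using s t S_carrier lprod_S_closed alt_lists by auto
  have comm: "x \<otimes> ((y \<otimes> x) [^] k \<otimes> y) = (x \<otimes> y) [^] Suc k"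
    if "x \<in> carrier G" "y \<in> carrier G" for x y and k :: nat
  proof (induction k)
    case (Suc k)
    have "x \<otimes> ((y \<otimes> x) [^] Suc k \<otimes> y) = (x \<otimes> ((y \<otimes> x) [^] k \<otimes> y)) \<otimes> (x \<otimes> y)"
      using that by (simp add: m_assoc)
    then show ?case using Suc by simp
  qed (use that in simp)
  have "?P k \<otimes> inv (?Q k) = (if even k then (s \<otimes> t) [^] k else (t \<otimes> s) [^] k)" for k
  proof (induction k)
    case (Suc k)
    show ?case
    proof (cases "even k")
      case True
      then have "?P (Suc k) \<otimes> inv (?Q (Suc k)) = t \<otimes> ((?P k \<otimes> inv (?Q k)) \<otimes> s)"
        using c gen_inv[OF s] by (simp add: inv_mult_group m_assoc)
      then show ?thesis using Suc True comm[of t s k] c by simp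
    next
      case False
      then have "?P (Suc k) \<otimes> inv (?Q (Suc k)) = s \<otimes> ((?P k \<otimes> inv (?Q k)) \<otimes> t)"
        using c gen_inv[OF t] by (simp add: inv_mult_group m_assoc)
      then show ?thesis using Suc False comm[of s t k] c by simp
    qed
  qed simp
  moreover have "(s \<otimes> t) [^] k = \<one>"
  proof -
    have "lprod G (concat (replicate n [s, t])) = (s \<otimes> t) [^] n" for n
    proof (induction n)
      case (Suc n)
      have "(s \<otimes> t) \<otimes> (s \<otimes> t) [^] n = (s \<otimes> t) [^] Suc n" using c by (metis m_closed nat_pow_Suc2)
      then show ?case using Suc c by (simp add: m_assoc)
    qed simp
    then show ?thesis using gen_braid[OF s t st k] by metis
  qed
  moreover from this have "(t \<otimes> s) [^] k = \<one>"
  proof -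
    have "t \<otimes> s = inv (s \<otimes> t)" using c gen_inv s t by (simp add: inv_mult_group)
    then show ?thesis using nat_pow_inv[of "s \<otimes> t" k] c \<open>(s \<otimes> t) [^] k = \<one>\<close> by simp
  qed
  ultimately have "?P k \<otimes> inv (?Q k) = \<one>" by simp
  then show ?thesis using c by (metis inv_closed inv_equality inv_inv)
qed

text \<open>The theorem of Tits. By induction on the length choose \<open>t\<close> that shortens \<open>w\<close> from the right, and write
  \<open>w = v d\<close>, without loss of length, with \<open>d\<close> an alternating word in \<open>s\<close> and \<open>t\<close> of maximal length \<open>k\<close>. By
  maximality neither \<open>s\<close> nor \<open>t\<close> shortens \<open>v\<close> from the right, so \<open>v\<close> maps both simple roots to nonnegative
  vectors. If \<open>k\<close> reached the order of \<open>s t\<close>, the braid relation would produce a reduced expression of \<open>w\<close>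
  ending in \<open>s\<close>. So \<open>d\<close> maps the simple root of \<open>s\<close> to a nonnegative combination of the two simple roots.\<close>

theorem ascent_nonneg:
  assumes "w \<in> carrier G" "s \<in> S" "\<not> wlen (w \<otimes> s) < wlen w"
  shows "\<forall>r. act w (simple_root s) r \<ge> 0"
  using assms
proof (induction "wlen w" arbitrary: w s rule: less_induct)
  case less
  note w = less.prems(1) and s = less.prems(2) and asc = less.prems(3)
  show ?case
  proof (cases "w = \<one>")
    case True
    then show ?thesis by (simp add: act_one simple_root_def)
  next
    case False
    obtain t where t: "t \<in> S" "wlen (w \<otimes> t) < wlen w" using descent_exists[OF w False] by blast
    have st: "s \<noteq> t" using t(2) asc by blast
    have sc: "s \<in> carrier G" "t \<in> carrier G" using s t(1) S_carrier by auto
    have ac: "lprod G (alt s t k) \<in> carrier G" for k using lprod_S_closed alt_lists s t(1) by blast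
    define Ks where "Ks = {k. \<exists>v\<in>carrier G. w = v \<otimes> lprod G (alt s t k) \<and> wlen v + k = wlen w}"
    have "wlen (w \<otimes> t) + 1 = wlen w" using t(2) wlen_mult_gen'[OF w t(1)] by simp
    moreover have "w = (w \<otimes> t) \<otimes> lprod G (alt s t 1)" using gen_cancel[OF t(1) w] sc by simp
    ultimately have one: "1 \<in> Ks" unfolding Ks_def using w sc by (intro CollectI bexI[of _ "w \<otimes> t"]) auto
    have fin: "finite Ks" by (rule finite_subset[of _ "{..wlen w}"]) (auto simp: Ks_def)
    define k where "k = Max Ks"
    have "k \<in> Ks" "k \<ge> 1" using Max_in[OF fin] Max_ge[OF fin one] one unfolding k_def by auto
    then obtain v where v: "v \<in> carrier G" "w = v \<otimes> lprod G (alt s t k)" "wlen v + k = wlen w"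
      unfolding Ks_def by blast
    have k_max: "Suc k \<notin> Ks" using Max_ge[OF fin, of "Suc k"] unfolding k_def by auto
    obtain j where j: "k = Suc j" using \<open>k \<ge> 1\<close> by (cases k) auto
    define x where "x = (if even j then t else s)"
    define y where "y = (if even k then t else s)"
    have xyS: "x \<in> S" "y \<in> S" using s t by (auto simp: x_def y_def)
    then have xyc: "x \<in> carrier G" "y \<in> carrier G" using S_carrier by auto
    have ay: "\<not> wlen (v \<otimes> y) < wlen v"
    proof
      assume "wlen (v \<otimes> y) < wlen v"
      then have "wlen (v \<otimes> y) + 1 = wlen v" using wlen_mult_gen'[OF v(1) xyS(2)] by simp
      moreover have "w = (v \<otimes> y) \<otimes> lprod G (alt s t (Suc k))"
        using v(1,2) xyc ac[of k] gen_cancel_left[OF xyS(2) ac[of k]] by (simp add: y_def[symmetric] m_assoc)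
      ultimately have "Suc k \<in> Ks" unfolding Ks_def using v xyc by (intro CollectI bexI[of _ "v \<otimes> y"]) auto
      then show False using k_max by blast
    qed
    have ax: "\<not> wlen (v \<otimes> x) < wlen v"
    proof
      assume "wlen (v \<otimes> x) < wlen v"
      moreover have "w = (v \<otimes> x) \<otimes> lprod G (alt s t j)"
        using v(1,2) xyc ac[of j] by (simp add: j x_def[symmetric] m_assoc)
      then have "wlen w \<le> wlen (v \<otimes> x) + j"
        using wlen_mult_word[of "v \<otimes> x" "alt s t j"] v(1) xyc alt_lists[OF s t(1)] by simp
      ultimately show False using v(3) j by simp
    qed
    have xy: "{x, y} = {s, t}" by (auto simp: x_def y_def j)
    have vw: "wlen v < wlen w" using v(3) \<open>k \<ge> 1\<close> by simp
    have "\<forall>r. act v (simple_root x) r \<ge> 0" by (rule less.hyps[OF vw v(1) xyS(1) ax])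
    moreover have "\<forall>r. act v (simple_root y) r \<ge> 0" by (rule less.hyps[OF vw v(1) xyS(2) ay])
    ultimately have nn: "\<forall>r. act v (simple_root s) r \<ge> 0" "\<forall>r. act v (simple_root t) r \<ge> 0"
      using xy by (metis insertE insertI1 insertI2 singletonD)+
    have "enat (Suc k) \<le> M s t"
    proof (cases "M s t")
      case (enat q)
      have "k < q"
      proof (rule ccontr)
        assume "\<not> k < q"
        then obtain i where i: "k = i + q" by (metis add.commute le_Suc_ex not_less)
        have "2 \<le> M s t" using matrix s t(1) st unfolding coxeter_matrix_def by blast
        then have q2: "q \<ge> 2" using enat by (simp add: numeral_eq_enat)
        obtain zs where zs: "set zs \<subseteq> {s, t}" "length zs = i" "alt s t (i + q) = zs @ alt s t q"
          using alt_add by blast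
        obtain ys where ys: "set ys \<subseteq> {t, s}" "length ys = q - 1" "alt t s (q - 1 + 1) = ys @ alt t s 1"
          using alt_add by blast
        have zsS: "zs \<in> lists S" "ys \<in> lists S" using zs(1) ys(1) s t by auto
        have zc: "lprod G zs \<in> carrier G" "lprod G ys \<in> carrier G" using lprod_S_closed zsS by auto
        have "alt t s q = ys @ [s]" using ys(3) q2 by simp
        then have "lprod G (alt s t q) = lprod G ys \<otimes> s"
          using braid_alt[OF s t(1) st enat] lprod_S_append[of ys "[s]"] zsS s sc by simp
        then have "lprod G (alt s t k) = lprod G zs \<otimes> (lprod G ys \<otimes> s)"
          unfolding i zs(3) using lprod_S_append[OF zsS(1) alt_lists[OF s t(1)]] by simp
        then have "w = v \<otimes> lprod G (zs @ ys) \<otimes> s"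
          using v(1,2) zc sc lprod_S_append zsS by (simp add: m_assoc)
        then have "w \<otimes> s = v \<otimes> lprod G (zs @ ys)"
          using gen_cancel[OF s, of "v \<otimes> lprod G (zs @ ys)"] v(1) lprod_S_closed[of "zs @ ys"] zsS by simp
        then have "wlen (w \<otimes> s) \<le> wlen v + (i + (q - 1))"
          using wlen_mult_word[OF v(1), of "zs @ ys"] zsS zs(2) ys(2) by simp
        then show False using asc v(3) i q2 by simp
      qed
      then show ?thesis using enat by simp
    qed simp
    from word_act_alt_nonneg[OF s t(1) st this] obtain a b where
      ab: "a \<ge> 0" "b \<ge> 0" "word_act (alt s t k) (simple_root s) = (\<lambda>r. a * simple_root s r + b * simple_root t r)"
      by metis
    have "act w (simple_root s) = act v (word_act (alt s t k) (simple_root s))"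
      unfolding v(2) act_mult[OF v(1) ac] act_word[OF alt_lists[OF s t(1)]] ..
    also have "\<dots> = (\<lambda>r. a * act v (simple_root s) r + b * act v (simple_root t) r)"
      unfolding ab(3) by (rule act_lin[OF v(1)])
    finally show ?thesis using nn ab(1,2) by (simp add: add_nonneg_nonneg)
  qed
qed

corollary descent_nonpos:
  assumes w: "w \<in> carrier G" and s: "s \<in> S" and d: "wlen (w \<otimes> s) < wlen w"
  shows "\<forall>r. act w (simple_root s) r \<le> 0"
proof -
  have sc: "s \<in> carrier G" using s S_carrier by blast
  have "\<not> wlen (w \<otimes> s \<otimes> s) < wlen (w \<otimes> s)" using d gen_cancel[OF s w] by simp
  then have "\<forall>r. act (w \<otimes> s) (simple_root s) r \<ge> 0" using ascent_nonneg[OF _ s] w sc by blast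
  moreover have "act s (simple_root s) = (\<lambda>r. - simple_root s r)" by (simp add: act_gen s refl_simple)
  ultimately show ?thesis using act_mult[OF w sc, of "simple_root s"] act_neg[OF w] by simp
qed

section \<open>The root system of a Coxeter group\<close>

definition roots :: "('a \<Rightarrow> real) set" where
  "roots = {act w (simple_root s) | w s. w \<in> carrier G \<and> s \<in> S}"

definition pos :: "('a \<Rightarrow> real) \<Rightarrow> bool" where
  "pos v \<longleftrightarrow> (\<forall>r. v r \<ge> 0)"

lemma act_root: "w \<in> carrier G \<Longrightarrow> \<alpha> \<in> roots \<Longrightarrow> act w \<alpha> \<in> roots"
proof -
  assume w: "w \<in> carrier G" and "\<alpha> \<in> roots"
  then obtain x s where x: "x \<in> carrier G" "s \<in> S" "\<alpha> = act x (simple_root s)" unfolding roots_def by blast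
  then have "act w \<alpha> = act (w \<otimes> x) (simple_root s)" using act_mult[OF w] by simp
  then show ?thesis using x w unfolding roots_def by blast
qed

lemma simple_root_in: "s \<in> S \<Longrightarrow> simple_root s \<in> roots"
  unfolding roots_def by (intro CollectI exI[of _ "\<one>"] exI[of _ s]) (simp add: act_one)

lemma root_sign:
  assumes "\<alpha> \<in> roots" shows "pos \<alpha> \<or> (\<forall>r. \<alpha> r \<le> 0)"
proof -
  obtain w s where "w \<in> carrier G" "s \<in> S" "\<alpha> = act w (simple_root s)" using assms unfolding roots_def by blast
  then show ?thesis using ascent_nonneg[of w s] descent_nonpos[of w s] unfolding pos_def by blast
qed

lemma root_nonzero: "\<alpha> \<in> roots \<Longrightarrow> \<exists>r. \<alpha> r \<noteq> 0"
proof (rule ccontr)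
  assume "\<alpha> \<in> roots" and "\<nexists>r. \<alpha> r \<noteq> 0"
  then obtain w s where w: "w \<in> carrier G" "act w (simple_root s) = (\<lambda>_. 0)" unfolding roots_def by auto
  then have "simple_root s = (\<lambda>_. 0)" using act_inv_act[OF w(1), of "simple_root s"] act_zero by simp
  then have "simple_root s s = 0" by metis
  then show False by (simp add: simple_root_def)
qed

lemma neg_root: "\<alpha> \<in> roots \<Longrightarrow> (\<lambda>r. - \<alpha> r) \<in> roots"
proof -
  assume "\<alpha> \<in> roots"
  then obtain w s where w: "w \<in> carrier G" "s \<in> S" "\<alpha> = act w (simple_root s)" unfolding roots_def by blast
  have "act s (simple_root s) = (\<lambda>r. - simple_root s r)" by (simp add: act_gen w refl_simple)
  then have "(\<lambda>r. - \<alpha> r) = act w (act s (simple_root s))" using act_neg w by simp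
  moreover have "act s (simple_root s) \<in> roots" using act_root simple_root_in w(2) S_carrier by blast
  ultimately show ?thesis using act_root[OF w(1)] by simp
qed

lemma pos_neg: "\<alpha> \<in> roots \<Longrightarrow> pos (\<lambda>r. - \<alpha> r) \<longleftrightarrow> \<not> pos \<alpha>"
proof -
  assume \<alpha>: "\<alpha> \<in> roots"
  obtain r where r: "\<alpha> r \<noteq> 0" using root_nonzero[OF \<alpha>] by blast
  have "\<not> ((\<forall>r. - \<alpha> r \<ge> 0) \<and> (\<forall>r. \<alpha> r \<ge> 0))"
  proof
    assume "(\<forall>r. - \<alpha> r \<ge> 0) \<and> (\<forall>r. \<alpha> r \<ge> 0)"
    then have "- \<alpha> r \<ge> 0" "\<alpha> r \<ge> 0" by blast+
    then show False using r by simp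
  qed
  moreover have "(\<forall>r. - \<alpha> r \<ge> 0) \<or> (\<forall>r. \<alpha> r \<ge> 0)" using root_sign[OF \<alpha>] unfolding pos_def by auto
  ultimately show ?thesis unfolding pos_def by blast
qed

lemma word_act_support: "set ss \<subseteq> S \<Longrightarrow> r \<notin> S \<Longrightarrow> word_act ss v r = v r"
  by (induction ss) (auto simp: refl_def simple_root_def)

lemma act_support: "w \<in> carrier G \<Longrightarrow> r \<notin> S \<Longrightarrow> act w v r = v r"
proof -
  assume w: "w \<in> carrier G" and r: "r \<notin> S"
  obtain ss where "ss \<in> lists S" "w = lprod G ss" using word_exists[OF w] by blast
  then show ?thesis using word_act_support[of ss r v] r by (auto simp: act_word)
qed

lemma root_supp: "\<alpha> \<in> roots \<Longrightarrow> r \<notin> S \<Longrightarrow> \<alpha> r = 0"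
  unfolding roots_def using act_support by (auto simp: simple_root_def)

lemma root_norm: "\<alpha> \<in> roots \<Longrightarrow> form \<alpha> \<alpha> = 1"
proof -
  assume "\<alpha> \<in> roots"
  then obtain w s where w: "w \<in> carrier G" "s \<in> S" "\<alpha> = act w (simple_root s)" unfolding roots_def by blast
  obtain ss where ss: "ss \<in> lists S" "w = lprod G ss" using word_exists[OF w(1)] by blast
  have "form (word_act xs v) (word_act xs v) = form v v" if "set xs \<subseteq> S" for xs v
    using that by (induction xs) (auto simp: form_refl)
  then have "form \<alpha> \<alpha> = form (simple_root s) (simple_root s)"
    unfolding w(3) ss(2) act_word[OF ss(1)] using ss(1) by auto
  then show ?thesis using form_simple[OF w(2), of 1] by simp
qed

text \<open>A reflection alters a single coordinate. A positive root other than \<open>simple_root s\<close> has a positive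
  coordinate elsewhere, which survives, and a single positive coordinate determines the sign of a root.\<close>

lemma refl_pos:
  assumes s: "s \<in> S" and \<alpha>: "\<alpha> \<in> roots" "pos \<alpha>" "\<alpha> \<noteq> simple_root s"
  shows "pos (refl s \<alpha>)"
proof (cases "\<exists>r. r \<noteq> s \<and> \<alpha> r \<noteq> 0")
  case True
  then obtain r where r0: "r \<noteq> s" "\<alpha> r \<noteq> 0" by blast
  moreover have "\<alpha> r \<ge> 0" using \<alpha>(2) unfolding pos_def by blast
  ultimately have r: "r \<noteq> s" "\<alpha> r > 0" by auto
  then have "refl s \<alpha> r > 0" by (simp add: refl_def simple_root_def)
  moreover have "refl s \<alpha> \<in> roots" using act_root[of s \<alpha>] act_gen[OF s] s S_carrier \<alpha>(1) by auto
  ultimately show ?thesis using root_sign[of "refl s \<alpha>"] by (meson not_less)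
next
  case False
  then have eq: "\<alpha> = (\<lambda>r. \<alpha> s * simple_root s r)" by (intro ext) (auto simp: simple_root_def)
  have "\<alpha> s * \<alpha> s = 1" using root_norm[OF \<alpha>(1)] form_simple[OF s, of "\<alpha> s"] eq by simp
  moreover have "\<alpha> s \<ge> 0" using \<alpha>(2) unfolding pos_def by blast
  ultimately have "\<alpha> s = 1" using square_eq_1_iff[of "\<alpha> s"] by auto
  then have "\<alpha> = simple_root s" using eq by simp
  then show ?thesis using \<alpha>(3) by blast
qed

lemma refl_root: "s \<in> S \<Longrightarrow> \<alpha> \<in> roots \<Longrightarrow> refl s \<alpha> \<in> roots"
  using act_root[of s \<alpha>] act_gen[of s] S_carrier by auto

lemma refl_sign_changes:
  assumes s: "s \<in> S"
  shows "{\<alpha> \<in> roots. pos \<alpha> \<noteq> pos (refl s \<alpha>)} \<subseteq> {simple_root s, \<lambda>r. - simple_root s r}"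
proof
  fix \<alpha> assume "\<alpha> \<in> {\<alpha> \<in> roots. pos \<alpha> \<noteq> pos (refl s \<alpha>)}"
  then have \<alpha>: "\<alpha> \<in> roots" "pos \<alpha> \<noteq> pos (refl s \<alpha>)" by auto
  show "\<alpha> \<in> {simple_root s, \<lambda>r. - simple_root s r}"
  proof (cases "pos \<alpha>")
    case True
    then show ?thesis using refl_pos[OF s \<alpha>(1)] \<alpha>(2) by blast
  next
    case False
    let ?\<beta> = "\<lambda>r. - \<alpha> r"
    have \<beta>: "?\<beta> \<in> roots" "pos ?\<beta>" using neg_root[OF \<alpha>(1)] pos_neg[OF \<alpha>(1)] False by auto
    have "refl s ?\<beta> = (\<lambda>r. - refl s \<alpha> r)" using refl_lin[of s "- 1" \<alpha> 0 \<alpha>] by simp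
    then have "\<not> pos (refl s ?\<beta>)" using pos_neg[OF refl_root[OF s \<alpha>(1)]] \<alpha>(2) False by simp
    then have b: "?\<beta> = simple_root s" using refl_pos[OF s \<beta>] by blast
    have "\<alpha> = (\<lambda>r. - simple_root s r)" unfolding b[symmetric] by simp
    then show ?thesis by blast
  qed
qed

lemma finite_sign_changes_act:
  assumes "w \<in> carrier G" shows "finite {\<alpha> \<in> roots. pos \<alpha> \<noteq> pos (act w \<alpha>)}"
proof -
  obtain ss where ss: "ss \<in> lists S" "w = lprod G ss" using word_exists[OF assms] by blast
  have "finite {\<alpha> \<in> roots. pos \<alpha> \<noteq> pos (word_act xs \<alpha>)} \<and> (\<forall>\<alpha>\<in>roots. word_act xs \<alpha> \<in> roots) \<and> inj_on (word_act xs) roots"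
    if "set xs \<subseteq> S" for xs
    using that
  proof (induction xs)
    case (Cons s xs)
    then have s: "s \<in> S" and IH: "finite {\<alpha> \<in> roots. pos \<alpha> \<noteq> pos (word_act xs \<alpha>)}"
      "\<And>\<alpha>. \<alpha> \<in> roots \<Longrightarrow> word_act xs \<alpha> \<in> roots" "inj_on (word_act xs) roots" by auto
    let ?F = "{\<alpha> \<in> roots. pos \<alpha> \<noteq> pos (refl s \<alpha>)}"
    have "finite ?F" using refl_sign_changes[OF s] finite_subset by blast
    then have f2: "finite (word_act xs -` ?F \<inter> roots)" by (rule finite_vimage_IntI[OF _ IH(3)])
    have "{\<alpha> \<in> roots. pos \<alpha> \<noteq> pos (word_act (s # xs) \<alpha>)} \<subseteq>
        {\<alpha> \<in> roots. pos \<alpha> \<noteq> pos (word_act xs \<alpha>)} \<union> (word_act xs -` ?F \<inter> roots)"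
      using IH(2) by auto
    then have "finite {\<alpha> \<in> roots. pos \<alpha> \<noteq> pos (word_act (s # xs) \<alpha>)}"
      using IH(1) f2 finite_subset by blast
    moreover have "\<forall>\<alpha>\<in>roots. word_act (s # xs) \<alpha> \<in> roots" using IH(2) refl_root[OF s] by simp
    moreover have "inj_on (word_act (s # xs)) roots"
    proof (rule inj_onI)
      fix x y assume "x \<in> roots" "y \<in> roots" "word_act (s # xs) x = word_act (s # xs) y"
      then have xy: "x \<in> roots" "y \<in> roots" "refl s (word_act xs x) = refl s (word_act xs y)" by auto
      from arg_cong[OF xy(3), of "refl s"] have "word_act xs x = word_act xs y"
        unfolding refl_refl[OF s] .
      then show "x = y" using inj_onD[OF IH(3) _ xy(1,2)] by blast
    qed
    ultimately show ?case by blast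
  qed (simp add: inj_on_def)
  then have "finite {\<alpha> \<in> roots. pos \<alpha> \<noteq> pos (word_act ss \<alpha>)}" using ss(1) by auto
  then show ?thesis unfolding ss(2) act_word[OF ss(1)] .
qed

lemma faithful:
  assumes w: "w \<in> carrier G" and fixed: "\<And>s. s \<in> S \<Longrightarrow> act w (simple_root s) = simple_root s"
  shows "w = \<one>"
proof (rule ccontr)
  assume "w \<noteq> \<one>"
  then obtain s where s: "s \<in> S" "wlen (w \<otimes> s) < wlen w" using descent_exists[OF w] by blast
  then have "simple_root s s \<le> 0" using descent_nonpos[OF w s] fixed[OF s(1)] by simp
  then show False by (simp add: simple_root_def)
qed

definition inversions :: "'a \<Rightarrow> ('a \<Rightarrow> real) set" where
  "inversions w = {\<alpha> \<in> roots. pos \<alpha> \<and> \<not> pos (act w \<alpha>)}"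

lemma finite_inversions: "w \<in> carrier G \<Longrightarrow> finite (inversions w)"
  by (rule finite_subset[OF _ finite_sign_changes_act[of w]]) (auto simp: inversions_def)

lemma card_inversions_descent:
  assumes w: "w \<in> carrier G" and s: "s \<in> S" and d: "wlen (w \<otimes> s) < wlen w"
  shows "card (inversions (w \<otimes> s)) < card (inversions w)"
proof -
  have sc: "s \<in> carrier G" using s S_carrier by blast
  have ss: "act s (simple_root s) = (\<lambda>r. - simple_root s r)" by (simp add: act_gen s refl_simple)
  have neg: "\<not> pos (act w (simple_root s))"
  proof -
    have "act w (simple_root s) \<in> roots" using act_root[OF w simple_root_in[OF s]] .
    moreover have "pos (\<lambda>r. - act w (simple_root s) r)" using descent_nonpos[OF w s d] unfolding pos_def by simp
    ultimately show ?thesis using pos_neg by blast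
  qed
  have simple_pos: "pos (simple_root s)" by (simp add: pos_def simple_root_def)
  have ws: "act (w \<otimes> s) v = act w (refl s v)" for v using act_mult[OF w sc] act_gen[OF s] by simp
  have sub: "refl s ` inversions (w \<otimes> s) \<subseteq> inversions w - {simple_root s}"
  proof
    fix \<beta> assume "\<beta> \<in> refl s ` inversions (w \<otimes> s)"
    then obtain \<alpha> where \<alpha>: "\<beta> = refl s \<alpha>" "\<alpha> \<in> roots" "pos \<alpha>" "\<not> pos (act w (refl s \<alpha>))"
      unfolding inversions_def ws by blast
    have "\<alpha> \<noteq> simple_root s"
    proof
      assume "\<alpha> = simple_root s"
      then have "act w (refl s \<alpha>) = (\<lambda>r. - act w (simple_root s) r)"
        using ss act_gen[OF s] act_neg[OF w] by simp
      then show False using \<alpha>(4) neg pos_neg[OF act_root[OF w simple_root_in[OF s]]] by simp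
    qed
    then have p: "pos (refl s \<alpha>)" by (rule refl_pos[OF s \<alpha>(2,3)])
    have "refl s \<alpha> \<noteq> simple_root s"
    proof
      assume "refl s \<alpha> = simple_root s"
      then have "\<alpha> = (\<lambda>r. - simple_root s r)" using refl_refl[OF s, of \<alpha>] ss act_gen[OF s] by simp
      then show False using \<alpha>(3) pos_neg[OF simple_root_in[OF s]] simple_pos by simp
    qed
    then show "\<beta> \<in> inversions w - {simple_root s}"
      using p \<alpha> refl_root[OF s \<alpha>(2)] unfolding inversions_def by simp
  qed
  have inj: "inj_on (refl s) (inversions (w \<otimes> s))"
    by (rule inj_on_inverseI[of _ "refl s"]) (rule refl_refl[OF s])
  have "simple_root s \<in> inversions w" using neg simple_pos simple_root_in[OF s] unfolding inversions_def by blast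
  then have "card (inversions w - {simple_root s}) < card (inversions w)"
    using finite_inversions[OF w] by (intro psubset_card_mono) auto
  moreover have "card (inversions (w \<otimes> s)) \<le> card (inversions w - {simple_root s})"
    using card_inj_on_le[OF inj sub] finite_inversions[OF w] by simp
  ultimately show ?thesis by simp
qed

text \<open>Multiplying by a descent removes at least one inversion, so every element is a product of at most as
  many generators as it has inversions. Therefore only finitely many elements have a bounded number of inversions.\<close>

lemma wlen_le_card_inversions:
  "w \<in> carrier G \<Longrightarrow> \<exists>ss\<in>lists S. length ss \<le> card (inversions w) \<and> lprod G ss = w"
proof (induction "card (inversions w)" arbitrary: w rule: less_induct)
  case less
  show ?case
  proof (cases "w = \<one>")
    case True
    then show ?thesis by (intro bexI[of _ "[]"]) auto
  next
    case False
    obtain s where s: "s \<in> S" "wlen (w \<otimes> s) < wlen w" using descent_exists[OF less.prems False] by blast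
    have sc: "s \<in> carrier G" using s S_carrier by blast
    have lt: "card (inversions (w \<otimes> s)) < card (inversions w)" by (rule card_inversions_descent[OF less.prems s])
    from less.hyps[OF lt] obtain ss where
      ss: "ss \<in> lists S" "length ss \<le> card (inversions (w \<otimes> s))" "lprod G ss = w \<otimes> s" using less.prems sc by auto
    have "lprod G (ss @ [s]) = w"
      using lprod_S_append[OF ss(1), of "[s]"] ss(3) s(1) sc gen_cancel[OF s(1) less.prems] by simp
    then show ?thesis using ss lt s(1) by (intro bexI[of _ "ss @ [s]"]) auto
  qed
qed

sublocale ra: root_action G act roots pos S
proof unfold_locales
  show "finite S" by (rule finite_S)
  show "\<alpha> s = 0" if "\<alpha> \<in> roots" "s \<notin> S" for \<alpha> s by (rule root_supp[OF that])
  show "act w \<alpha> \<in> roots" if "w \<in> carrier G" "\<alpha> \<in> roots" for w \<alpha> by (rule act_root[OF that])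
  show "act (x \<otimes> y) \<alpha> = act x (act y \<alpha>)" if "x \<in> carrier G" "y \<in> carrier G" for x y \<alpha> by (rule act_mult[OF that])
  show "act \<one> \<alpha> = \<alpha>" for \<alpha> by (rule act_one)
  show "(\<lambda>s. - \<alpha> s) \<in> roots" if "\<alpha> \<in> roots" for \<alpha> by (rule neg_root[OF that])
  show "act w (\<lambda>s. - \<alpha> s) = (\<lambda>s. - act w \<alpha> s)" if "w \<in> carrier G" for w \<alpha> by (rule act_neg[OF that])
  show "pos (\<lambda>s. - \<alpha> s) \<longleftrightarrow> \<not> pos \<alpha>" if "\<alpha> \<in> roots" for \<alpha> by (rule pos_neg[OF that])
  show "finite {\<alpha> \<in> roots. pos \<alpha> \<noteq> pos (act w \<alpha>)}" if "w \<in> carrier G" for w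
    by (rule finite_sign_changes_act[OF that])
  show "finite {w \<in> carrier G. card {\<alpha> \<in> roots. pos \<alpha> \<and> \<not> pos (act w \<alpha>)} \<le> c}" for c
  proof (rule finite_subset)
    show "{w \<in> carrier G. card {\<alpha> \<in> roots. pos \<alpha> \<and> \<not> pos (act w \<alpha>)} \<le> c} \<subseteq>
        lprod G ` {ss. set ss \<subseteq> S \<and> length ss \<le> c}"
    proof
      fix w assume "w \<in> {w \<in> carrier G. card {\<alpha> \<in> roots. pos \<alpha> \<and> \<not> pos (act w \<alpha>)} \<le> c}"
      then have w: "w \<in> carrier G" "card (inversions w) \<le> c" unfolding inversions_def by auto
      from wlen_le_card_inversions[OF w(1)] obtain ss where "ss \<in> lists S" "length ss \<le> c" "lprod G ss = w"
        using w(2) le_trans by blast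
      then show "w \<in> lprod G ` {ss. set ss \<subseteq> S \<and> length ss \<le> c}" by force
    qed
    show "finite (lprod G ` {ss. set ss \<subseteq> S \<and> length ss \<le> c})"
      using finite_lists_length_le[OF finite_S] by blast
  qed
  show "(\<Sum>i\<in>I. c i * act w (\<alpha> i) s) = 0"
    if w: "w \<in> carrier G" and I: "finite I" "\<And>i. i \<in> I \<Longrightarrow> \<alpha> i \<in> roots"
      and rel: "\<And>s. s \<in> S \<Longrightarrow> (\<Sum>i\<in>I. c i * \<alpha> i s) = 0" and s: "s \<in> S"
    for w and \<alpha> :: "nat \<Rightarrow> 'a \<Rightarrow> real" and c I s
  proof -
    have "(\<Sum>i\<in>I. c i * \<alpha> i r) = 0" for r
    proof (cases "r \<in> S")
      case False
      have "c i * \<alpha> i r = 0" if "i \<in> I" for i using root_supp[OF I(2)[OF that] False] by simp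
      then show ?thesis by (rule sum.neutral[OF ballI])
    qed (rule rel)
    then have "act w (\<lambda>r. \<Sum>i\<in>I. c i * \<alpha> i r) = (\<lambda>_. 0)" using act_zero[OF w] by simp
    then show ?thesis unfolding act_comb[OF w] by metis
  qed
qed

end

section \<open>Finitely generated rings of real numbers\<close>

definition int_span :: "real set \<Rightarrow> real set" where
  "int_span T = range (\<lambda>u :: real \<Rightarrow> int. \<Sum>g\<in>T. of_int (u g) * g)"

lemma int_span_zero: "0 \<in> int_span T"
  unfolding int_span_def by (rule image_eqI[of _ _ "\<lambda>_. 0"]) auto

lemma int_span_add: "x \<in> int_span T \<Longrightarrow> y \<in> int_span T \<Longrightarrow> x + y \<in> int_span T"
  unfolding int_span_def
proof (elim imageE)
  fix u v :: "real \<Rightarrow> int"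
  assume "x = (\<Sum>g\<in>T. of_int (u g) * g)" "y = (\<Sum>g\<in>T. of_int (v g) * g)"
  then show "x + y \<in> range (\<lambda>u :: real \<Rightarrow> int. \<Sum>g\<in>T. of_int (u g) * g)"
    by (intro image_eqI[of _ _ "\<lambda>g. u g + v g"]) (auto simp: sum.distrib algebra_simps)
qed

lemma int_span_int_mult: "x \<in> int_span T \<Longrightarrow> of_int k * x \<in> int_span T"
  unfolding int_span_def
proof (elim imageE)
  fix u :: "real \<Rightarrow> int"
  assume "x = (\<Sum>g\<in>T. of_int (u g) * g)"
  then show "of_int k * x \<in> range (\<lambda>u :: real \<Rightarrow> int. \<Sum>g\<in>T. of_int (u g) * g)"
    by (intro image_eqI[of _ _ "\<lambda>g. k * u g"]) (auto simp: sum_distrib_left mult_ac)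
qed

lemma int_span_incl: "finite T \<Longrightarrow> g \<in> T \<Longrightarrow> g \<in> int_span T"
proof -
  assume "finite T" "g \<in> T"
  have "(\<Sum>h\<in>T. of_int (of_bool (h = g)) * h) = (\<Sum>h\<in>T. if h = g then h else 0)"
    by (rule sum.cong) auto
  also have "\<dots> = g" using \<open>finite T\<close> \<open>g \<in> T\<close> by simp
  finally show ?thesis unfolding int_span_def by (intro image_eqI[of _ _ "\<lambda>h. of_bool (h = g)"]) auto
qed

lemma int_span_sum: "(\<And>i. i \<in> I \<Longrightarrow> f i \<in> int_span T) \<Longrightarrow> (\<Sum>i\<in>I. f i) \<in> int_span T"
  by (induction I rule: infinite_finite_induct) (auto simp: int_span_zero int_span_add)

lemma int_span_mult:
  assumes "\<And>g h. g \<in> T \<Longrightarrow> h \<in> T \<Longrightarrow> g * h \<in> int_span T" "x \<in> int_span T" "y \<in> int_span T"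
  shows "x * y \<in> int_span T"
proof -
  obtain u v :: "real \<Rightarrow> int" where x: "x = (\<Sum>g\<in>T. of_int (u g) * g)" and y: "y = (\<Sum>h\<in>T. of_int (v h) * h)"
    using assms(2,3) unfolding int_span_def by blast
  have "x * y = (\<Sum>g\<in>T. \<Sum>h\<in>T. of_int (u g * v h) * (g * h))"
    unfolding x y by (simp add: sum_product mult_ac)
  also have "\<dots> \<in> int_span T" by (intro int_span_sum int_span_int_mult assms(1))
  finally show ?thesis .
qed

lemma int_span_residues:
  assumes "finite T" "n > 0"
  obtains f :: "real \<Rightarrow> real \<Rightarrow> int" where "finite (f ` int_span T)"
    "\<And>x y. x \<in> int_span T \<Longrightarrow> y \<in> int_span T \<Longrightarrow> f x = f y \<Longrightarrow> \<exists>z\<in>int_span T. x = y + of_nat n * z"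
proof -
  define c where "c x = (SOME u :: real \<Rightarrow> int. x = (\<Sum>g\<in>T. of_int (u g) * g))" for x
  have c: "x = (\<Sum>g\<in>T. of_int (c x g) * g)" if "x \<in> int_span T" for x
    using someI_ex[of "\<lambda>u :: real \<Rightarrow> int. x = (\<Sum>g\<in>T. of_int (u g) * g)"] that
    unfolding c_def int_span_def by blast
  define f where "f x = (\<lambda>g\<in>T. c x g mod int n)" for x
  have "f ` int_span T \<subseteq> (\<Pi>\<^sub>E g\<in>T. {0..<int n})"
    using assms(2) by (auto simp: f_def)
  moreover have "finite (\<Pi>\<^sub>E g\<in>T. {0..<int n})" using assms(1) by (intro finite_PiE) auto
  ultimately have fin: "finite (f ` int_span T)" using finite_subset by blast
  show thesis
  proof (rule that[OF fin])
    fix x y assume x: "x \<in> int_span T" and y: "y \<in> int_span T" and eq: "f x = f y"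
    have "c x g = c y g + int n * ((c x g - c y g) div int n)" if "g \<in> T" for g
    proof -
      have "c x g mod int n = c y g mod int n" using fun_cong[OF eq, of g] that by (simp add: f_def)
      then have "int n dvd c x g - c y g" by (simp add: mod_eq_dvd_iff)
      then show ?thesis by simp
    qed
    then have "x = (\<Sum>g\<in>T. of_int (c y g + int n * ((c x g - c y g) div int n)) * g)"
      by (subst c[OF x]) (auto intro!: sum.cong)
    also have "\<dots> = (\<Sum>g\<in>T. of_int (c y g) * g) + of_nat n * (\<Sum>g\<in>T. of_int ((c x g - c y g) div int n) * g)"
      by (simp add: sum.distrib sum_distrib_left algebra_simps)
    also have "(\<Sum>g\<in>T. of_int (c y g) * g) = y" by (rule c[OF y, symmetric])
    finally have "x = y + of_nat n * (\<Sum>g\<in>T. of_int ((c x g - c y g) div int n) * g)" .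
    moreover have "(\<Sum>g\<in>T. of_int ((c x g - c y g) div int n) * g) \<in> int_span T"
      unfolding int_span_def by (rule image_eqI[of _ _ "\<lambda>g. (c x g - c y g) div int n"]) auto
    ultimately show "\<exists>z\<in>int_span T. x = y + of_nat n * z" by blast
  qed
qed

text \<open>A linear form on \<open>\<real>\<close> as a vector space over the rational numbers.\<close>

lemma rational_functional:
  fixes x :: real assumes "x \<noteq> 0"
  shows "\<exists>L :: real \<Rightarrow> rat. (\<forall>a b. L (a + b) = L a + L b) \<and> (\<forall>q a. L (of_rat q * a) = q * L a) \<and> L x = 1"
proof -
  interpret V: vector_space_pair "\<lambda>(q::rat) (x::real). of_rat q * x" "\<lambda>(q::rat) x. q * x"
    by unfold_locales (auto simp: algebra_simps of_rat_add of_rat_mult)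
  have "V.vs1.independent {x}" using assms by (simp add: V.vs1.dependent_single)
  from V.linear_independent_extend[OF this, of "\<lambda>_. 1"] obtain L where
    L: "Vector_Spaces.linear (\<lambda>(q::rat) (x::real). of_rat q * x) (\<lambda>(q::rat) x. q * x) L" "L x = 1" by auto
  then show ?thesis
    using V.linear_add[OF L(1)] V.linear_scale[OF L(1)] by blast
qed

lemma common_denominator:
  fixes L :: "real \<Rightarrow> rat"
  assumes "finite T"
  obtains d :: int where "d > 0" "\<And>g. g \<in> T \<Longrightarrow> of_int d * L g \<in> \<int>"
proof -
  have "\<exists>d::int. d > 0 \<and> (\<forall>g\<in>T. of_int d * L g \<in> \<int>)" using assms
  proof (induction T rule: finite_induct)
    case (insert g T)
    then obtain d :: int where d: "d > 0" "\<forall>g\<in>T. of_int d * L g \<in> \<int>" by blast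
    obtain a b where ab: "L g = of_int a / of_int b" "b > 0" by (metis Fract_of_int_quotient Rat_cases)
    have "of_int (d * b) * L g = of_int (d * a)" using ab by simp
    moreover have "of_int (d * b) * L h \<in> \<int>" if "h \<in> T" for h
    proof -
      have "of_int (d * b) * L h = of_int b * (of_int d * L h)" by simp
      also have "\<dots> \<in> \<int>" by (rule Ints_mult) (use d(2) that in auto)
      finally show ?thesis .
    qed
    ultimately have "\<forall>h\<in>insert g T. of_int (d * b) * L h \<in> \<int>" by (metis Ints_of_int insertE)
    then show ?case using d(1) ab(2) by (intro exI[of _ "d * b"]) auto
  qed (auto intro: exI[of _ 1])
  then show thesis using that by blast
qed

text \<open>A rational linear form \<open>L\<close> with \<open>L x = 1\<close> has bounded denominator \<open>d\<close> on the finitely generated group;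
  if \<open>x\<close> were divisible by all powers of \<open>n\<close>, then so would be the positive integer \<open>d\<close>.\<close>

lemma int_span_separated:
  assumes T: "finite T" and n: "n \<ge> 2" and div: "\<And>k. \<exists>y\<in>int_span T. x = of_nat (n ^ k) * y"
  shows "x = 0"
proof (rule ccontr)
  assume nz: "x \<noteq> 0"
  obtain L :: "real \<Rightarrow> rat" where L: "\<And>a b. L (a + b) = L a + L b" "\<And>q a. L (of_rat q * a) = q * L a" "L x = 1"
    using rational_functional[OF nz] by blast
  have Lint: "L (of_int k * a) = of_int k * L a" for k a using L(2)[of "of_int k" a] by simp
  have Lsum: "L (\<Sum>g\<in>A. f g) = (\<Sum>g\<in>A. L (f g))" if "finite A" for A and f :: "real \<Rightarrow> real"
    using that L(2)[of 0 0] by (induction A rule: finite_induct) (auto simp: L(1))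
  obtain d :: int where d: "d > 0" "\<And>g. g \<in> T \<Longrightarrow> of_int d * L g \<in> \<int>" using common_denominator[OF T, of L] by blast
  have dL: "of_int d * L y \<in> \<int>" if "y \<in> int_span T" for y
  proof -
    obtain u :: "real \<Rightarrow> int" where y: "y = (\<Sum>g\<in>T. of_int (u g) * g)" using \<open>y \<in> int_span T\<close> unfolding int_span_def by blast
    have "of_int d * L y = (\<Sum>g\<in>T. of_int (u g) * (of_int d * L g))"
      unfolding y Lsum[OF T] Lint by (simp add: sum_distrib_left mult_ac)
    also have "\<dots> \<in> \<int>" by (rule Ints_sum, rule Ints_mult) (simp_all add: d(2))
    finally show ?thesis .
  qed
  define k where "k = nat d"
  obtain y where y: "y \<in> int_span T" "x = of_nat (n ^ k) * y" using div by blast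
  obtain z where z: "of_int d * L y = of_int z" using dL[OF y(1)] by (auto elim: Ints_cases)
  have "x = of_int (int n ^ k) * y" using y(2) by simp
  then have "1 = of_int (int n ^ k) * L y" using L(3) Lint[of "int n ^ k" y] by metis
  then have "of_int d = of_int (int n ^ k) * (of_int d * L y)" by (metis mult.left_commute mult.right_neutral)
  then have "(of_int d :: rat) = of_int (int n ^ k * z)" unfolding z by simp
  then have dz: "d = int n ^ k * z" by (simp only: of_int_eq_iff)
  then have "int n ^ k dvd d" by simp
  then have "int n ^ k \<le> d" using d(1) by (rule zdvd_imp_le)
  moreover have "int k < int n ^ k"
  proof -
    have "k < 2 ^ k" by (rule less_exp)
    also have "(2::nat) ^ k \<le> n ^ k" using n by (rule power_mono) simp
    finally show ?thesis by (metis of_nat_less_iff of_nat_power)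
  qed
  ultimately show False using d(1) by (simp add: k_def)
qed

text \<open>By the addition theorem a product of two numbers \<open>2 cos (i \<pi> / q)\<close> is the sum of two such numbers, so
  these generators and \<open>1\<close> span a ring. For a common multiple \<open>q\<close> of the finite entries of the Coxeter
  matrix this ring contains all matrix entries of the simple reflections.\<close>

definition cos_generators :: "nat \<Rightarrow> real set" where
  "cos_generators q = insert 1 ((\<lambda>j. 2 * cos (real j * pi / real q)) ` {..<2 * q})"

lemma cos_in_span:
  assumes q: "q > 0" shows "2 * cos (of_int j * pi / real q) \<in> int_span (cos_generators q)"
proof -
  let ?r = "nat (j mod int (2 * q))"
  have pos: "int (2 * q) > 0" using q by simp
  have r: "int ?r = j mod int (2 * q)" "?r < 2 * q" using pos by (auto simp: nat_less_iff)
  have "of_int j = real ?r + real_of_int (int (2 * q) * (j div int (2 * q)))"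
  proof -
    have "j = int ?r + int (2 * q) * (j div int (2 * q))" unfolding r(1) by simp
    then show ?thesis by (metis of_int_add of_int_of_nat_eq)
  qed
  then have e: "of_int j * pi / real q = real ?r * pi / real q + 2 * pi * of_int (j div int (2 * q))"
    using q by (simp add: field_simps)
  have "cos (of_int j * pi / real q) = cos (real ?r * pi / real q)"
    unfolding e using cos_int_2pin[of "j div int (2 * q)"] sin_int_2pin[of "j div int (2 * q)"]
    by (simp only: cos_add)
  then have "2 * cos (of_int j * pi / real q) \<in> cos_generators q"
    unfolding cos_generators_def using r(2)
    by (intro insertI2 image_eqI[of _ _ ?r]) (simp_all only: lessThan_iff)
  then show ?thesis by (intro int_span_incl) (auto simp: cos_generators_def)
qed

lemma cos_generators_mult:
  assumes q: "q > 0" and g: "g \<in> cos_generators q" and h: "h \<in> cos_generators q"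
  shows "g * h \<in> int_span (cos_generators q)"
proof -
  have fin: "finite (cos_generators q)" by (simp add: cos_generators_def)
  consider "g = 1" | "h = 1" | i j where "g = 2 * cos (real i * pi / real q)" "h = 2 * cos (real j * pi / real q)"
    using g h unfolding cos_generators_def by auto
  then show ?thesis
  proof cases
    case 3
    have e: "of_int (int i + int j) * pi / real q = real i * pi / real q + real j * pi / real q"
      "of_int (int i - int j) * pi / real q = real i * pi / real q - real j * pi / real q"
      by (simp_all add: add_divide_distrib diff_divide_distrib distrib_right left_diff_distrib)
    have "g * h = 2 * cos (of_int (int i + int j) * pi / real q) + 2 * cos (of_int (int i - int j) * pi / real q)"
      unfolding 3 e cos_add cos_diff by simp
    then show ?thesis using int_span_add[OF cos_in_span[OF q] cos_in_span[OF q]] by metis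
  qed (use g h int_span_incl[OF fin] in auto)
qed

lemma (in coxeter_matrix_on) integral_form:
  obtains T where "finite T" "1 \<in> int_span T" "\<And>x y. x \<in> int_span T \<Longrightarrow> y \<in> int_span T \<Longrightarrow> x * y \<in> int_span T"
    "\<And>s t. s \<in> S \<Longrightarrow> t \<in> S \<Longrightarrow> 2 * cox_form M s t \<in> int_span T"
proof -
  define e where "e p = (case M (fst p) (snd p) of enat k \<Rightarrow> max k 1 | \<infinity> \<Rightarrow> 1)" for p
  define q where "q = (\<Prod>p\<in>S \<times> S. e p)"
  have q: "q > 0" unfolding q_def by (intro prod_pos) (auto simp: e_def split: enat.splits)
  let ?T = "cos_generators q"
  have fin: "finite ?T" by (simp add: cos_generators_def)
  have one: "1 \<in> int_span ?T" by (rule int_span_incl[OF fin]) (simp add: cos_generators_def)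
  have two: "2 \<in> int_span ?T" using int_span_add[OF one one] by simp
  show thesis
  proof (rule that[of ?T])
    show "x * y \<in> int_span ?T" if "x \<in> int_span ?T" "y \<in> int_span ?T" for x y
      by (rule int_span_mult[OF cos_generators_mult[OF q] that])
    fix s t assume st: "s \<in> S" "t \<in> S"
    show "2 * cox_form M s t \<in> int_span ?T"
    proof (cases "s = t")
      case True
      then show ?thesis using two by simp
    next
      case False
      show ?thesis
      proof (cases "M s t")
        case (enat k)
        have "2 \<le> M s t" using matrix st False unfolding coxeter_matrix_def by blast
        then have k2: "k \<ge> 2" using enat by (simp add: numeral_eq_enat)
        then have "e (s, t) = k" using enat by (simp add: e_def)
        moreover have "e (s, t) dvd q" unfolding q_def using st finite_S by (intro dvd_prodI) auto
        ultimately obtain l where l: "q = k * l" by (auto simp: dvd_def)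
        have "of_int (int l) * pi / real q = pi / real k" using l q by simp
        then have "2 * cos (pi / real k) \<in> int_span ?T" using cos_in_span[OF q, of "int l"] by simp
        from int_span_int_mult[OF this, of "- 1"] show ?thesis using False enat by (simp add: cox_form_def)
      next
        case infinity
        then show ?thesis using int_span_int_mult[OF two, of "- 1"] False by (simp add: cox_form_def)
      qed
    qed
  qed (rule fin one)+
qed

section \<open>Congruence subgroups are torsion-free\<close>

locale coxeter_lattice = coxeter_presentation +
  fixes T :: "real set"
  assumes finite_T: "finite T" and one_T: "1 \<in> int_span T"
    and mult_T: "\<And>x y. x \<in> int_span T \<Longrightarrow> y \<in> int_span T \<Longrightarrow> x * y \<in> int_span T"
    and form_T: "\<And>s t. s \<in> S \<Longrightarrow> t \<in> S \<Longrightarrow> 2 * cox_form M s t \<in> int_span T"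
begin

definition lattice :: "('a \<Rightarrow> real) set" where
  "lattice = {v. (\<forall>r\<in>S. v r \<in> int_span T) \<and> (\<forall>r. r \<notin> S \<longrightarrow> v r = 0)}"

lemma int_T: "of_int k \<in> int_span T"
  using int_span_int_mult[OF one_T, of k] by simp

lemma nat_T: "real k \<in> int_span T"
  using int_T[of "int k"] by simp

lemma lattice_lin:
  assumes "a \<in> int_span T" "b \<in> int_span T" "u \<in> lattice" "v \<in> lattice"
  shows "(\<lambda>r. a * u r + b * v r) \<in> lattice"
  using assms unfolding lattice_def by (auto intro!: int_span_add mult_T)

lemma simple_root_lattice: "s \<in> S \<Longrightarrow> simple_root s \<in> lattice"
  unfolding lattice_def using one_T int_span_zero by (auto simp: simple_root_def of_bool_def)

lemma refl_lattice: "s \<in> S \<Longrightarrow> v \<in> lattice \<Longrightarrow> refl s v \<in> lattice"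
proof -
  assume s: "s \<in> S" and v: "v \<in> lattice"
  have "2 * pairing s v = (\<Sum>t\<in>S. (2 * cox_form M s t) * v t)"
    unfolding pairing_def by (simp add: sum_distrib_left mult_ac)
  also have "\<dots> \<in> int_span T"
    by (rule int_span_sum, rule mult_T) (use form_T s v in \<open>auto simp: lattice_def\<close>)
  finally have p: "- (2 * pairing s v) \<in> int_span T" using int_span_int_mult[of _ T "- 1"] by force
  have "refl s v = (\<lambda>r. 1 * v r + (- (2 * pairing s v)) * simple_root s r)" by (simp add: refl_def)
  then show ?thesis using lattice_lin[OF one_T p v simple_root_lattice[OF s]] by simp
qed

lemma act_lattice: "w \<in> carrier G \<Longrightarrow> v \<in> lattice \<Longrightarrow> act w v \<in> lattice"
proof -
  assume w: "w \<in> carrier G" and v: "v \<in> lattice"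
  obtain ss where ss: "ss \<in> lists S" "w = lprod G ss" using word_exists[OF w] by blast
  have "word_act xs v \<in> lattice" if "set xs \<subseteq> S" for xs
    using that by (induction xs) (auto simp: v refl_lattice)
  then show ?thesis unfolding ss(2) act_word[OF ss(1)] using ss(1) by auto
qed

definition congruent_to_one :: "nat \<Rightarrow> 'a \<Rightarrow> bool" where
  "congruent_to_one n w \<longleftrightarrow> w \<in> carrier G \<and>
     (\<forall>v\<in>lattice. \<exists>u\<in>lattice. act w v = (\<lambda>r. 1 * v r + real n * u r))"

definition congruence_subgroup :: "nat \<Rightarrow> 'a set" where
  "congruence_subgroup n = {w. congruent_to_one n w}"

lemma congruence_subgroup_subgroup: "subgroup (congruence_subgroup n) G"
proof (rule subgroupI)
  show "congruence_subgroup n \<subseteq> carrier G" unfolding congruence_subgroup_def congruent_to_one_def by blast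
  have zero: "(\<lambda>_. 0) \<in> lattice" by (simp add: lattice_def int_span_zero)
  have "congruent_to_one n \<one>"
    unfolding congruent_to_one_def using zero by (auto simp: act_one intro!: bexI[of _ "\<lambda>_. 0"])
  then show "congruence_subgroup n \<noteq> {}" unfolding congruence_subgroup_def by blast
next
  fix w assume "w \<in> congruence_subgroup n"
  then have w: "w \<in> carrier G" and c: "\<And>v. v \<in> lattice \<Longrightarrow> \<exists>u\<in>lattice. act w v = (\<lambda>r. 1 * v r + real n * u r)"
    unfolding congruence_subgroup_def congruent_to_one_def by auto
  have iw: "inv w \<in> carrier G" using w by simp
  have "\<exists>u\<in>lattice. act (inv w) v = (\<lambda>r. 1 * v r + real n * u r)" if v: "v \<in> lattice" for v
  proof -
    obtain u where u: "u \<in> lattice" "act w v = (\<lambda>r. 1 * v r + real n * u r)" using c[OF v] by blast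
    have eq: "v = (\<lambda>r. 1 * act (inv w) v r + real n * act (inv w) u r)"
      using act_inv_act[OF w, of v] unfolding u(2) act_lin[OF iw] by simp
    have "act (inv w) v = (\<lambda>r. 1 * v r + real n * ((- 1) * act (inv w) u r + 0 * v r))"
      (is "_ = (\<lambda>r. 1 * v r + real n * ?u r)")
    proof
      fix r
      show "act (inv w) v r = 1 * v r + real n * ?u r" using fun_cong[OF eq, of r] by simp
    qed
    moreover have "?u \<in> lattice"
      using int_T[of "- 1"] int_span_zero act_lattice[OF iw u(1)] v by (intro lattice_lin) auto
    ultimately show ?thesis by (intro bexI[of _ ?u])
  qed
  then show "inv w \<in> congruence_subgroup n" using iw unfolding congruence_subgroup_def congruent_to_one_def by blast
next
  fix x y assume "x \<in> congruence_subgroup n" "y \<in> congruence_subgroup n"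
  then have x: "x \<in> carrier G" and cx: "\<And>v. v \<in> lattice \<Longrightarrow> \<exists>u\<in>lattice. act x v = (\<lambda>r. 1 * v r + real n * u r)"
    and y: "y \<in> carrier G" and cy: "\<And>v. v \<in> lattice \<Longrightarrow> \<exists>u\<in>lattice. act y v = (\<lambda>r. 1 * v r + real n * u r)"
    unfolding congruence_subgroup_def congruent_to_one_def by auto
  have "\<exists>u\<in>lattice. act (x \<otimes> y) v = (\<lambda>r. 1 * v r + real n * u r)" if v: "v \<in> lattice" for v
  proof -
    obtain u where u: "u \<in> lattice" "act y v = (\<lambda>r. 1 * v r + real n * u r)" using cy[OF v] by blast
    obtain u' where u': "u' \<in> lattice" "act x v = (\<lambda>r. 1 * v r + real n * u' r)" using cx[OF v] by blast
    have "act (x \<otimes> y) v = (\<lambda>r. 1 * v r + real n * (1 * u' r + 1 * act x u r))"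
      unfolding act_mult[OF x y] u(2) act_lin[OF x] u'(2) by (simp add: algebra_simps)
    moreover have "(\<lambda>r. 1 * u' r + 1 * act x u r) \<in> lattice"
      by (rule lattice_lin[OF one_T one_T u'(1) act_lattice[OF x u(1)]])
    ultimately show ?thesis by (intro bexI[of _ "\<lambda>r. 1 * u' r + 1 * act x u r"])
  qed
  then show "x \<otimes> y \<in> congruence_subgroup n" using x y unfolding congruence_subgroup_def congruent_to_one_def by blast
qed

lemma lattice_expand: "v \<in> lattice \<Longrightarrow> v = (\<lambda>r. \<Sum>s\<in>S. v s * simple_root s r)"
proof
  fix r assume v: "v \<in> lattice"
  have "(\<Sum>s\<in>S. v s * simple_root s r) = (\<Sum>s\<in>S. if s = r then v s else 0)"
    by (rule sum.cong) (auto simp: simple_root_def)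
  then show "v r = (\<Sum>s\<in>S. v s * simple_root s r)" using v finite_S by (auto simp: lattice_def)
qed

text \<open>The residues of the matrix entries take finitely many values. They are taken of the inverse, so
  that equal residues give a right coset.\<close>

lemma congruence_subgroup_fin_index:
  assumes n: "n > 0"
  shows "fin_index G (congruence_subgroup n) (carrier G)"
proof -
  obtain f :: "real \<Rightarrow> real \<Rightarrow> int" where fin: "finite (f ` int_span T)"
    and f: "\<And>x y. x \<in> int_span T \<Longrightarrow> y \<in> int_span T \<Longrightarrow> f x = f y \<Longrightarrow> \<exists>z\<in>int_span T. x = y + of_nat n * z"
    using int_span_residues[OF finite_T n] by blast
  define F where "F w = (\<lambda>s\<in>S. \<lambda>r\<in>S. f (act (inv w) (simple_root s) r))" for w
  show ?thesis
  proof (rule fin_indexI[where f = F])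
    show "subgroup (congruence_subgroup n) G" "subgroup (carrier G) G"
      by (rule congruence_subgroup_subgroup subgroup_self)+
    then show "congruence_subgroup n \<subseteq> carrier G" using subgroup.subset by blast
    have "F w \<in> (\<Pi>\<^sub>E s\<in>S. \<Pi>\<^sub>E r\<in>S. f ` int_span T)" if "w \<in> carrier G" for w
      using act_lattice[OF inv_closed[OF that] simple_root_lattice] unfolding F_def
      by (auto simp: lattice_def)
    then have "F ` carrier G \<subseteq> (\<Pi>\<^sub>E s\<in>S. \<Pi>\<^sub>E r\<in>S. f ` int_span T)" by blast
    moreover have "finite (\<Pi>\<^sub>E s\<in>S. \<Pi>\<^sub>E r\<in>S. f ` int_span T)" using fin finite_S by (intro finite_PiE) auto
    ultimately show "finite (F ` carrier G)" using finite_subset by blast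
    fix x y assume x: "x \<in> carrier G" and y: "y \<in> carrier G" and eq: "F x = F y"
    have ix: "inv x \<in> carrier G" and iy: "inv y \<in> carrier G" using x y by auto
    have "\<exists>z\<in>lattice. act (inv y) (simple_root s) = (\<lambda>r. 1 * act (inv x) (simple_root s) r + real n * z r)" if s: "s \<in> S" for s
    proof -
      let ?a = "act (inv y) (simple_root s)" and ?b = "act (inv x) (simple_root s)"
      have ab: "?a \<in> lattice" "?b \<in> lattice" using act_lattice simple_root_lattice[OF s] ix iy by auto
      have "\<exists>z. z \<in> int_span T \<and> ?a r = ?b r + real n * z" if r: "r \<in> S" for r
      proof -
        have "F x s r = F y s r" by (simp add: eq)
        then have "f (?a r) = f (?b r)" using s r unfolding F_def by simp
        then show ?thesis using f[of "?a r" "?b r"] ab r unfolding lattice_def by blast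
      qed
      then have "\<forall>r\<in>S. \<exists>z. z \<in> int_span T \<and> ?a r = ?b r + real n * z" by blast
      from bchoice[OF this] obtain z where z: "\<And>r. r \<in> S \<Longrightarrow> z r \<in> int_span T" "\<And>r. r \<in> S \<Longrightarrow> ?a r = ?b r + real n * z r"
        by blast
      show ?thesis
      proof (rule bexI[of _ "\<lambda>r. if r \<in> S then z r else 0"])
        show "?a = (\<lambda>r. 1 * ?b r + real n * (if r \<in> S then z r else 0))"
          using z(2) ab by (intro ext) (auto simp: lattice_def)
      qed (use z(1) in \<open>auto simp: lattice_def\<close>)
    qed
    then have "\<forall>s\<in>S. \<exists>z. z \<in> lattice \<and> act (inv y) (simple_root s) = (\<lambda>r. 1 * act (inv x) (simple_root s) r + real n * z r)" by blast
    from bchoice[OF this] obtain z where z: "\<And>s. s \<in> S \<Longrightarrow> z s \<in> lattice"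
      "\<And>s. s \<in> S \<Longrightarrow> act (inv y) (simple_root s) = (\<lambda>r. 1 * act (inv x) (simple_root s) r + real n * z s r)" by blast
    have "\<exists>u\<in>lattice. act (x \<otimes> inv y) v = (\<lambda>r. 1 * v r + real n * u r)" if v: "v \<in> lattice" for v
    proof -
      define u where "u = (\<lambda>r. \<Sum>s\<in>S. v s * z s r)"
      have u: "u \<in> lattice"
        using z(1) v unfolding lattice_def u_def by (auto intro!: int_span_sum mult_T)
      have "act (inv y) v = (\<lambda>r. \<Sum>s\<in>S. v s * act (inv y) (simple_root s) r)"
        by (subst lattice_expand[OF v]) (rule act_comb[OF iy])
      also have "\<dots> = (\<lambda>r. \<Sum>s\<in>S. v s * (1 * act (inv x) (simple_root s) r + real n * z s r))"
        by (intro ext sum.cong) (auto simp: z(2))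
      also have "\<dots> = (\<lambda>r. 1 * (\<Sum>s\<in>S. v s * act (inv x) (simple_root s) r) + real n * u r)"
        unfolding u_def by (simp add: sum.distrib sum_distrib_left algebra_simps)
      also have "(\<lambda>r. 1 * (\<Sum>s\<in>S. v s * act (inv x) (simple_root s) r) + real n * u r) =
          (\<lambda>r. 1 * act (inv x) v r + real n * u r)"
        by (subst (2) lattice_expand[OF v]) (simp add: act_comb[OF ix])
      finally have "act (x \<otimes> inv y) v = (\<lambda>r. 1 * act x (act (inv x) v) r + real n * act x u r)"
        unfolding act_mult[OF x iy] by (simp only: act_lin[OF x])
      also have "act x (act (inv x) v) = v" using act_inv_act[OF ix, of v] x by simp
      finally show ?thesis using act_lattice[OF x u] by blast
    qed
    then show "x \<otimes> inv y \<in> congruence_subgroup n"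
      using x iy unfolding congruence_subgroup_def congruent_to_one_def by blast
  qed
qed

text \<open>Minkowski's argument. If \<open>w\<close> is \<open>1 + D\<close> with \<open>D\<close> divisible by a power \<open>Q\<close> of \<open>l\<close>, then the \<open>p\<close>-th power of \<open>w\<close>
  is \<open>1 + p D\<close> modulo \<open>Q\<^sup>2\<close>. As it is \<open>1\<close> and \<open>p\<close> is invertible modulo \<open>l\<close>, the map \<open>D\<close> is divisible by
  \<open>l Q\<close>. So \<open>D\<close> is divisible by all powers of \<open>l\<close>, that is \<open>D = 0\<close>.\<close>

lemma congruence_order:
  assumes l: "Factorial_Ring.prime (l::nat)" and p: "Factorial_Ring.prime (p::nat)" "p \<noteq> l" and w: "congruent_to_one l w" and wp: "w [^] p = \<one>"
  shows "w = \<one>"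
proof -
  have wc: "w \<in> carrier G" using w unfolding congruent_to_one_def by blast
  have cong: "congruent_to_one (l ^ Suc k) w" for k
  proof (induction k)
    case (Suc k)
    let ?q = "l ^ Suc k"
    have IH: "\<And>v. v \<in> lattice \<Longrightarrow> \<exists>u\<in>lattice. act w v = (\<lambda>r. 1 * v r + real ?q * u r)"
      using Suc unfolding congruent_to_one_def by blast
    have "\<exists>u\<in>lattice. act w v = (\<lambda>r. 1 * v r + real (l ^ Suc (Suc k)) * u r)" if v: "v \<in> lattice" for v
    proof -
      obtain u where u: "u \<in> lattice" "act w v = (\<lambda>r. 1 * v r + real ?q * u r)" using IH[OF v] by blast
      obtain u' where u': "u' \<in> lattice" "act w u = (\<lambda>r. 1 * u r + real ?q * u' r)" using IH[OF u(1)] by blast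
      have "\<exists>t\<in>lattice. act (w [^] j) v = (\<lambda>r. 1 * (1 * v r + real (j * ?q) * u r) + real (?q * ?q) * t r)" for j :: nat
      proof (induction j)
        case 0
        show ?case by (rule bexI[of _ "\<lambda>_. 0"]) (auto simp: act_one lattice_def int_span_zero)
      next
        case (Suc j)
        then obtain t where t: "t \<in> lattice"
          "act (w [^] j) v = (\<lambda>r. 1 * (1 * v r + real (j * ?q) * u r) + real (?q * ?q) * t r)" by blast
        have "w [^] Suc j = w \<otimes> w [^] j" using wc by (rule nat_pow_Suc2)
        then have "act (w [^] Suc j) v = act w (\<lambda>r. 1 * (1 * v r + real (j * ?q) * u r) + real (?q * ?q) * t r)"
          using act_mult[OF wc, of "w [^] j" v] wc t(2) by simp
        also have "\<dots> = (\<lambda>r. 1 * (1 * (1 * v r + real ?q * u r) + real (j * ?q) * (1 * u r + real ?q * u' r)) + real (?q * ?q) * act w t r)"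
          unfolding act_lin[OF wc] u(2) u'(2) ..
        also have "\<dots> = (\<lambda>r. 1 * (1 * v r + real (Suc j * ?q) * u r) + real (?q * ?q) * (real j * u' r + 1 * act w t r))"
          by (intro ext) (simp add: algebra_simps)
        finally show ?case
          by (intro bexI[of _ "\<lambda>r. real j * u' r + 1 * act w t r"]
                lattice_lin[OF nat_T one_T u'(1) act_lattice[OF wc t(1)]])
      qed
      then obtain t where t: "t \<in> lattice"
        "act (w [^] p) v = (\<lambda>r. 1 * (1 * v r + real (p * ?q) * u r) + real (?q * ?q) * t r)" by blast
      have rel: "real p * u r = - (real ?q * t r)" for r
      proof -
        have "v r = v r + real (p * ?q) * u r + real (?q * ?q) * t r"
          using fun_cong[OF t(2), of r] wp by (simp add: act_one)
        then have "real ?q * (real p * u r + real ?q * t r) = 0" by (simp add: algebra_simps)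
        moreover have "real ?q \<noteq> 0" using prime_gt_0_nat[OF l] by simp
        ultimately show ?thesis by (metis add_eq_0_iff2 mult_eq_0_iff)
      qed
      have "coprime p l" using primes_coprime[OF p(1) l p(2)] .
      then have "coprime (int p) (int l)" by simp
      then obtain a b where ab: "a * int p + b * int l = 1" using bezout_int[of "int p" "int l"] by auto
      have abr: "of_int a * real p + of_int b * real l = 1"
      proof -
        have "of_int (a * int p + b * int l) = (1 :: real)" using ab by simp
        then show ?thesis by simp
      qed
      define z where "z = (\<lambda>r. of_int (- a * int (l ^ k)) * t r + of_int b * u r)"
      have z: "z \<in> lattice" unfolding z_def by (rule lattice_lin[OF int_T int_T t(1) u(1)])
      have "u r = real l * z r" for r
      proof -
        have "u r = (of_int a * real p + of_int b * real l) * u r" using abr by simp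
        also have "\<dots> = of_int a * (real p * u r) + of_int b * real l * u r" by (simp add: algebra_simps)
        also have "\<dots> = real l * z r" unfolding rel z_def by (simp add: algebra_simps)
        finally show ?thesis .
      qed
      then have "act w v = (\<lambda>r. 1 * v r + real (l ^ Suc (Suc k)) * z r)"
        unfolding u(2) by (intro ext) simp
      then show ?thesis using z by blast
    qed
    then show ?case using wc unfolding congruent_to_one_def by blast
  qed (use w in simp)
  show "w = \<one>"
  proof (rule faithful[OF wc])
    fix s assume s: "s \<in> S"
    have "act w (simple_root s) r - simple_root s r = 0" for r
    proof (cases "r \<in> S")
      case True
      show ?thesis
      proof (rule int_span_separated[OF finite_T, of l])
        show "l \<ge> 2" using l by (rule prime_ge_2_nat)
        fix k
        obtain u where u: "u \<in> lattice" "act w (simple_root s) = (\<lambda>r. 1 * simple_root s r + real (l ^ Suc k) * u r)"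
          using cong[of k] simple_root_lattice[OF s] unfolding congruent_to_one_def by blast
        have "act w (simple_root s) r - simple_root s r = real (l ^ k) * (real l * u r)" unfolding u(2) by simp
        moreover have "real l * u r \<in> int_span T" using u(1) True mult_T[OF nat_T] unfolding lattice_def by blast
        ultimately show "\<exists>y\<in>int_span T. act w (simple_root s) r - simple_root s r = of_nat (l ^ k) * y" by blast
      qed
    next
      case False
      then show ?thesis using act_support[OF wc False] by simp
    qed
    then show "act w (simple_root s) = simple_root s" by (intro ext) simp
  qed
qed

text \<open>Two different moduli are combined so that for every prime order one of them is coprime to it.\<close>

lemma congruence_torsion_free:
  assumes "w \<in> congruence_subgroup 3 \<inter> congruence_subgroup 5" "0 < n" "w [^] (n::nat) = \<one>"
  shows "w = \<one>"
  using assms(2,3)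
proof (induction n rule: less_induct)
  case (less n)
  have wc: "w \<in> carrier G" using assms(1) unfolding congruence_subgroup_def congruent_to_one_def by blast
  show ?case
  proof (cases "n = 1")
    case True
    then show ?thesis using less.prems wc by simp
  next
    case False
    then obtain p where p: "Factorial_Ring.prime p" "p dvd n" using prime_factor_nat by blast
    then obtain m where m: "n = m * p" by (metis dvd_def mult.commute)
    let ?y = "w [^] m"
    have pw: "w [^] m \<in> congruence_subgroup k" if "w \<in> congruence_subgroup k" for k
      using subgroup_int_pow_closed[OF congruence_subgroup_subgroup that, of "int m"] by (simp add: int_pow_int)
    have y: "congruent_to_one 3 ?y" "congruent_to_one 5 ?y"
      using pw assms(1) unfolding congruence_subgroup_def by auto
    have yp: "?y [^] p = \<one>" using less.prems(2) m wc by (simp add: nat_pow_pow)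
    have "?y = \<one>"
    proof (cases "p = 3")
      case True
      then show ?thesis using congruence_order[of 5 p ?y] p(1) y(2) yp by (simp add: prime_nat_numeral_eq)
    next
      case False
      then show ?thesis using congruence_order[of 3 p ?y] p(1) y(1) yp by (simp add: prime_nat_numeral_eq)
    qed
    moreover have "m < n" "0 < m" using m less.prems(1) prime_gt_1_nat[OF p(1)] by auto
    ultimately show ?thesis using less.IH by blast
  qed
qed

lemma congruence_detecting_group: "detecting_group G (congruence_subgroup 3 \<inter> congruence_subgroup 5) (card S)"
proof unfold_locales
  let ?\<Gamma> = "congruence_subgroup 3 \<inter> congruence_subgroup 5"
  have f5: "fin_index G (congruence_subgroup 5) (carrier G)" by (rule congruence_subgroup_fin_index) simp
  have f3: "fin_index G (congruence_subgroup 3) (carrier G)" by (rule congruence_subgroup_fin_index) simp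
  have "fin_index G ?\<Gamma> (congruence_subgroup 5)"
    by (rule fin_index_Int[OF f3 congruence_subgroup_subgroup])
       (use subgroup.subset[OF congruence_subgroup_subgroup] in blast)
  then show "fin_index G ?\<Gamma> (carrier G)" by (rule fin_index_trans[OF _ f5])
  show "x = \<one>" if "x \<in> ?\<Gamma>" "0 < n" "x [^] (n::nat) = \<one>" for x n by (rule congruence_torsion_free[OF that])
  show "\<exists>\<tau> :: 'a \<Rightarrow> int. (\<forall>x\<in>B. \<forall>y\<in>B. \<tau> (x \<otimes> y) = \<tau> x + \<tau> y) \<and> \<tau> a \<noteq> 0"
    if "subgroup B G" "a \<in> B" "\<And>x. x \<in> B \<Longrightarrow> a \<otimes> x = x \<otimes> a" "\<And>n. 0 < n \<Longrightarrow> a [^] (n::nat) \<noteq> \<one>" for B a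
    by (rule ra.central_element_detected[OF that])
  show "m \<le> card S"
    if "\<And>i. i < m \<Longrightarrow> b i \<in> carrier G" "\<And>i j. i < m \<Longrightarrow> j < m \<Longrightarrow> b i \<otimes> b j = b j \<otimes> b i"
      "\<And>(n :: nat \<Rightarrow> int) i. lprod G (map (\<lambda>i. b i [^] n i) [0..<m]) = \<one> \<Longrightarrow> i < m \<Longrightarrow> n i = 0" for b m
    using ra.commuting_rank_bound[of m b] that by blast
qed

end

section \<open>Virtual strong Remak decompositions of Coxeter groups\<close>

theorem corollary6p2:
  fixes W :: "('a, 'b) monoid_scheme"
  assumes "coxeter_group W"
  shows "(\<exists>H Hs. virtual_strong_Remak_decomposition W H Hs) \<and>
         (\<forall>H Hs H' Hs'. virtual_strong_Remak_decomposition W H Hs \<longrightarrow>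
            virtual_strong_Remak_decomposition W H' Hs' \<longrightarrow>
            equivalent_decompositions W Hs Hs')"
proof -
  obtain S M where SM: "finite S" "coxeter_matrix S M" "has_presentation W S (coxeter_relators S M)"
    using assms unfolding coxeter_group_def by blast
  then have "group W" unfolding has_presentation_def by blast
  have "coxeter_matrix_on S M" using SM by unfold_locales
  then obtain T where T: "finite T" "1 \<in> int_span T"
    "\<And>x y. x \<in> int_span T \<Longrightarrow> y \<in> int_span T \<Longrightarrow> x * y \<in> int_span T"
    "\<And>s t. s \<in> S \<Longrightarrow> t \<in> S \<Longrightarrow> 2 * cox_form M s t \<in> int_span T"
    by (rule coxeter_matrix_on.integral_form) blast
  interpret group W by (rule \<open>group W\<close>)
  interpret coxeter_lattice W S M T by unfold_locales (use SM T in auto)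
  interpret detecting_group W "congruence_subgroup 3 \<inter> congruence_subgroup 5" "card S" by (rule congruence_detecting_group)
  show ?thesis using virtual_strong_Remak_decomposition_exists virtual_strong_Remak_decomposition_unique by blast
qed

end
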